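(* Thompson's group $V$ has at least countably (infinitely) many commensurability classes of commensurated subgroups. Moreover, there are at least countably (infinitely) many pairwise locally non-isomorphic groups of tree almost automorphisms into which $V$ embeds densely; that is, there is an infinite family of topological groups of the form $\operatorname{AAut}_{\mathscr{P}}(\mathcal{T})$ (for trees $\mathcal{T}$ with patternings $\mathscr{P}$), no two of which have isomorphic open subgroups, such that for each member of the family there is an injective group homomorphism from $V$ into it with dense image.
   Context: **Thompson's $V$.** $V$ is the group of homeomorphisms $g$ of $\{0,1\}^{\mathbb{N}}$ for which there are finite sets of words $u_1,\dots,u_n$ and $w_1,\dots,w_n$, whose cylinder sets each partition $\{0,1\}^{\mathbb N}$, with $g(u_ix)=w_ix$ for all $i$ and all $x\in\{0,1\}^{\mathbb{N}}$. **Commensuration.** Two subgroups of a group are commensurate if their intersection has finite index in both; this is an equivalence relation, whose classes are the commensurability classes. A subgroup is commensurated if it is commensurate to each of its conjugates. Commensurability classes of commensurated subgroups are counted as classes $[U]$ of commensurated $U$. **Trees and almost automorphisms.** Let $\mathcal{T}=(\mathcal{V},\mathcal{E})$ be a locally finite tree with root $v_0$, edges oriented away from the root via $o,t\colon\mathcal{E}\to\mathcal{V}$ (so $t(e)$ is a child of $o(e)$). A finite subtree $T$ is complete if it contains $v_0$ and for each of its vertices contains all or none of its children. $\mathcal{L}T$ denotes the set of leaves (vertices without children in $T$), $\mathcal{T}_v$ the subtree of all descendants of $v$ (rooted at $v$), and $\mathcal{T}\setminus T:=\bigsqcup_{v\in\mathcal{L}T}\mathcal{T}_v$. An honest almost automorphism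 is a forest isomorphism $\varphi\colon\mathcal{T}\setminus T_1\to\mathcal{T}\setminus T_2$ with $T_1,T_2$ finite complete. Two of them, with domains $\mathcal{T}\setminus T_1$ and $\mathcal{T}\setminus T_1'$, are equivalent if they coincide on $\mathcal{T}\setminus T$ for some finite complete $T\supset T_1\cup T_1'$. The equivalence classes are the almost automorphisms; they form a group $\operatorname{AAut}(\mathcal{T})$ under composition of suitable representatives. **Patternings.** A colouring structure $\mathscr{C}=(L,\ell,\mathcal{D},\operatorname{ccol})$ on $\mathcal{T}$ consists of: a finite set $L$ of labels; a labelling $\ell\colon\mathcal{V}\setminus\{v_0\}\to L$ such that for $\ell(v)=\ell(w)$ there is a label-preserving bijection between the children of $v$ and the children of $w$, and such that for each $l\in L$ the set $\ell^{-1}(l)$ is not contained in any proper subtree of $\mathcal{T}$; a family $\mathcal{D}=\{D_{l,l'}\mid l,l'\in L\}$ of pairwise disjoint finite sets, $|D_{l,l'}|$ being the number of children with label $l'$ of any vertex with label $l$; and a map $\operatorname{ccol}\colon\mathcal{E}\setminus o^{-1}(v_0)\to\bigsqcup_{l,l'}D_{l,l'}$ which for every $v\neq v_0$ with $\ell(v)=l$ and every $l'$ restricts to a bijection $\{e\in\mathcal{E}\mid o(e)=v,\ \ell(t(e))=l'\}\to D_{l,l'}$. Put $D_l=\bigsqcup_{l'}D_{l,l'}$. A patterning $\mathscr{P}=(L,\ell,\mathcal{D},\operatorname{ccol},\mathscr{F})$ is a colouring structure together with permutation groups $\mathscr{F}=\{F_l\le\operatorname{Sym}(D_l)\mid l\in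 L\}$, each preserving every part $D_{l,l'}$. For an honest almost automorphism $\varphi\colon\mathcal{T}\setminus T_1\to\mathcal{T}\setminus T_2$ with $T_1,T_2\ne\{v_0\}$ and a vertex $v$ of $\mathcal{T}\setminus T_1$, the local permutation is $\operatorname{prm}_{\varphi,v}:=\operatorname{ccol}\circ\varphi\circ\operatorname{ccol}^{-1}|_{D_{\ell(v)}}\colon D_{\ell(v)}\to D_{\ell(\varphi(v))}$ (with $\operatorname{ccol}^{-1}$ taken on the edges with origin $v$). $\varphi$ is $\mathscr{P}$-patterning if $\ell(\varphi(v))=\ell(v)$ for all $v\in\mathcal{L}T_1$ and $\operatorname{prm}_{\varphi,v}\in F_{\ell(v)}$ for all vertices $v$ of $\mathcal{T}\setminus T_1$. $\operatorname{AAut}_{\mathscr{P}}(\mathcal{T})\le\operatorname{AAut}(\mathcal{T})$ is the group of almost automorphisms having a $\mathscr{P}$-patterning representative. $\operatorname{Aut}_{\mathscr{P}}(\mathcal{T})$ is the group of (root-fixing) automorphisms $g$ of $\mathcal{T}$ that preserve the labels of the children of $v_0$ and satisfy $\operatorname{prm}_{g,v}\in F_{\ell(v)}$ for all $v\ne v_0$. $\operatorname{AAut}_{\mathscr{P}}(\mathcal{T})$ carries the unique group topology for which $\operatorname{Aut}_{\mathscr{P}}(\mathcal{T})$, with its subspace topology from $\operatorname{Aut}(\mathcal{T})$ (topology of pointwise convergence), is an open subgroup; it is then a t.d.l.c. group. *)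

theory Defs
  imports
    "HOL-Analysis.Analysis"
    "HOL-Algebra.Bij"
    "HOL-Algebra.Coset"
    "HOL-Library.Omega_Words_Fun"
begin

section \<open>Thompson's group V\<close>

text \<open>The Cantor set is the type \<^typ>\<open>nat \<Rightarrow> bool\<close> with its product topology, finite words are
  lists, and \<open>u \<frown> x\<close> is the infinite word \<open>x\<close> prefixed by \<open>u\<close>.\<close>

definition cylinder :: "bool list \<Rightarrow> (nat \<Rightarrow> bool) set" where
  "cylinder u = range (\<lambda>x. u \<frown> x)"

definition cylinder_partition :: "bool list list \<Rightarrow> bool" where
  "cylinder_partition us \<longleftrightarrow> distinct us \<and> partition_on UNIV (cylinder ` set us)"

definition thompson_V :: "((nat \<Rightarrow> bool) \<Rightarrow> (nat \<Rightarrow> bool)) monoid" where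
  "thompson_V = (BijGroup UNIV) \<lparr>carrier :=
     {g. homeomorphic_map euclidean euclidean g \<and>
         (\<exists>us ws. length us = length ws \<and> cylinder_partition us \<and> cylinder_partition ws \<and>
            (\<forall>i < length us. \<forall>x. g (us ! i \<frown> x) = ws ! i \<frown> x))}\<rparr>"

section \<open>Commensuration\<close>

text \<open>\<open>H\<close> is meant to be a subgroup of \<open>K\<close>, and \<open>K\<close> a subgroup of \<open>G\<close>.\<close>

definition finite_index :: "('a, 'b) monoid_scheme \<Rightarrow> 'a set \<Rightarrow> 'a set \<Rightarrow> bool" where
  "finite_index G H K \<longleftrightarrow> finite (rcosets\<^bsub>G\<lparr>carrier := K\<rparr>\<^esub> H)"

definition commensurate :: "('a, 'b) monoid_scheme \<Rightarrow> 'a set \<Rightarrow> 'a set \<Rightarrow> bool" where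
  "commensurate G H K \<longleftrightarrow> subgroup H G \<and> subgroup K G \<and>
     finite_index G (H \<inter> K) H \<and> finite_index G (H \<inter> K) K"

definition commensuration :: "('a, 'b) monoid_scheme \<Rightarrow> ('a set \<times> 'a set) set" where
  "commensuration G = {(H, K). commensurate G H K}"

definition commensurated :: "('a, 'b) monoid_scheme \<Rightarrow> 'a set \<Rightarrow> bool" where
  "commensurated G H \<longleftrightarrow> subgroup H G \<and>
     (\<forall>g \<in> carrier G. commensurate G H ((g <#\<^bsub>G\<^esub> H) #>\<^bsub>G\<^esub> (inv\<^bsub>G\<^esub> g)))"

section \<open>Topological groups\<close>

definition topological_group :: "('a, 'b) monoid_scheme \<Rightarrow> 'a topology \<Rightarrow> bool" where
  "topological_group G \<tau> \<longleftrightarrow> group G \<and> topspace \<tau> = carrier G \<and>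
     continuous_map (prod_topology \<tau> \<tau>) \<tau> (\<lambda>(x, y). x \<otimes>\<^bsub>G\<^esub> y) \<and>
     continuous_map \<tau> \<tau> (\<lambda>x. inv\<^bsub>G\<^esub> x)"

definition open_subgroup :: "'a set \<Rightarrow> ('a, 'b) monoid_scheme \<Rightarrow> 'a topology \<Rightarrow> bool" where
  "open_subgroup U G \<tau> \<longleftrightarrow> subgroup U G \<and> openin \<tau> U"

definition locally_isomorphic ::
  "('a, 'c) monoid_scheme \<Rightarrow> 'a topology \<Rightarrow> ('b, 'd) monoid_scheme \<Rightarrow> 'b topology \<Rightarrow> bool" where
  "locally_isomorphic G \<tau> H \<sigma> \<longleftrightarrow>
     (\<exists>U W f. open_subgroup U G \<tau> \<and> open_subgroup W H \<sigma> \<and>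
        f \<in> iso (G\<lparr>carrier := U\<rparr>) (H\<lparr>carrier := W\<rparr>) \<and>
        homeomorphic_map (subtopology \<tau> U) (subtopology \<sigma> W) f)"

definition embeds_densely ::
  "('a, 'c) monoid_scheme \<Rightarrow> ('b, 'd) monoid_scheme \<Rightarrow> 'b topology \<Rightarrow> bool" where
  "embeds_densely G H \<sigma> \<longleftrightarrow>
     (\<exists>f \<in> hom G H. inj_on f (carrier G) \<and> \<sigma> closure_of (f ` carrier G) = carrier H)"

section \<open>Rooted trees\<close>

text \<open>Edges are pairs \<open>e = (o e, t e)\<close> pointing away from the root, so the origin and terminus maps
  are \<^const>\<open>fst\<close> and \<^const>\<open>snd\<close>. The root is \<open>base T\<close>.\<close>

record 'v rooted_tree =
  verts :: "'v set"
  edges :: "('v \<times> 'v) set"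
  base :: 'v

definition adjacency :: "('v, 'x) rooted_tree_scheme \<Rightarrow> ('v \<times> 'v) set" where
  "adjacency T = edges T \<union> (edges T)\<inverse>"

text \<open>Connected subgraphs of a tree are induced subgraphs, so they are given by their vertex sets.\<close>

definition connected_in :: "('v, 'x) rooted_tree_scheme \<Rightarrow> 'v set \<Rightarrow> bool" where
  "connected_in T S \<longleftrightarrow> S \<subseteq> verts T \<and> (\<forall>u \<in> S. \<forall>v \<in> S. (u, v) \<in> (adjacency T \<inter> S \<times> S)\<^sup>*)"

definition is_cycle :: "('v, 'x) rooted_tree_scheme \<Rightarrow> 'v list \<Rightarrow> bool" where
  "is_cycle T p \<longleftrightarrow> length p \<ge> 3 \<and> distinct p \<and>
     successively (\<lambda>u v. (u, v) \<in> adjacency T) p \<and> (last p, hd p) \<in> adjacency T"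

text \<open>A locally finite tree (a connected simple graph without cycles) whose edges are oriented away
  from the root; the last condition is the orientation.\<close>

definition locally_finite_rooted_tree :: "('v, 'x) rooted_tree_scheme \<Rightarrow> bool" where
  "locally_finite_rooted_tree T \<longleftrightarrow>
     base T \<in> verts T \<and>
     edges T \<subseteq> verts T \<times> verts T \<and>
     irrefl (edges T) \<and> edges T \<inter> (edges T)\<inverse> = {} \<and>
     connected_in T (verts T) \<and>
     (\<forall>p. \<not> is_cycle T p) \<and>
     (\<forall>v \<in> verts T. finite (adjacency T `` {v})) \<and>
     (\<forall>v \<in> verts T. (base T, v) \<in> (edges T)\<^sup>*)"

definition children :: "('v, 'x) rooted_tree_scheme \<Rightarrow> 'v \<Rightarrow> 'v set" where
  "children T v = edges T `` {v}"

definition descendants :: "('v, 'x) rooted_tree_scheme \<Rightarrow> 'v \<Rightarrow> 'v set" where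
  "descendants T v = (edges T)\<^sup>* `` {v}"

definition finite_complete :: "('v, 'x) rooted_tree_scheme \<Rightarrow> 'v set \<Rightarrow> bool" where
  "finite_complete T S \<longleftrightarrow> finite S \<and> connected_in T S \<and> base T \<in> S \<and>
     (\<forall>v \<in> S. children T v \<subseteq> S \<or> children T v \<inter> S = {})"

definition leaves :: "('v, 'x) rooted_tree_scheme \<Rightarrow> 'v set \<Rightarrow> 'v set" where
  "leaves T S = {v \<in> S. children T v \<inter> S = {}}"

text \<open>The vertices of the forest \<open>T \<setminus> S\<close>. Note that they include the leaves of \<open>S\<close>. The edges of the
  forest are the edges of \<open>T\<close> between these vertices.\<close>

definition forest :: "('v, 'x) rooted_tree_scheme \<Rightarrow> 'v set \<Rightarrow> 'v set" where
  "forest T S = (\<Union>v \<in> leaves T S. descendants T v)"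

section \<open>Almost automorphisms\<close>

text \<open>Honest almost automorphisms are partial maps defined exactly on the vertices of the first
  forest. As the trees of a forest are rooted, forest isomorphisms preserve the orientation of edges.\<close>

definition honest :: "('v, 'x) rooted_tree_scheme \<Rightarrow> 'v set \<Rightarrow> 'v set \<Rightarrow> ('v \<rightharpoonup> 'v) \<Rightarrow> bool" where
  "honest T S\<^sub>1 S\<^sub>2 \<phi> \<longleftrightarrow> finite_complete T S\<^sub>1 \<and> finite_complete T S\<^sub>2 \<and>
     dom \<phi> = forest T S\<^sub>1 \<and> bij_betw (the \<circ> \<phi>) (forest T S\<^sub>1) (forest T S\<^sub>2) \<and>
     (\<forall>u \<in> forest T S\<^sub>1. \<forall>v \<in> forest T S\<^sub>1.
        (u, v) \<in> edges T \<longleftrightarrow> (the (\<phi> u), the (\<phi> v)) \<in> edges T)"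

definition honest_aauts :: "('v, 'x) rooted_tree_scheme \<Rightarrow> ('v \<rightharpoonup> 'v) set" where
  "honest_aauts T = {\<phi>. \<exists>S\<^sub>1 S\<^sub>2. honest T S\<^sub>1 S\<^sub>2 \<phi>}"

definition aaut_rel :: "('v, 'x) rooted_tree_scheme \<Rightarrow> (('v \<rightharpoonup> 'v) \<times> ('v \<rightharpoonup> 'v)) set" where
  "aaut_rel T = {(\<phi>, \<phi>'). \<exists>S\<^sub>1 S\<^sub>2 S\<^sub>1' S\<^sub>2'. honest T S\<^sub>1 S\<^sub>2 \<phi> \<and> honest T S\<^sub>1' S\<^sub>2' \<phi>' \<and>
     (\<exists>S. finite_complete T S \<and> S\<^sub>1 \<union> S\<^sub>1' \<subseteq> S \<and> (\<forall>v \<in> forest T S. \<phi> v = \<phi>' v))}"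

text \<open>The product of \<open>x\<close> and \<open>y\<close> is the class of all composites \<open>\<psi> \<circ> \<phi>\<close> of representatives such that
  the image forest of \<open>\<phi>\<close> is the domain of \<open>\<psi>\<close>.\<close>

definition AAut :: "('v, 'x) rooted_tree_scheme \<Rightarrow> ('v \<rightharpoonup> 'v) set monoid" where
  "AAut T =
     \<lparr>carrier = honest_aauts T // aaut_rel T,
      mult = (\<lambda>x y. aaut_rel T `` {\<psi> \<circ>\<^sub>m \<phi> | \<psi> \<phi>. \<psi> \<in> x \<and> \<phi> \<in> y \<and> dom \<psi> = ran \<phi>}),
      one = aaut_rel T `` {Some |` verts T}\<rparr>"

section \<open>Patternings\<close>

text \<open>The label of the root and the colours of the edges at the root are never used.\<close>

record ('v, 'l, 'c) colouring =
  labels :: "'l set"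
  lab :: "'v \<Rightarrow> 'l"
  cols :: "'l \<Rightarrow> 'l \<Rightarrow> 'c set"
  ccol :: "'v \<times> 'v \<Rightarrow> 'c"

record ('v, 'l, 'c) patterning = "('v, 'l, 'c) colouring" +
  perms :: "'l \<Rightarrow> ('c \<Rightarrow> 'c) set"

definition out_edges :: "('v, 'x) rooted_tree_scheme \<Rightarrow> 'v \<Rightarrow> ('v \<times> 'v) set" where
  "out_edges T v = {e \<in> edges T. fst e = v}"

definition all_cols :: "('v, 'l, 'c, 'y) colouring_scheme \<Rightarrow> 'l \<Rightarrow> 'c set" where
  "all_cols C l = (\<Union>l' \<in> labels C. cols C l l')"

definition is_colouring ::
  "('v, 'x) rooted_tree_scheme \<Rightarrow> ('v, 'l, 'c, 'y) colouring_scheme \<Rightarrow> bool" where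
  "is_colouring T C \<longleftrightarrow>
     finite (labels C) \<and>
     lab C ` (verts T - {base T}) \<subseteq> labels C \<and>
     (\<forall>v \<in> verts T - {base T}. \<forall>w \<in> verts T - {base T}. lab C v = lab C w \<longrightarrow>
        (\<exists>f. bij_betw f (children T v) (children T w) \<and>
             (\<forall>u \<in> children T v. lab C (f u) = lab C u))) \<and>
     (\<forall>l \<in> labels C. \<forall>S. connected_in T S \<and> {v \<in> verts T - {base T}. lab C v = l} \<subseteq> S
        \<longrightarrow> S = verts T) \<and>
     (\<forall>l \<in> labels C. \<forall>l' \<in> labels C. finite (cols C l l')) \<and>
     disjoint_family_on (\<lambda>(l, l'). cols C l l') (labels C \<times> labels C) \<and>
     (\<forall>v \<in> verts T - {base T}. \<forall>l' \<in> labels C.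
        card (cols C (lab C v) l') = card {u \<in> children T v. lab C u = l'} \<and>
        bij_betw (ccol C) {e \<in> out_edges T v. lab C (snd e) = l'} (cols C (lab C v) l'))"

text \<open>The symmetric group on a set \<open>D\<close> is \<^term>\<open>BijGroup D\<close>, whose elements are extensional functions.\<close>

definition is_patterning ::
  "('v, 'x) rooted_tree_scheme \<Rightarrow> ('v, 'l, 'c, 'y) patterning_scheme \<Rightarrow> bool" where
  "is_patterning T P \<longleftrightarrow> is_colouring T P \<and>
     (\<forall>l \<in> labels P. subgroup (perms P l) (BijGroup (all_cols P l)) \<and>
        (\<forall>f \<in> perms P l. \<forall>l' \<in> labels P. f ` cols P l l' = cols P l l'))"

definition local_perm ::
  "('v, 'x) rooted_tree_scheme \<Rightarrow> ('v, 'l, 'c, 'y) colouring_scheme \<Rightarrow>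
     ('v \<Rightarrow> 'v) \<Rightarrow> 'v \<Rightarrow> 'c \<Rightarrow> 'c" where
  "local_perm T C \<phi> v =
     (\<lambda>c \<in> all_cols C (lab C v). ccol C (map_prod \<phi> \<phi> (inv_into (out_edges T v) (ccol C) c)))"

definition patterned ::
  "('v, 'x) rooted_tree_scheme \<Rightarrow> ('v, 'l, 'c, 'y) patterning_scheme \<Rightarrow> ('v \<rightharpoonup> 'v) \<Rightarrow> bool" where
  "patterned T P \<phi> \<longleftrightarrow> (\<exists>S\<^sub>1 S\<^sub>2. honest T S\<^sub>1 S\<^sub>2 \<phi> \<and> S\<^sub>1 \<noteq> {base T} \<and> S\<^sub>2 \<noteq> {base T} \<and>
     (\<forall>v \<in> leaves T S\<^sub>1. lab P (the (\<phi> v)) = lab P v) \<and>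
     (\<forall>v \<in> forest T S\<^sub>1. local_perm T P (the \<circ> \<phi>) v \<in> perms P (lab P v)))"

definition AAut_pat ::
  "('v, 'x) rooted_tree_scheme \<Rightarrow> ('v, 'l, 'c, 'y) patterning_scheme \<Rightarrow> ('v \<rightharpoonup> 'v) set monoid" where
  "AAut_pat T P = (AAut T)\<lparr>carrier := {x \<in> carrier (AAut T). \<exists>\<phi> \<in> x. patterned T P \<phi>}\<rparr>"

section \<open>The topology\<close>

definition Aut :: "('v, 'x) rooted_tree_scheme \<Rightarrow> ('v \<Rightarrow> 'v) set" where
  "Aut T = {g \<in> Bij (verts T). g (base T) = base T \<and>
     (\<forall>u \<in> verts T. \<forall>v \<in> verts T. (u, v) \<in> edges T \<longleftrightarrow> (g u, g v) \<in> edges T)}"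

definition Aut_pat ::
  "('v, 'x) rooted_tree_scheme \<Rightarrow> ('v, 'l, 'c, 'y) patterning_scheme \<Rightarrow> ('v \<Rightarrow> 'v) set" where
  "Aut_pat T P = {g \<in> Aut T.
     (\<forall>v \<in> children T (base T). lab P (g v) = lab P v) \<and>
     (\<forall>v \<in> verts T - {base T}. local_perm T P g v \<in> perms P (lab P v))}"

definition Aut_topology :: "('v, 'x) rooted_tree_scheme \<Rightarrow> ('v \<Rightarrow> 'v) topology" where
  "Aut_topology T =
     subtopology (product_topology (\<lambda>_. discrete_topology (verts T)) (verts T)) (Aut T)"

definition aaut_of_aut :: "('v, 'x) rooted_tree_scheme \<Rightarrow> ('v \<Rightarrow> 'v) \<Rightarrow> ('v \<rightharpoonup> 'v) set" where
  "aaut_of_aut T g = aaut_rel T `` {(Some \<circ> g) |` verts T}"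

text \<open>The unique group topology for which the group of patterned automorphisms, embedded by
  \<^const>\<open>aaut_of_aut\<close> and carrying the topology of pointwise convergence, is an open subgroup.\<close>

definition AAut_pat_topology ::
  "('v, 'x) rooted_tree_scheme \<Rightarrow> ('v, 'l, 'c, 'y) patterning_scheme \<Rightarrow>
     ('v \<rightharpoonup> 'v) set topology" where
  "AAut_pat_topology T P = (THE \<tau>.
     topological_group (AAut_pat T P) \<tau> \<and>
     open_subgroup (aaut_of_aut T ` Aut_pat T P) (AAut_pat T P) \<tau> \<and>
     embedding_map (subtopology (Aut_topology T) (Aut_pat T P)) \<tau> (aaut_of_aut T))"

end

theory Submission
  imports Defs "HOL-Computational_Algebra.Primes"
begin

text \<open>The idea is to let \<open>V\<close> act on one and the same Cantor set through different trees. Fix \<open>m \<ge> 2\<close> and cut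
binary words into tokens: at the start and after a letter \<open>0\<close> the next token is one of
\<open>0, 10, 110, \<dots>, 1\<^sup>m\<^sup>-\<^sup>1 0, 1\<^sup>m\<close>, and after a letter \<open>1\<close> it is a single letter. Every infinite word is cut in
exactly one way, so finite token sequences form a tree whose boundary is the Cantor set. Labelling a
vertex by its last letter gives a colouring in which a vertex labelled \<open>0\<close> has \<open>m\<close> children labelled
\<open>0\<close>; let the local group rotate these cyclically, and let the other local group be trivial.

Which prefixes of a word are vertices, and with which label, can be read off their last \<open>m\<close> letters:
apart from the root, a vertex ends in \<open>0\<close> or in \<open>1\<^sup>m\<close>. So replacing a prefix \<open>u\<close> by a prefix \<open>w\<close> carries all long enough
vertices below \<open>u\<close> to vertices below \<open>w\<close> and keeps labels and colours. This embeds \<open>V\<close> into the group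
\<open>G\<^sub>m\<close> of patterned almost automorphisms (\<open>embed_hom\<close>, \<open>embed_inj\<close>). The image is dense for a reason
that has nothing to do with the local groups: a patterned map can be followed down to a deep level
and continued below that level by keeping colours, and a map of the latter kind is a prefix
replacement (\<open>level_realised\<close>, \<open>embed_dense\<close>).

The number \<open>m\<close> is visible in torsion near the identity. Rotating the children of one deep vertex
gives elements of order \<open>m\<close> in every neighbourhood of the identity of \<open>G\<^sub>m\<close>. If \<open>p\<close> is coprime to \<open>m\<close>,
then no nontrivial automorphism fixing the first level satisfies \<open>g\<^sup>p = 1\<close>: a moved vertex of least
depth has a fixed parent, and there the local permutation is a rotation whose \<open>p\<close>-th power fixes a
colour, hence which fixes that colour itself (\<open>no_coprime_torsion\<close>). Therefore \<open>G\<^sub>p\<close> and \<open>G\<^sub>q\<close> are not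
locally isomorphic for distinct primes (\<open>not_locally_isomorphic_if_torsion\<close>). The same contrast
separates commensurability classes. The preimage \<open>U\<^sub>m\<close> of \<open>Aut\<^sub>P(T)\<close> in \<open>V\<close> is commensurated, because
conjugates of \<open>Aut\<^sub>P(T)\<close> contain stabilisers of large balls, which have finite index
(\<open>commensurated_preimage\<close>). It contains infinitely many commuting elements of order \<open>m\<close>. Were \<open>U\<^sub>p\<close>
commensurate to \<open>U\<^sub>q\<close>, a quotient of two such elements of \<open>U\<^sub>p\<close> would act trivially on the first level of the
tree for \<open>q\<close>, which is impossible (\<open>not_commensurate_if_torsion\<close>).

The groups themselves become manageable through two remarks. In a tree without leaves the forests
\<open>T \<setminus> S\<close> are exactly the cofinite sets of vertices that are closed under children
(\<open>cofinite_forest_forest\<close>, \<open>forest_of_cofinite\<close>), and equivalence of honest almost automorphisms means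
agreement off a finite set (\<open>aaut_rel_iff\<close>). Partial isomorphisms between cofinite forests can be
composed without matching domains and inverted, so products of classes are computed on arbitrary
representatives (\<open>germ_mult\<close>). Stabilisers of balls then give a neighbourhood basis of the
identity that is stable under conjugation, which both produces the topology and, together with its
uniqueness, identifies it (\<open>AAut_pat_topology_eq\<close>).\<close>

section \<open>Groups filtered by subgroups\<close>

definition filtration_topology :: "('a, 'b) monoid_scheme \<Rightarrow> (nat \<Rightarrow> 'a set) \<Rightarrow> 'a topology" where
  "filtration_topology G W =
     topology (\<lambda>A. A \<subseteq> carrier G \<and> (\<forall>x\<in>A. \<exists>n. \<forall>u\<in>W n. x \<otimes>\<^bsub>G\<^esub> u \<in> A))"

locale filtered_group = group G for G (structure) +
  fixes W :: "nat \<Rightarrow> 'a set"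
  assumes W_subgroup: "subgroup (W n) G"
    and W_antimono: "n \<le> m \<Longrightarrow> W m \<subseteq> W n"
    and W_conj: "x \<in> carrier G \<Longrightarrow> \<exists>m. \<forall>u\<in>W m. x \<otimes> u \<otimes> inv x \<in> W n"
begin

lemma W_carrier: "u \<in> W n \<Longrightarrow> u \<in> carrier G"
  using W_subgroup subgroup.mem_carrier by metis

lemma openin_filtration_topology:
  "openin (filtration_topology G W) A \<longleftrightarrow>
     A \<subseteq> carrier G \<and> (\<forall>x\<in>A. \<exists>n. \<forall>u\<in>W n. x \<otimes> u \<in> A)"
proof -
  let ?P = "\<lambda>A. A \<subseteq> carrier G \<and> (\<forall>x\<in>A. \<exists>n. \<forall>u\<in>W n. x \<otimes> u \<in> A)"
  have "istopology ?P"
    unfolding istopology_def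
  proof (intro conjI allI impI)
    fix A B assume AB: "?P A" "?P B"
    have "\<exists>n. \<forall>u\<in>W n. x \<otimes> u \<in> A \<inter> B" if "x \<in> A \<inter> B" for x
    proof -
      from AB that obtain i j where ij: "\<forall>u\<in>W i. x \<otimes> u \<in> A" "\<forall>u\<in>W j. x \<otimes> u \<in> B" by blast
      have "W (max i j) \<subseteq> W i" "W (max i j) \<subseteq> W j" by (auto intro!: W_antimono)
      then show ?thesis using ij by blast
    qed
    then show "\<forall>x\<in>A \<inter> B. \<exists>n. \<forall>u\<in>W n. x \<otimes> u \<in> A \<inter> B" by blast
    show "A \<inter> B \<subseteq> carrier G" using AB by blast
  next
    fix \<K> assume K: "\<forall>A\<in>\<K>. ?P A"
    show "\<Union>\<K> \<subseteq> carrier G" using K by blast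
    show "\<forall>x\<in>\<Union>\<K>. \<exists>n. \<forall>u\<in>W n. x \<otimes> u \<in> \<Union>\<K>"
    proof
      fix x assume "x \<in> \<Union>\<K>"
      then obtain A where "A \<in> \<K>" "x \<in> A" by blast
      then have "\<exists>n. \<forall>u\<in>W n. x \<otimes> u \<in> A" using K by simp
      then show "\<exists>n. \<forall>u\<in>W n. x \<otimes> u \<in> \<Union>\<K>" using \<open>A \<in> \<K>\<close> by (meson UnionI)
    qed
  qed
  then show ?thesis unfolding filtration_topology_def by (simp add: topology_inverse')
qed

lemma topspace_filtration_topology: "topspace (filtration_topology G W) = carrier G"
proof
  show "topspace (filtration_topology G W) \<subseteq> carrier G"
    using openin_filtration_topology openin_topspace by blast
  have "openin (filtration_topology G W) (carrier G)"
    unfolding openin_filtration_topology using W_carrier by auto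
  then show "carrier G \<subseteq> topspace (filtration_topology G W)" by (rule openin_subset)
qed

lemma openin_coset: "x \<in> carrier G \<Longrightarrow> openin (filtration_topology G W) ((\<lambda>u. x \<otimes> u) ` W n)"
proof -
  assume x: "x \<in> carrier G"
  have "x \<otimes> v \<otimes> u \<in> (\<lambda>u. x \<otimes> u) ` W n" if "v \<in> W n" "u \<in> W n" for u v
  proof (rule image_eqI)
    show "x \<otimes> v \<otimes> u = x \<otimes> (v \<otimes> u)" using x that W_carrier m_assoc by blast
    show "v \<otimes> u \<in> W n" using that W_subgroup subgroup.m_closed by metis
  qed
  then have "\<forall>y\<in>(\<lambda>u. x \<otimes> u) ` W n. \<forall>u\<in>W n. y \<otimes> u \<in> (\<lambda>u. x \<otimes> u) ` W n"
    by blast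
  moreover have "(\<lambda>u. x \<otimes> u) ` W n \<subseteq> carrier G" using x W_carrier by auto
  ultimately show ?thesis unfolding openin_filtration_topology by blast
qed

lemma one_in_W: "\<one> \<in> W n"
  using W_subgroup subgroup.one_closed by metis

lemma openin_W: "openin (filtration_topology G W) (W n)"
  using openin_coset[of \<one> n] W_carrier by (simp cong: image_cong)

text \<open>The condition on conjugates is what makes multiplication continuous:
  \<open>x W\<^sub>m \<cdot> y W\<^sub>n = x y \<cdot> (y\<inverse> W\<^sub>m y) W\<^sub>n\<close>.\<close>

theorem topological_group_filtration: "topological_group G (filtration_topology G W)"
  unfolding topological_group_def
proof (intro conjI)
  let ?\<tau> = "filtration_topology G W"
  show "group G" by (rule is_group)
  show "topspace ?\<tau> = carrier G" by (rule topspace_filtration_topology)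
  show "continuous_map ?\<tau> ?\<tau> (\<lambda>x. inv x)"
    unfolding continuous_map topspace_filtration_topology
  proof (intro conjI allI impI)
    show "(\<lambda>x. inv x) ` carrier G \<subseteq> carrier G" by auto
  next
    fix B assume B: "openin ?\<tau> B"
    show "openin ?\<tau> {x \<in> carrier G. inv x \<in> B}"
      unfolding openin_filtration_topology
    proof (intro conjI ballI)
      fix x assume x: "x \<in> {x \<in> carrier G. inv x \<in> B}"
      then obtain n where n: "\<forall>u\<in>W n. inv x \<otimes> u \<in> B" using B openin_filtration_topology by blast
      obtain m where m: "\<forall>u\<in>W m. x \<otimes> u \<otimes> inv x \<in> W n" using W_conj x by blast
      have "x \<otimes> u \<in> {x \<in> carrier G. inv x \<in> B}" if u: "u \<in> W m" for u
      proof -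
        have c: "x \<in> carrier G" "u \<in> carrier G" "inv u \<in> W m"
          using x u W_carrier subgroup.m_inv_closed[OF W_subgroup] by auto
        then have "inv x \<otimes> (x \<otimes> inv u \<otimes> inv x) \<in> B" using m n by blast
        moreover have "inv x \<otimes> (x \<otimes> inv u \<otimes> inv x) = inv (x \<otimes> u)"
          using c by (simp add: inv_mult_group m_assoc[symmetric])
        ultimately show ?thesis using c by simp
      qed
      then show "\<exists>n. \<forall>u\<in>W n. x \<otimes> u \<in> {x \<in> carrier G. inv x \<in> B}" by blast
    qed auto
  qed
  show "continuous_map (prod_topology ?\<tau> ?\<tau>) ?\<tau> (\<lambda>(x, y). x \<otimes> y)"
    unfolding continuous_map topspace_filtration_topology topspace_prod_topology
  proof (intro conjI allI impI)
    show "(\<lambda>(x, y). x \<otimes> y) ` (carrier G \<times> carrier G) \<subseteq> carrier G" by auto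
  next
    fix B assume B: "openin ?\<tau> B"
    let ?S = "{p \<in> carrier G \<times> carrier G. (case p of (x, y) \<Rightarrow> x \<otimes> y) \<in> B}"
    show "openin (prod_topology ?\<tau> ?\<tau>) ?S"
      unfolding openin_prod_topology_alt
    proof (intro allI impI)
      fix x y assume "(x, y) \<in> ?S"
      then have xy: "x \<in> carrier G" "y \<in> carrier G" "x \<otimes> y \<in> B" by auto
      then obtain n where n: "\<forall>u\<in>W n. x \<otimes> y \<otimes> u \<in> B" using B openin_filtration_topology by blast
      obtain m where m: "\<forall>u\<in>W m. inv y \<otimes> u \<otimes> inv (inv y) \<in> W n"
        using W_conj[of "inv y"] xy by blast
      have "(x \<otimes> u) \<otimes> (y \<otimes> v) \<in> B" if uv: "u \<in> W m" "v \<in> W n" for u v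
      proof -
        have c: "u \<in> carrier G" "v \<in> carrier G" using uv W_carrier by auto
        have "inv y \<otimes> u \<otimes> y \<otimes> v \<in> W n"
          using m uv xy(2) subgroup.m_closed[OF W_subgroup] by fastforce
        then have "x \<otimes> y \<otimes> (inv y \<otimes> u \<otimes> y \<otimes> v) \<in> B" using n by blast
        moreover have "x \<otimes> y \<otimes> (inv y \<otimes> u \<otimes> y \<otimes> v) = (x \<otimes> u) \<otimes> (y \<otimes> v)"
        proof -
          have "y \<otimes> (inv y \<otimes> (u \<otimes> (y \<otimes> v))) = u \<otimes> (y \<otimes> v)"
            using c xy by (simp add: m_assoc[symmetric])
          then show ?thesis using c xy by (simp add: m_assoc)
        qed
        ultimately show ?thesis by simp
      qed
      then have "(\<lambda>u. x \<otimes> u) ` W m \<times> (\<lambda>u. y \<otimes> u) ` W n \<subseteq> ?S" using xy W_carrier by auto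
      moreover have "x \<in> (\<lambda>u. x \<otimes> u) ` W m" "y \<in> (\<lambda>u. y \<otimes> u) ` W n"
        using one_in_W xy by force+
      ultimately show "\<exists>U V. openin ?\<tau> U \<and> openin ?\<tau> V \<and> x \<in> U \<and> y \<in> V \<and> U \<times> V \<subseteq> ?S"
        using openin_coset xy by meson
    qed
  qed
qed

end

text \<open>Left translations move a neighbourhood of any point to one of the identity, where it may be
intersected with \<open>U\<close> and compared.\<close>

lemma group_topology_le_if_open_subgroup:
  assumes \<tau>: "topological_group G \<tau>" and \<sigma>: "topological_group G \<sigma>"
    and U: "open_subgroup U G \<tau>" "open_subgroup U G \<sigma>"
    and eq: "subtopology \<tau> U = subtopology \<sigma> U" and A: "openin \<tau> A"
  shows "openin \<sigma> A"
proof -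
  interpret group G using \<tau> by (simp add: topological_group_def)
  have translate: "openin \<rho> {u \<in> carrier G. x \<otimes>\<^bsub>G\<^esub> u \<in> B}"
    if "topological_group G \<rho>" "x \<in> carrier G" "openin \<rho> B" for \<rho> x B
  proof -
    have \<rho>: "topspace \<rho> = carrier G" "continuous_map (prod_topology \<rho> \<rho>) \<rho> (\<lambda>(x, y). x \<otimes>\<^bsub>G\<^esub> y)"
      using that by (auto simp: topological_group_def)
    have "continuous_map \<rho> (prod_topology \<rho> \<rho>) (\<lambda>u. (x, u))"
      using that \<rho> by (simp add: continuous_map_pairwise o_def)
    then have "continuous_map \<rho> \<rho> (\<lambda>u. x \<otimes>\<^bsub>G\<^esub> u)"
      using continuous_map_compose[of \<rho> _ "\<lambda>u. (x, u)", OF _ \<rho>(2)] by (simp add: comp_def)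
    then show ?thesis using that \<rho> by (auto simp: continuous_map)
  qed
  have AG: "A \<subseteq> carrier G" using A \<tau> openin_subset by (fastforce simp: topological_group_def)
  have "\<exists>B. openin \<sigma> B \<and> x \<in> B \<and> B \<subseteq> A" if x: "x \<in> A" for x
  proof -
    have xG: "x \<in> carrier G" using x AG by blast
    let ?C = "{u \<in> carrier G. x \<otimes>\<^bsub>G\<^esub> u \<in> A} \<inter> U"
    have "openin (subtopology \<tau> U) ?C"
      using translate[OF \<tau> xG A] by (meson openin_subtopology)
    then have "openin (subtopology \<sigma> U) ?C" by (simp add: eq)
    then have C: "openin \<sigma> ?C" using U(2) openin_open_subtopology unfolding open_subgroup_def by blast
    let ?B = "{y \<in> carrier G. inv\<^bsub>G\<^esub> x \<otimes>\<^bsub>G\<^esub> y \<in> ?C}"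
    have "openin \<sigma> ?B" using translate[OF \<sigma> _ C] xG by blast
    moreover have "x \<in> ?B"
      using xG x U(1) by (auto simp: open_subgroup_def subgroup.one_closed)
    moreover have "?B \<subseteq> A"
      using xG by (auto simp: m_assoc[symmetric])
    ultimately show ?thesis by blast
  qed
  then show ?thesis using openin_subopen by metis
qed

lemma embedding_image_subtopology:
  assumes "embedding_map X \<tau> f"
  shows "openin (subtopology \<tau> (f ` topspace X)) B \<longleftrightarrow>
    B \<subseteq> f ` topspace X \<and> openin X {x \<in> topspace X. f x \<in> B}"
proof -
  have h: "homeomorphic_map X (subtopology \<tau> (f ` topspace X)) f"
    using assms by (simp add: embedding_map_def)
  have im: "f ` topspace X = topspace (subtopology \<tau> (f ` topspace X))"
    using h homeomorphic_imp_surjective_map by blast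
  have "openin X U \<longleftrightarrow> openin (subtopology \<tau> (f ` topspace X)) (f ` U)" if "U \<subseteq> topspace X" for U
    using homeomorphic_map_openness[OF h that] by simp
  moreover have "f ` {x \<in> topspace X. f x \<in> B} = B" if "B \<subseteq> f ` topspace X"
    using that by auto
  ultimately show ?thesis
    using im openin_subset[of _ B] by (metis (no_types, lifting) mem_Collect_eq subsetI)
qed

text \<open>Both topologies are determined by the neighbourhoods of the identity, which may be
  taken inside the common open subgroup.\<close>

lemma group_topology_unique:
  assumes "topological_group G \<tau>" "topological_group G \<sigma>"
    and U: "open_subgroup (e ` topspace X) G \<tau>" "open_subgroup (e ` topspace X) G \<sigma>"
    and e: "embedding_map X \<tau> e" "embedding_map X \<sigma> e"
  shows "\<tau> = \<sigma>"
proof -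
  have eq: "subtopology \<tau> (e ` topspace X) = subtopology \<sigma> (e ` topspace X)"
    unfolding topology_eq embedding_image_subtopology[OF e(1)] embedding_image_subtopology[OF e(2)]
    by simp
  have "openin \<tau> A \<longleftrightarrow> openin \<sigma> A" for A
    using group_topology_le_if_open_subgroup[OF assms(1,2) U eq]
      group_topology_le_if_open_subgroup[OF assms(2,1) U(2,1) eq[symmetric]] by blast
  then show ?thesis unfolding topology_eq by blast
qed

text \<open>A map on \<open>K\<close> that takes finitely many values and separates the right cosets of \<open>H\<close> bounds the index. Below it is
the action on a finite ball.\<close>

lemma rcosets_finiteI:
  assumes G: "group G" and H: "subgroup H G" and K: "subgroup K G" and HK: "H \<subseteq> K"
    and fin: "finite (F ` K)"
    and F: "\<And>a b. a \<in> K \<Longrightarrow> b \<in> K \<Longrightarrow> F a = F b \<Longrightarrow> a \<otimes>\<^bsub>G\<^esub> inv\<^bsub>G\<^esub> b \<in> H"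
  shows "finite_index G H K"
proof -
  interpret group G by fact
  have rc: "rcosets\<^bsub>G\<lparr>carrier := K\<rparr>\<^esub> H = (\<lambda>a. H #>\<^bsub>G\<^esub> a) ` K"
    by (auto simp: RCOSETS_def r_coset_def)
  have eq: "H #>\<^bsub>G\<^esub> a = H #>\<^bsub>G\<^esub> b" if "a \<in> K" "b \<in> K" "F a = F b" for a b
  proof -
    have "a \<in> carrier G" "b \<in> carrier G" using that subgroup.mem_carrier[OF K] by auto
    moreover have "a \<otimes>\<^bsub>G\<^esub> inv\<^bsub>G\<^esub> b \<in> H" using F that by blast
    ultimately have "a \<in> H #>\<^bsub>G\<^esub> b"
      unfolding r_coset_def by (force simp: m_assoc)
    then show ?thesis using repr_independence[OF _ _ H] \<open>b \<in> carrier G\<close> by metis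
  qed
  have "(\<lambda>a. H #>\<^bsub>G\<^esub> a) ` K = (\<lambda>z. H #>\<^bsub>G\<^esub> (SOME a. a \<in> K \<and> F a = z)) ` F ` K"
    unfolding image_image
  proof (rule image_cong[OF refl])
    fix a assume "a \<in> K"
    then have "(SOME b. b \<in> K \<and> F b = F a) \<in> K \<and> F (SOME b. b \<in> K \<and> F b = F a) = F a"
      by (metis (mono_tags, lifting) someI_ex)
    then show "H #>\<^bsub>G\<^esub> a = H #>\<^bsub>G\<^esub> (SOME b. b \<in> K \<and> F b = F a)"
      using eq \<open>a \<in> K\<close> by metis
  qed
  then show ?thesis unfolding finite_index_def rc using fin by simp
qed

section \<open>Commensurability and local isomorphism detected by torsion\<close>

lemma (in group) cancel_left:
  assumes "g \<in> carrier G" "x \<in> carrier G"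
  shows "inv g \<otimes> (g \<otimes> x) = x" "g \<otimes> (inv g \<otimes> x) = x"
  using assms by (simp_all add: m_assoc[symmetric])

lemma (in group) conjugate_eq:
  assumes g: "g \<in> carrier G" and H: "H \<subseteq> carrier G"
  shows "(g <# H) #> (inv g) = {x \<in> carrier G. inv g \<otimes> x \<otimes> g \<in> H}"
proof (intro equalityI subsetI)
  fix x assume "x \<in> (g <# H) #> (inv g)"
  then obtain h where h: "h \<in> H" "x = g \<otimes> h \<otimes> inv g" by (auto simp: l_coset_def r_coset_def)
  then have "h \<in> carrier G" using H by blast
  then have "inv g \<otimes> x \<otimes> g = h" using g h by (simp add: m_assoc cancel_left)
  then show "x \<in> {x \<in> carrier G. inv g \<otimes> x \<otimes> g \<in> H}" using h g \<open>h \<in> carrier G\<close> by simp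
next
  fix x assume x: "x \<in> {x \<in> carrier G. inv g \<otimes> x \<otimes> g \<in> H}"
  then have "x = g \<otimes> (inv g \<otimes> x \<otimes> g) \<otimes> inv g" using g by (simp add: m_assoc cancel_left)
  then show "x \<in> (g <# H) #> (inv g)" using x unfolding l_coset_def r_coset_def by blast
qed

lemma (in group) conj_mult_inv:
  assumes "g \<in> carrier G" "a \<in> carrier G" "b \<in> carrier G"
  shows "inv g \<otimes> (a \<otimes> inv b) \<otimes> g = (inv g \<otimes> a \<otimes> g) \<otimes> inv (inv g \<otimes> b \<otimes> g)"
proof -
  have "g \<otimes> (inv g \<otimes> (inv b \<otimes> g)) = inv b \<otimes> g" using assms by (simp add: m_assoc[symmetric])
  then show ?thesis using assms by (simp add: inv_mult_group m_assoc)
qed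

lemma (in group) conj_cancel:
  assumes "g \<in> carrier G" "x \<in> carrier G"
  shows "g \<otimes> (inv g \<otimes> x \<otimes> g) \<otimes> inv g = x"
  using assms by (simp add: m_assoc cancel_left)

lemma (in group) subgroup_div: "subgroup H G \<Longrightarrow> a \<in> H \<Longrightarrow> b \<in> H \<Longrightarrow> a \<otimes> inv b \<in> H"
  by (simp add: subgroup.m_closed subgroup.m_inv_closed)

lemma (in group) subgroup_conjugate:
  assumes g: "g \<in> carrier G" and H: "subgroup H G"
  shows "subgroup ((g <# H) #> (inv g)) G"
  unfolding conjugate_eq[OF g subgroup.subset[OF H]]
proof (rule subgroupI)
  show "{x \<in> carrier G. inv g \<otimes> x \<otimes> g \<in> H} \<noteq> {}"
    using g subgroup.one_closed[OF H] by (intro ex_in_conv[THEN iffD1] exI[of _ \<one>]) simp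
next
  fix a assume a: "a \<in> {x \<in> carrier G. inv g \<otimes> x \<otimes> g \<in> H}"
  then have "inv (inv g \<otimes> a \<otimes> g) \<in> H" using subgroup.m_inv_closed[OF H] by simp
  then show "inv a \<in> {x \<in> carrier G. inv g \<otimes> x \<otimes> g \<in> H}"
    using a g by (simp add: inv_mult_group m_assoc)
next
  fix a b assume ab: "a \<in> {x \<in> carrier G. inv g \<otimes> x \<otimes> g \<in> H}" "b \<in> {x \<in> carrier G. inv g \<otimes> x \<otimes> g \<in> H}"
  then have "(inv g \<otimes> a \<otimes> g) \<otimes> (inv g \<otimes> b \<otimes> g) \<in> H" using subgroup.m_closed[OF H] by simp
  moreover have "g \<otimes> (inv g \<otimes> (b \<otimes> g)) = b \<otimes> g" using ab g by (simp add: m_assoc[symmetric])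
  ultimately show "a \<otimes> b \<in> {x \<in> carrier G. inv g \<otimes> x \<otimes> g \<in> H}"
    using ab g by (simp add: m_assoc)
qed auto

context filtered_group
begin

text \<open>A conjugate of \<open>W\<^sub>0\<close> contains some \<open>W\<^sub>m\<close>, and the map \<open>F m\<close> witnesses that \<open>W\<^sub>m\<close> has finite index in
\<open>W\<^sub>0\<close>. Conjugating back, the same argument bounds the index of the intersection in the conjugate. Both bounds
survive taking preimages, as only elements of the image of \<open>f\<close> are conjugated with.\<close>

lemma commensurated_preimage:
  fixes F :: "nat \<Rightarrow> 'a \<Rightarrow> 'f"
  assumes V: "group V" and f: "f \<in> hom V G"
    and F: "\<And>m. finite (F m ` W 0)"
      "\<And>m a b. a \<in> W 0 \<Longrightarrow> b \<in> W 0 \<Longrightarrow> F m a = F m b \<Longrightarrow> a \<otimes> inv b \<in> W m"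
  shows "commensurated V {v \<in> carrier V. f v \<in> W 0}"
proof -
  interpret V: group V by (rule V)
  interpret f: group_hom V G f by unfold_locales (rule f)
  define H where "H = {v \<in> carrier V. f v \<in> W 0}"
  have H: "subgroup H V"
    unfolding H_def
  proof (rule V.subgroupI)
    show "{v \<in> carrier V. f v \<in> W 0} \<noteq> {}"
      using one_in_W by (intro ex_in_conv[THEN iffD1] exI[of _ "\<one>\<^bsub>V\<^esub>"]) simp
  qed (use subgroup.m_closed[OF W_subgroup[of 0]] subgroup.m_inv_closed[OF W_subgroup[of 0]] in auto)
  have "commensurate V H ((g <#\<^bsub>V\<^esub> H) #>\<^bsub>V\<^esub> (inv\<^bsub>V\<^esub> g))" if g: "g \<in> carrier V" for g
    unfolding commensurate_def
  proof (intro conjI)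
    let ?C = "(g <#\<^bsub>V\<^esub> H) #>\<^bsub>V\<^esub> (inv\<^bsub>V\<^esub> g)"
    note C_eq = V.conjugate_eq[OF g subgroup.subset[OF H]]
    have C_iff: "x \<in> ?C \<longleftrightarrow> x \<in> carrier V \<and> inv\<^bsub>V\<^esub> g \<otimes>\<^bsub>V\<^esub> x \<otimes>\<^bsub>V\<^esub> g \<in> H" for x by (simp add: C_eq)
    show "subgroup H V" by (rule H)
    show C: "subgroup ?C V" using V.subgroup_conjugate[OF g H] .
    have HC: "subgroup (H \<inter> ?C) V" by (rule V.subgroups_Inter_pair[OF H C])
    obtain m where m: "\<forall>u\<in>W m. inv (f g) \<otimes> u \<otimes> inv (inv (f g)) \<in> W 0"
      using W_conj[of "inv (f g)"] g by auto
    show "finite_index V (H \<inter> ?C) H"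
    proof (rule rcosets_finiteI[OF V HC H])
      show "finite ((F m \<circ> f) ` H)"
        by (rule finite_subset[OF _ F(1)]) (auto simp: H_def)
      fix a b assume ab: "a \<in> H" "b \<in> H" "(F m \<circ> f) a = (F m \<circ> f) b"
      then have c: "a \<in> carrier V" "b \<in> carrier V" by (simp_all add: H_def)
      have "f a \<otimes> inv (f b) \<in> W m" using F(2)[of "f a" "f b" m] ab by (simp add: H_def)
      then have "inv (f g) \<otimes> (f a \<otimes> inv (f b)) \<otimes> f g \<in> W 0" using m g by fastforce
      then have "inv\<^bsub>V\<^esub> g \<otimes>\<^bsub>V\<^esub> (a \<otimes>\<^bsub>V\<^esub> inv\<^bsub>V\<^esub> b) \<otimes>\<^bsub>V\<^esub> g \<in> H" using c g by (simp add: H_def)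
      then show "a \<otimes>\<^bsub>V\<^esub> inv\<^bsub>V\<^esub> b \<in> H \<inter> ?C"
        using V.subgroup_div[OF H ab(1,2)] c by (simp add: C_iff)
    qed blast
    obtain m' where m': "\<forall>u\<in>W m'. f g \<otimes> u \<otimes> inv (f g) \<in> W 0"
      using W_conj[of "f g"] g by auto
    define c where "c x = inv\<^bsub>V\<^esub> g \<otimes>\<^bsub>V\<^esub> x \<otimes>\<^bsub>V\<^esub> g" for x
    show "finite_index V (H \<inter> ?C) ?C"
    proof (rule rcosets_finiteI[OF V HC C])
      show "finite ((F m' \<circ> f \<circ> c) ` ?C)"
      proof (rule finite_subset[OF _ F(1)[of m']], rule subsetI)
        fix z assume "z \<in> (F m' \<circ> f \<circ> c) ` ?C"
        then obtain x where x: "x \<in> ?C" "z = F m' (f (c x))" by auto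
        have "c x \<in> H" using x(1) by (simp add: C_iff c_def)
        then show "z \<in> F m' ` W 0" using x(2) by (simp add: H_def)
      qed
      fix a b assume ab: "a \<in> ?C" "b \<in> ?C" "(F m' \<circ> f \<circ> c) a = (F m' \<circ> f \<circ> c) b"
      then have car: "a \<in> carrier V" "b \<in> carrier V" and cH: "c a \<in> H" "c b \<in> H"
        by (simp_all add: C_iff c_def)
      have cc: "c a \<in> carrier V" "c b \<in> carrier V" using car g by (simp_all add: c_def)
      have "f (c a) \<otimes> inv (f (c b)) \<in> W m'" using F(2)[of "f (c a)" "f (c b)" m'] cH ab(3) by (simp add: H_def)
      then have "f g \<otimes> (f (c a) \<otimes> inv (f (c b))) \<otimes> inv (f g) \<in> W 0" using m' by blast
      then have "f (g \<otimes>\<^bsub>V\<^esub> (c a \<otimes>\<^bsub>V\<^esub> inv\<^bsub>V\<^esub> c b) \<otimes>\<^bsub>V\<^esub> inv\<^bsub>V\<^esub> g) \<in> W 0" using cc g by simp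
      moreover have "g \<otimes>\<^bsub>V\<^esub> (c a \<otimes>\<^bsub>V\<^esub> inv\<^bsub>V\<^esub> c b) \<otimes>\<^bsub>V\<^esub> inv\<^bsub>V\<^esub> g = a \<otimes>\<^bsub>V\<^esub> inv\<^bsub>V\<^esub> b"
        unfolding c_def V.conj_mult_inv[OF g car, symmetric]
        using V.conj_cancel[OF g, of "a \<otimes>\<^bsub>V\<^esub> inv\<^bsub>V\<^esub> b"] car by simp
      ultimately show "a \<otimes>\<^bsub>V\<^esub> inv\<^bsub>V\<^esub> b \<in> H \<inter> ?C"
        using V.subgroup_div[OF C ab(1,2)] car by (simp add: H_def)
    qed blast
  qed
  then show ?thesis unfolding commensurated_def H_def[symmetric] using H by blast
qed

end

text \<open>Infinitely many elements of \<open>A\<close> lie in one coset of \<open>H\<close>.\<close>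

lemma finite_index_pigeonhole:
  assumes G: "group G" and K: "subgroup K G" and H: "subgroup H G" and fin: "finite_index G H K"
    and A: "A \<subseteq> K" "infinite A"
  obtains b B where "B \<subseteq> A" "infinite B" "b \<in> A" "\<And>a. a \<in> B \<Longrightarrow> a \<otimes>\<^bsub>G\<^esub> inv\<^bsub>G\<^esub> b \<in> H"
proof -
  interpret group G by (rule G)
  have "rcosets\<^bsub>G\<lparr>carrier := K\<rparr>\<^esub> H = (\<lambda>a. H #>\<^bsub>G\<^esub> a) ` K"
    by (auto simp: RCOSETS_def r_coset_def)
  then have "finite ((\<lambda>a. H #>\<^bsub>G\<^esub> a) ` K)" using fin by (simp add: finite_index_def)
  then have "finite ((\<lambda>a. H #>\<^bsub>G\<^esub> a) ` A)" by (rule finite_subset[rotated]) (use A in blast)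
  then obtain b where b: "b \<in> A" "infinite {a \<in> A. H #>\<^bsub>G\<^esub> a = H #>\<^bsub>G\<^esub> b}"
    using pigeonhole_infinite[OF A(2)] by blast
  have "a \<otimes>\<^bsub>G\<^esub> inv\<^bsub>G\<^esub> b \<in> H" if a: "a \<in> A" "H #>\<^bsub>G\<^esub> a = H #>\<^bsub>G\<^esub> b" for a
  proof -
    have c: "a \<in> carrier G" "b \<in> carrier G" using a b A subgroup.subset[OF K] by blast+
    then have "a \<in> H #>\<^bsub>G\<^esub> b" using a(2) rcos_self[OF c(1) H] by simp
    then obtain h where "h \<in> H" "a = h \<otimes>\<^bsub>G\<^esub> b" by (auto simp: r_coset_def)
    moreover have "h \<in> carrier G" using \<open>h \<in> H\<close> subgroup.subset[OF H] by blast
    ultimately show ?thesis using c by (simp add: m_assoc)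
  qed
  then show thesis using that[of "{a \<in> A. H #>\<^bsub>G\<^esub> a = H #>\<^bsub>G\<^esub> b}" b] b by blast
qed

lemma (in group) pow_div_commuting:
  assumes "a \<in> carrier G" "b \<in> carrier G" "a \<otimes> b = b \<otimes> a" "a [^] (p::nat) = \<one>" "b [^] p = \<one>"
  shows "(a \<otimes> inv b) [^] p = \<one>"
proof -
  have "a \<otimes> inv b = inv b \<otimes> a"
    using assms(1-3) by (metis inv_closed inv_solve_left inv_solve_right m_assoc m_closed)
  then have "(a \<otimes> inv b) [^] p = a [^] p \<otimes> inv b [^] p"
    using assms by (intro pow_mult_distrib) auto
  then show ?thesis using assms by (simp add: nat_pow_inv)
qed

text \<open>Two applications of the pigeonhole principle. The first moves infinitely many \<open>e\<^sub>k\<close>, divided by a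
fixed one, into \<open>K \<inter> L\<close>; the second finds two of them that \<open>F\<close> does not distinguish, so that
their quotient lies in \<open>M\<close>. As the \<open>e\<^sub>k\<close> commute, this quotient is nontrivial with trivial \<open>p\<close>-th power.\<close>

lemma not_commensurate_if_torsion:
  assumes V: "group V" and K: "subgroup K V" and L: "subgroup L V"
    and e: "\<And>k :: nat. e k \<in> K" "inj e" "\<And>i j. e i \<otimes>\<^bsub>V\<^esub> e j = e j \<otimes>\<^bsub>V\<^esub> e i"
      "\<And>k. e k [^]\<^bsub>V\<^esub> (p::nat) = \<one>\<^bsub>V\<^esub>"
    and F: "finite (F ` L)" "\<And>a b. a \<in> L \<Longrightarrow> b \<in> L \<Longrightarrow> F a = F b \<Longrightarrow> a \<otimes>\<^bsub>V\<^esub> inv\<^bsub>V\<^esub> b \<in> M"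
    and M: "\<And>x. x \<in> M \<Longrightarrow> x \<in> carrier V \<Longrightarrow> x [^]\<^bsub>V\<^esub> p = \<one>\<^bsub>V\<^esub> \<Longrightarrow> x = \<one>\<^bsub>V\<^esub>"
  shows "\<not> commensurate V K L"
proof
  assume com: "commensurate V K L"
  interpret group V by (rule V)
  have KL: "subgroup (K \<inter> L) V" by (rule subgroups_Inter_pair[OF K L])
  have "finite_index V (K \<inter> L) K" using com by (simp add: commensurate_def)
  moreover have "range e \<subseteq> K" "infinite (range e)" using e(1,2) finite_imageD by blast+
  ultimately obtain b B where B: "B \<subseteq> range e" "infinite B" "b \<in> range e" and
      bB: "\<And>a. a \<in> B \<Longrightarrow> a \<otimes>\<^bsub>V\<^esub> inv\<^bsub>V\<^esub> b \<in> K \<inter> L"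
    using finite_index_pigeonhole[OF V K KL] by metis
  have "finite ((\<lambda>a. F (a \<otimes>\<^bsub>V\<^esub> inv\<^bsub>V\<^esub> b)) ` B)"
    by (rule finite_subset[OF _ F(1)]) (use bB in blast)
  then obtain a where a: "a \<in> B" "infinite {a' \<in> B. F (a' \<otimes>\<^bsub>V\<^esub> inv\<^bsub>V\<^esub> b) = F (a \<otimes>\<^bsub>V\<^esub> inv\<^bsub>V\<^esub> b)}"
    using pigeonhole_infinite[OF B(2)] by blast
  then have "\<not> {a' \<in> B. F (a' \<otimes>\<^bsub>V\<^esub> inv\<^bsub>V\<^esub> b) = F (a \<otimes>\<^bsub>V\<^esub> inv\<^bsub>V\<^esub> b)} \<subseteq> {a}"
    using finite_subset by blast
  then obtain a' where a': "a' \<in> B" "a' \<noteq> a" "F (a' \<otimes>\<^bsub>V\<^esub> inv\<^bsub>V\<^esub> b) = F (a \<otimes>\<^bsub>V\<^esub> inv\<^bsub>V\<^esub> b)" by blast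
  have car: "a \<in> carrier V" "a' \<in> carrier V" "b \<in> carrier V"
    using a a' B e(1) subgroup.subset[OF K] by blast+
  have "(a' \<otimes>\<^bsub>V\<^esub> inv\<^bsub>V\<^esub> b) \<otimes>\<^bsub>V\<^esub> inv\<^bsub>V\<^esub> (a \<otimes>\<^bsub>V\<^esub> inv\<^bsub>V\<^esub> b) \<in> M"
    using F(2) bB a a' by blast
  moreover have "(a' \<otimes>\<^bsub>V\<^esub> inv\<^bsub>V\<^esub> b) \<otimes>\<^bsub>V\<^esub> inv\<^bsub>V\<^esub> (a \<otimes>\<^bsub>V\<^esub> inv\<^bsub>V\<^esub> b) = a' \<otimes>\<^bsub>V\<^esub> inv\<^bsub>V\<^esub> a"
  proof -
    have "inv\<^bsub>V\<^esub> b \<otimes>\<^bsub>V\<^esub> (b \<otimes>\<^bsub>V\<^esub> inv\<^bsub>V\<^esub> a) = inv\<^bsub>V\<^esub> a" using car by (simp add: m_assoc[symmetric])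
    then show ?thesis using car by (simp add: inv_mult_group m_assoc)
  qed
  ultimately have "a' \<otimes>\<^bsub>V\<^esub> inv\<^bsub>V\<^esub> a \<in> M" by simp
  moreover have "(a' \<otimes>\<^bsub>V\<^esub> inv\<^bsub>V\<^esub> a) [^]\<^bsub>V\<^esub> p = \<one>\<^bsub>V\<^esub>"
  proof -
    obtain i j where "a' = e i" "a = e j" using a a' B by blast
    then show ?thesis using pow_div_commuting[OF car(2,1)] e(3,4) by blast
  qed
  ultimately have "a' \<otimes>\<^bsub>V\<^esub> inv\<^bsub>V\<^esub> a = \<one>\<^bsub>V\<^esub>" using M car by blast
  then have "a' = a" using car by (metis inv_equality inv_inv inv_closed)
  then show False using a'(2) by blast
qed

text \<open>A local isomorphism carries small elements with trivial \<open>p\<close>-th power into \<open>X n\<close>.\<close>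

lemma not_locally_isomorphic_if_torsion:
  assumes G: "filtered_group G W" and H: "filtered_group H X"
    and tors: "\<And>n. \<exists>x\<in>W n. x \<noteq> \<one>\<^bsub>G\<^esub> \<and> x [^]\<^bsub>G\<^esub> (p::nat) = \<one>\<^bsub>G\<^esub>"
    and free: "\<And>x. x \<in> X n \<Longrightarrow> x [^]\<^bsub>H\<^esub> p = \<one>\<^bsub>H\<^esub> \<Longrightarrow> x = \<one>\<^bsub>H\<^esub>"
  shows "\<not> locally_isomorphic G (filtration_topology G W) H (filtration_topology H X)"
proof
  interpret G: filtered_group G W by (rule G)
  interpret H: filtered_group H X by (rule H)
  let ?\<tau> = "filtration_topology G W" and ?\<sigma> = "filtration_topology H X"
  assume "locally_isomorphic G ?\<tau> H ?\<sigma>"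
  then obtain U Y f where U: "subgroup U G" "openin ?\<tau> U" and Y: "subgroup Y H" "openin ?\<sigma> Y"
    and f: "f \<in> iso (G\<lparr>carrier := U\<rparr>) (H\<lparr>carrier := Y\<rparr>)"
    and hom: "homeomorphic_map (subtopology ?\<tau> U) (subtopology ?\<sigma> Y) f"
    unfolding locally_isomorphic_def open_subgroup_def by blast
  have bij: "bij_betw f U Y" and mult: "\<And>x y. x \<in> U \<Longrightarrow> y \<in> U \<Longrightarrow> f (x \<otimes>\<^bsub>G\<^esub> y) = f x \<otimes>\<^bsub>H\<^esub> f y"
    using f by (auto simp: iso_def hom_def)
  have topU: "topspace (subtopology ?\<tau> U) = U"
    using openin_subset[OF U(2)] by auto
  have f_one: "f \<one>\<^bsub>G\<^esub> = \<one>\<^bsub>H\<^esub>"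
  proof -
    have one: "\<one>\<^bsub>G\<^esub> \<in> U" using U(1) by (rule subgroup.one_closed)
    then have "f \<one>\<^bsub>G\<^esub> \<in> carrier H" using bij Y(1) subgroup.subset bij_betwE by blast
    moreover have "f \<one>\<^bsub>G\<^esub> \<otimes>\<^bsub>H\<^esub> f \<one>\<^bsub>G\<^esub> = f \<one>\<^bsub>G\<^esub>" using mult[OF one one] by simp
    ultimately show ?thesis using H.l_cancel_one' H.l_cancel_one by metis
  qed
  have f_pow: "f (x [^]\<^bsub>G\<^esub> k) = f x [^]\<^bsub>H\<^esub> k" if x: "x \<in> U" for x and k :: nat
  proof (induction k)
    case (Suc k)
    have "x [^]\<^bsub>G\<^esub> k \<in> U"
      using x U(1) by (induction k) (auto simp: subgroup.one_closed subgroup.m_closed)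
    then show ?case using mult x Suc by simp
  qed (use f_one in simp)
  define A where "A = {x \<in> U. f x \<in> X n \<inter> Y}"
  have "openin (subtopology ?\<sigma> Y) (X n \<inter> Y)"
    using H.openin_W openin_subtopology_Int by blast
  then have "openin (subtopology ?\<tau> U) {x \<in> topspace (subtopology ?\<tau> U). f x \<in> X n \<inter> Y}"
    using homeomorphic_imp_continuous_map[OF hom] unfolding continuous_map by blast
  then have "openin (subtopology ?\<tau> U) A" unfolding topU A_def .
  then have "openin ?\<tau> A" using openin_open_subtopology[OF U(2)] by blast
  moreover have "\<one>\<^bsub>G\<^esub> \<in> A"
    using f_one H.one_in_W subgroup.one_closed[OF U(1)] subgroup.one_closed[OF Y(1)] by (simp add: A_def)
  ultimately obtain k where k: "\<forall>u\<in>W k. \<one>\<^bsub>G\<^esub> \<otimes>\<^bsub>G\<^esub> u \<in> A"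
    unfolding G.openin_filtration_topology by blast
  obtain x where x: "x \<in> W k" "x \<noteq> \<one>\<^bsub>G\<^esub>" "x [^]\<^bsub>G\<^esub> p = \<one>\<^bsub>G\<^esub>" using tors by blast
  then have "x \<in> A" using k G.W_carrier by fastforce
  then have xU: "x \<in> U" "f x \<in> X n" by (simp_all add: A_def)
  have "f x [^]\<^bsub>H\<^esub> p = \<one>\<^bsub>H\<^esub>" using f_pow[OF xU(1), of p] x(3) f_one by simp
  then have "f x = \<one>\<^bsub>H\<^esub>" using free xU(2) by blast
  then have "x = \<one>\<^bsub>G\<^esub>"
    using inj_onD[OF bij_betw_imp_inj_on[OF bij]] f_one xU(1) subgroup.one_closed[OF U(1)] by metis
  then show False using x(2) by blast
qed

section \<open>Leafless rooted trees and cofinite forests\<close>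

text \<open>Depth functions are a convenient way to see that a graph is a tree: cycles are excluded by looking
at a deepest vertex, and the recursion along parents ends at the root. A tree without leaves has no
finite branches that a complete subtree could swallow, which is why its forests have the simple
description given below.\<close>

locale leafless_tree =
  fixes T :: "('v, 'x) rooted_tree_scheme" and depth :: "'v \<Rightarrow> nat"
  assumes base_in: "base T \<in> verts T"
    and edge_verts: "(u, v) \<in> edges T \<Longrightarrow> u \<in> verts T \<and> v \<in> verts T"
    and depth_base: "depth (base T) = 0"
    and depth_edge: "(u, v) \<in> edges T \<Longrightarrow> depth v = Suc (depth u)"
    and parent_unique: "(u, w) \<in> edges T \<Longrightarrow> (v, w) \<in> edges T \<Longrightarrow> u = v"
    and parent_ex: "v \<in> verts T \<Longrightarrow> v \<noteq> base T \<Longrightarrow> \<exists>u. (u, v) \<in> edges T"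
    and finite_children: "v \<in> verts T \<Longrightarrow> finite (children T v)"
    and child_ex: "v \<in> verts T \<Longrightarrow> \<exists>w. (v, w) \<in> edges T"
begin

lemma not_edge_base: "(u, base T) \<notin> edges T"
  using depth_edge depth_base by fastforce

lemma depth_0: "v \<in> verts T \<Longrightarrow> depth v = 0 \<Longrightarrow> v = base T"
  using parent_ex depth_edge by fastforce

lemma tree_induct [consumes 1, case_names base child]:
  assumes "v \<in> verts T" "P (base T)"
    "\<And>u v. u \<in> verts T \<Longrightarrow> (u, v) \<in> edges T \<Longrightarrow> P u \<Longrightarrow> P v"
  shows "P v"
  using assms(1)
proof (induction "depth v" arbitrary: v)
  case 0
  then show ?case using depth_0 assms(2) by metis
next
  case (Suc n)
  then obtain u where u: "(u, v) \<in> edges T" using parent_ex depth_base by fastforce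
  then show ?case using Suc depth_edge assms(3) edge_verts by (metis Suc_inject)
qed

lemma finite_level: "finite {v \<in> verts T. depth v = n}"
proof (induction n)
  case 0
  have "{v \<in> verts T. depth v = 0} \<subseteq> {base T}" using depth_0 by blast
  then show ?case using finite_subset by blast
next
  case (Suc n)
  have "{v \<in> verts T. depth v = Suc n} \<subseteq> (\<Union>u\<in>{v \<in> verts T. depth v = n}. children T u)"
  proof
    fix v assume v: "v \<in> {v \<in> verts T. depth v = Suc n}"
    then obtain u where "(u, v) \<in> edges T" using parent_ex depth_base by fastforce
    then show "v \<in> (\<Union>u\<in>{v \<in> verts T. depth v = n}. children T u)"
      using v depth_edge[of _ v] edge_verts by (auto simp: children_def)
  qed
  moreover have "finite (\<Union>u\<in>{v \<in> verts T. depth v = n}. children T u)"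
    using Suc finite_children by simp
  ultimately show ?case by (rule finite_subset)
qed

lemma finite_ball: "finite {v \<in> verts T. depth v \<le> n}"
proof -
  have "{v \<in> verts T. depth v \<le> n} = (\<Union>k\<le>n. {v \<in> verts T. depth v = k})" by auto
  then show ?thesis using finite_level by simp
qed

lemma finite_ball_less: "finite {v \<in> verts T. depth v < n}"
  by (rule finite_subset[OF _ finite_ball[of n]]) auto

lemma depth_bounded:
  assumes "finite S" obtains n where "\<And>v. v \<in> S \<Longrightarrow> depth v < n"
proof -
  have "depth v < Suc (Max (depth ` S))" if "v \<in> S" for v
    using that assms by (simp add: le_imp_less_Suc)
  then show thesis using that by blast
qed

lemma reachable: "v \<in> verts T \<Longrightarrow> (base T, v) \<in> (edges T)\<^sup>*"
  by (induction rule: tree_induct) (auto intro: rtrancl_into_rtrancl)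

lemma descend_verts: "(u, v) \<in> (edges T)\<^sup>* \<Longrightarrow> u \<in> verts T \<Longrightarrow> v \<in> verts T"
  by (induction rule: rtrancl_induct) (auto dest: edge_verts)

lemma adjacency_sym: "(u, v) \<in> adjacency T \<longleftrightarrow> (v, u) \<in> adjacency T"
  by (auto simp: adjacency_def)

lemma connected_in_if_parents:
  assumes S: "S \<subseteq> verts T"
    and parents: "\<And>v. v \<in> S \<Longrightarrow> v \<noteq> base T \<Longrightarrow> \<exists>u\<in>S. (u, v) \<in> edges T"
  shows "connected_in T S"
proof -
  let ?A = "(adjacency T \<inter> S \<times> S)\<^sup>*"
  have to_base: "(base T, v) \<in> ?A" if "v \<in> S" for v
    using that
  proof (induction "depth v" arbitrary: v rule: less_induct)
    case less
    show ?case
    proof (cases "v = base T")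
      case False
      then obtain u where u: "u \<in> S" "(u, v) \<in> edges T" using parents less by blast
      then have "(base T, u) \<in> ?A" using less depth_edge by simp
      moreover have "(u, v) \<in> adjacency T \<inter> S \<times> S" using u less by (auto simp: adjacency_def)
      ultimately show ?thesis by (rule rtrancl_into_rtrancl)
    qed simp
  qed
  have "sym ?A" by (rule sym_rtrancl) (auto simp: sym_def adjacency_def)
  then show ?thesis unfolding connected_in_def using S to_base
    by (meson rtrancl_trans symD)
qed

text \<open>A deepest vertex of a cycle would have two parents.\<close>

lemma no_cycle: "\<not> is_cycle T p"
proof
  assume c: "is_cycle T p"
  let ?n = "length p"
  have n: "?n \<ge> 3" and d: "distinct p" using c by (auto simp: is_cycle_def)
  then have pne: "p \<noteq> []" by auto
  have adj: "(p ! k, p ! (Suc k mod ?n)) \<in> adjacency T" if "k < ?n" for k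
  proof (cases "Suc k = ?n")
    case True
    then have "k = ?n - 1" by simp
    with True pne have "p ! k = last p" "p ! (Suc k mod ?n) = hd p"
      by (simp_all add: last_conv_nth hd_conv_nth)
    then show ?thesis using c by (simp add: is_cycle_def)
  next
    case False
    then show ?thesis using c that by (simp add: is_cycle_def successively_conv_nth)
  qed
  have "\<exists>i<?n. \<forall>j<?n. depth (p ! j) \<le> depth (p ! i)"
    using ex_has_greatest_nat[of "\<lambda>i. i < ?n" 0 "\<lambda>i. depth (p ! i)" "Suc (Max (depth ` set p))"] pne
    by (auto simp: less_Suc_eq_le)
  then obtain i where i: "i < ?n" "\<And>j. j < ?n \<Longrightarrow> depth (p ! j) \<le> depth (p ! i)" by blast
  have parent: "(p ! j, p ! i) \<in> edges T" if "j < ?n" "(p ! i, p ! j) \<in> adjacency T" for j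
    using that i(2)[of j] depth_edge[of "p ! i" "p ! j"] by (auto simp: adjacency_def)
  define j where "j = Suc i mod ?n"
  define k where "k = (if i = 0 then ?n - 1 else i - 1)"
  have jk: "j < ?n" "k < ?n" "Suc k mod ?n = i"
    using n i(1) pne by (auto simp: j_def k_def mod_less_divisor)
  have "(p ! j, p ! i) \<in> edges T" using parent adj i(1) jk j_def by simp
  moreover have "(p ! k, p ! i) \<in> edges T" using parent adj[of k] jk adjacency_sym by metis
  ultimately have "p ! j = p ! k" using parent_unique by blast
  then have "j = k" using d jk by (simp add: nth_eq_iff_index_eq)
  then show False using n i(1) by (auto simp: j_def k_def mod_Suc split: if_splits)
qed

theorem locally_finite_rooted_tree: "locally_finite_rooted_tree T"
proof -
  have "finite (adjacency T `` {v})" if "v \<in> verts T" for v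
  proof -
    have "adjacency T `` {v} = children T v \<union> {u. (u, v) \<in> edges T}"
      by (auto simp: adjacency_def children_def)
    moreover have "finite {u. (u, v) \<in> edges T}"
    proof -
      have "{u. (u, v) \<in> edges T} \<subseteq> {THE u. (u, v) \<in> edges T}"
        using parent_unique by (auto intro!: the_equality[symmetric])
      then show ?thesis by (rule finite_subset) simp
    qed
    ultimately show ?thesis using finite_children that by simp
  qed
  moreover have "connected_in T (verts T)"
    by (rule connected_in_if_parents) (use parent_ex edge_verts in blast)+
  moreover have "irrefl (edges T)" using depth_edge by (fastforce simp: irrefl_def)
  moreover have "edges T \<inter> (edges T)\<inverse> = {}" by (auto dest!: depth_edge)
  ultimately show ?thesis
    unfolding locally_finite_rooted_tree_def
    using base_in edge_verts no_cycle reachable by auto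
qed

text \<open>These are the vertex sets of the forests \<open>T \<setminus> S\<close>; the complement consists of the inner vertices of
\<open>S\<close>.\<close>

definition cofinite_forest :: "'v set \<Rightarrow> bool" where
  "cofinite_forest F \<longleftrightarrow> F \<subseteq> verts T \<and> finite (verts T - F) \<and>
     (\<forall>u v. u \<in> F \<longrightarrow> (u, v) \<in> edges T \<longrightarrow> v \<in> F)"

lemma cofinite_forest_deep: "cofinite_forest {v \<in> verts T. n \<le> depth v}"
proof -
  have "verts T - {v \<in> verts T. n \<le> depth v} \<subseteq> {v \<in> verts T. depth v < n}" by auto
  then show ?thesis
    unfolding cofinite_forest_def using finite_subset[OF _ finite_ball_less]
    by (auto dest: edge_verts depth_edge)
qed

lemma cofinite_forest_contains_deep:
  assumes "cofinite_forest F" obtains n where "{v \<in> verts T. n \<le> depth v} \<subseteq> F"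
proof -
  obtain n where "\<And>v. v \<in> verts T - F \<Longrightarrow> depth v < n"
    using depth_bounded assms unfolding cofinite_forest_def by metis
  then show thesis using that[of n] by force
qed

lemma cofinite_forest_descend:
  "cofinite_forest F \<Longrightarrow> u \<in> F \<Longrightarrow> (u, v) \<in> (edges T)\<^sup>* \<Longrightarrow> v \<in> F"
  by (rotate_tac 2, induction rule: rtrancl_induct) (auto simp: cofinite_forest_def)

text \<open>On the way from the root to a vertex outside \<open>S\<close>, the last vertex in \<open>S\<close> has a child outside \<open>S\<close>, so
it is a leaf of \<open>S\<close> by completeness.\<close>

lemma outside_in_forest:
  assumes S: "finite_complete T S" and v: "v \<in> verts T" "v \<notin> S"
  shows "v \<in> forest T S"
  using v
proof (induction rule: tree_induct)
  case base
  then show ?case using S by (simp add: finite_complete_def)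
next
  case (child u v)
  show ?case
  proof (cases "u \<in> S")
    case True
    then have "children T u \<inter> S = {}" using child S
      by (auto simp: finite_complete_def children_def)
    then have "u \<in> leaves T S" using True by (simp add: leaves_def)
    then show ?thesis using child by (auto simp: forest_def descendants_def)
  next
    case False
    then show ?thesis using child by (auto simp: forest_def descendants_def intro: rtrancl_into_rtrancl)
  qed
qed

lemma cofinite_forest_forest:
  assumes S: "finite_complete T S" shows "cofinite_forest (forest T S)"
proof -
  have "leaves T S \<subseteq> verts T" using S by (auto simp: leaves_def finite_complete_def connected_in_def)
  then have "forest T S \<subseteq> verts T" by (auto simp: forest_def descendants_def intro: descend_verts)
  moreover have "verts T - forest T S \<subseteq> S" using outside_in_forest[OF S] by blast
  ultimately show ?thesis
    unfolding cofinite_forest_def using S finite_subset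
    by (auto simp: finite_complete_def forest_def descendants_def intro: rtrancl_into_rtrancl)
qed

lemma leaves_subset_forest: "leaves T S \<subseteq> forest T S"
  by (auto simp: forest_def descendants_def)

text \<open>This turns the condition \<open>S \<noteq> {base T}\<close> on patterned maps into a condition on the forest alone.\<close>

lemma base_in_forest:
  assumes S: "finite_complete T S" shows "base T \<in> forest T S \<longleftrightarrow> S = {base T}"
proof
  assume "S = {base T}"
  then have "base T \<in> leaves T S" using not_edge_base by (auto simp: leaves_def children_def)
  then show "base T \<in> forest T S" using leaves_subset_forest by blast
next
  assume "base T \<in> forest T S"
  then obtain v where v: "v \<in> leaves T S" "(v, base T) \<in> (edges T)\<^sup>*"
    by (auto simp: forest_def descendants_def)
  then have "v = base T" using not_edge_base by (metis rtranclE)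
  then have ch: "children T (base T) \<inter> S = {}" using v by (simp add: leaves_def)
  show "S = {base T}"
  proof (rule ccontr)
    assume "S \<noteq> {base T}"
    then obtain w where w: "w \<in> S" "w \<noteq> base T" "(base T, w) \<in> (adjacency T \<inter> S \<times> S)\<^sup>*"
      using S by (auto simp: finite_complete_def connected_in_def)
    then obtain x where "(base T, x) \<in> adjacency T" "x \<in> S"
      by (metis (no_types, lifting) IntE SigmaD2 converse_rtranclE)
    then show False using ch not_edge_base by (auto simp: adjacency_def children_def)
  qed
qed

text \<open>The inner vertices of \<open>S\<close> have to be those outside \<open>F\<close>, so \<open>S\<close> consists of these, their children and the root.
That no vertex outside \<open>F\<close> becomes a leaf of \<open>S\<close> uses that every vertex has a child.\<close>

lemma forest_of_cofinite:
  assumes F: "cofinite_forest F"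
  obtains S where "finite_complete T S" "forest T S = F" "verts T - F \<subseteq> S"
proof -
  define I where "I = verts T - F"
  define S where "S = insert (base T) (I \<union> (\<Union>u\<in>I. children T u))"
  have I_parent: "u \<in> I" if "(u, v) \<in> edges T" "v \<in> I" for u v
    using that F edge_verts by (auto simp: I_def cofinite_forest_def)
  have SV: "S \<subseteq> verts T" using base_in edge_verts by (auto simp: S_def I_def children_def)
  have fin: "finite S" using F finite_children by (auto simp: S_def I_def cofinite_forest_def)
  have conn: "connected_in T S"
  proof (rule connected_in_if_parents[OF SV])
    fix v assume v: "v \<in> S" "v \<noteq> base T"
    then obtain u where u: "(u, v) \<in> edges T" using parent_ex SV by blast
    have "u \<in> I"
    proof (cases "v \<in> I")
      case True
      then show ?thesis using I_parent u by blast
    next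
      case False
      then obtain x where "x \<in> I" "(x, v) \<in> edges T" using v by (auto simp: S_def children_def)
      then show ?thesis using parent_unique u by blast
    qed
    then show "\<exists>u\<in>S. (u, v) \<in> edges T" using u by (auto simp: S_def)
  qed
  have inner: "children T v \<subseteq> S" if "v \<in> I" for v using that by (auto simp: S_def)
  have outer: "children T v \<inter> S = {}" if "v \<in> F" for v
  proof -
    have "v \<notin> I" using that by (simp add: I_def)
    show ?thesis
    proof (rule equals0I)
      fix w assume "w \<in> children T v \<inter> S"
      then have e: "(v, w) \<in> edges T" and "w \<in> S" by (auto simp: children_def)
      then consider "w \<in> I" | x where "x \<in> I" "(x, w) \<in> edges T"
        using not_edge_base by (auto simp: S_def children_def)
      then show False using \<open>v \<notin> I\<close> e I_parent parent_unique by cases blast+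
    qed
  qed
  have complete: "finite_complete T S"
    unfolding finite_complete_def
  proof (intro conjI ballI)
    fix v assume "v \<in> S"
    then have "v \<in> I \<or> v \<in> F" using SV by (auto simp: I_def)
    then show "children T v \<subseteq> S \<or> children T v \<inter> S = {}" using inner outer by blast
  qed (use fin conn in \<open>simp_all add: S_def\<close>)
  have leaves: "leaves T S = S \<inter> F"
  proof -
    have "children T v \<inter> S \<noteq> {}" if "v \<in> I" for v
      using inner[OF that] child_ex[of v] that by (auto simp: I_def children_def)
    then show ?thesis using outer SV unfolding leaves_def I_def by blast
  qed
  have "forest T S \<subseteq> F"
    using leaves cofinite_forest_descend[OF F] by (auto simp: forest_def descendants_def)
  moreover have "v \<in> forest T S" if "v \<in> F" for v
  proof (cases "v \<in> S")
    case True
    then show ?thesis using that leaves leaves_subset_forest by blast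
  next
    case False
    then show ?thesis using outside_in_forest complete that F by (auto simp: cofinite_forest_def)
  qed
  ultimately have "forest T S = F" by blast
  moreover have "verts T - F \<subseteq> S" unfolding S_def I_def by blast
  ultimately show thesis using that complete by blast
qed

section \<open>Germs of almost isomorphisms\<close>

text \<open>Honest almost automorphisms without reference to the finite subtrees.\<close>

definition almost_iso :: "('v \<rightharpoonup> 'v) \<Rightarrow> bool" where
  "almost_iso \<phi> \<longleftrightarrow> cofinite_forest (dom \<phi>) \<and> cofinite_forest (ran \<phi>) \<and> inj_on \<phi> (dom \<phi>) \<and>
     (\<forall>u v u' v'. \<phi> u = Some u' \<longrightarrow> \<phi> v = Some v' \<longrightarrow> ((u, v) \<in> edges T \<longleftrightarrow> (u', v') \<in> edges T))"

lemma almost_isoD: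
  assumes "almost_iso \<phi>"
  shows "cofinite_forest (dom \<phi>)" "cofinite_forest (ran \<phi>)"
    and almost_iso_inj: "\<phi> u = Some w \<Longrightarrow> \<phi> v = Some w \<Longrightarrow> u = v"
    and almost_iso_edge: "\<phi> u = Some u' \<Longrightarrow> \<phi> v = Some v' \<Longrightarrow> (u, v) \<in> edges T \<longleftrightarrow> (u', v') \<in> edges T"
  using assms unfolding almost_iso_def by (auto simp: inj_on_def dom_def)

lemma almost_iso_verts:
  assumes "almost_iso \<phi>" "\<phi> u = Some w" shows "u \<in> verts T" "w \<in> verts T"
  using almost_isoD(1,2)[OF assms(1)] assms(2) by (auto simp: cofinite_forest_def ran_def)

lemma almost_iso_child:
  assumes "almost_iso \<phi>" "\<phi> u = Some u'" "(u, v) \<in> edges T"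
  obtains v' where "\<phi> v = Some v'" "(u', v') \<in> edges T"
proof -
  have "v \<in> dom \<phi>" using almost_isoD(1)[OF assms(1)] assms by (auto simp: cofinite_forest_def)
  then show thesis using that almost_iso_edge[OF assms(1,2)] assms(3) by blast
qed

lemma almost_iso_child_inv:
  assumes "almost_iso \<phi>" "\<phi> u = Some u'" "(u', v') \<in> edges T"
  obtains v where "\<phi> v = Some v'" "(u, v) \<in> edges T"
proof -
  have "v' \<in> ran \<phi>" using almost_isoD(2)[OF assms(1)] assms
    by (auto simp: cofinite_forest_def ran_def)
  then obtain v where "\<phi> v = Some v'" by (auto simp: ran_def)
  then show thesis using that almost_iso_edge[OF assms(1,2)] assms(3) by blast
qed

lemma honest_iff:
  "honest T S\<^sub>1 S\<^sub>2 \<phi> \<longleftrightarrow> finite_complete T S\<^sub>1 \<and> finite_complete T S\<^sub>2 \<and>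
     dom \<phi> = forest T S\<^sub>1 \<and> ran \<phi> = forest T S\<^sub>2 \<and> almost_iso \<phi>" (is "?L \<longleftrightarrow> ?R")
proof -
  have ran: "(the \<circ> \<phi>) ` dom \<phi> = ran \<phi>" by (force simp: ran_def dom_def)
  have inj: "inj_on (the \<circ> \<phi>) (dom \<phi>) \<longleftrightarrow> inj_on \<phi> (dom \<phi>)"
    by (auto simp: inj_on_def dom_def)
  have edge: "(\<forall>u\<in>dom \<phi>. \<forall>v\<in>dom \<phi>. (u, v) \<in> edges T \<longleftrightarrow> (the (\<phi> u), the (\<phi> v)) \<in> edges T) \<longleftrightarrow>
      (\<forall>u v u' v'. \<phi> u = Some u' \<longrightarrow> \<phi> v = Some v' \<longrightarrow> ((u, v) \<in> edges T \<longleftrightarrow> (u', v') \<in> edges T))"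
    by (auto simp: dom_def)
  show ?thesis
  proof
    assume h: ?L
    then have d: "dom \<phi> = forest T S\<^sub>1" by (simp add: honest_def)
    then show ?R
      using h ran inj edge cofinite_forest_forest
      unfolding honest_def almost_iso_def bij_betw_def by metis
  next
    assume h: ?R
    then have d: "dom \<phi> = forest T S\<^sub>1" by blast
    then show ?L
      using h ran inj edge
      unfolding honest_def almost_iso_def bij_betw_def by metis
  qed
qed

lemma honest_aauts_eq: "honest_aauts T = {\<phi>. almost_iso \<phi>}"
proof -
  have "\<exists>S\<^sub>1 S\<^sub>2. honest T S\<^sub>1 S\<^sub>2 \<phi>" if iso: "almost_iso \<phi>" for \<phi>
  proof -
    obtain S\<^sub>1 where "finite_complete T S\<^sub>1" "forest T S\<^sub>1 = dom \<phi>"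
      using forest_of_cofinite[OF almost_isoD(1)[OF iso]] .
    moreover obtain S\<^sub>2 where "finite_complete T S\<^sub>2" "forest T S\<^sub>2 = ran \<phi>"
      using forest_of_cofinite[OF almost_isoD(2)[OF iso]] .
    ultimately show ?thesis using iso unfolding honest_iff by blast
  qed
  then show ?thesis unfolding honest_aauts_def honest_iff by (auto simp: honest_iff)
qed

lemma map_comp_assoc: "(f \<circ>\<^sub>m g) \<circ>\<^sub>m h = f \<circ>\<^sub>m (g \<circ>\<^sub>m h)"
  by (auto simp: map_comp_def fun_eq_iff split: option.split)

definition almost_eq :: "('v \<rightharpoonup> 'v) \<Rightarrow> ('v \<rightharpoonup> 'v) \<Rightarrow> bool" where
  "almost_eq \<phi> \<psi> \<longleftrightarrow> finite {v. \<phi> v \<noteq> \<psi> v}"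

lemma almost_eq_refl [simp]: "almost_eq \<phi> \<phi>"
  by (simp add: almost_eq_def)

lemma almost_eq_sym: "almost_eq \<phi> \<psi> \<Longrightarrow> almost_eq \<psi> \<phi>"
  unfolding almost_eq_def by (simp add: eq_commute)

lemma almost_eq_trans: "almost_eq \<phi> \<psi> \<Longrightarrow> almost_eq \<psi> \<theta> \<Longrightarrow> almost_eq \<phi> \<theta>"
  unfolding almost_eq_def
  by (rule finite_subset[of _ "{v. \<phi> v \<noteq> \<psi> v} \<union> {v. \<psi> v \<noteq> \<theta> v}"]) auto

lemma almost_eq_if_deep:
  assumes "almost_iso \<phi>" "almost_iso \<psi>"
    and "\<And>v. v \<in> verts T \<Longrightarrow> n \<le> depth v \<Longrightarrow> \<phi> v = \<psi> v"
  shows "almost_eq \<phi> \<psi>"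
proof -
  have "{v. \<phi> v \<noteq> \<psi> v} \<subseteq> {v \<in> verts T. depth v < n}"
  proof
    fix v assume v: "v \<in> {v. \<phi> v \<noteq> \<psi> v}"
    have "v \<in> verts T"
    proof (cases "\<phi> v")
      case None
      then obtain w where "\<psi> v = Some w" using v by fastforce
      then show ?thesis using almost_iso_verts(1)[OF assms(2)] by blast
    next
      case (Some w)
      then show ?thesis using almost_iso_verts(1)[OF assms(1)] by blast
    qed
    then show "v \<in> {v \<in> verts T. depth v < n}" using v assms(3)[of v] by force
  qed
  then show ?thesis unfolding almost_eq_def using finite_ball_less finite_subset by blast
qed

lemma almost_eq_deep:
  assumes "almost_eq \<phi> \<psi>" obtains n where "\<And>v. n \<le> depth v \<Longrightarrow> \<phi> v = \<psi> v"
proof -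
  obtain n where "\<And>v. v \<in> {v. \<phi> v \<noteq> \<psi> v} \<Longrightarrow> depth v < n"
    using depth_bounded assms unfolding almost_eq_def by metis
  then show thesis using that[of n] by force
qed

text \<open>A finite set of vertices lies in some ball, and balls are finite complete subtrees.\<close>

lemma aaut_rel_iff: "(\<phi>, \<psi>) \<in> aaut_rel T \<longleftrightarrow> almost_iso \<phi> \<and> almost_iso \<psi> \<and> almost_eq \<phi> \<psi>"
proof
  assume "(\<phi>, \<psi>) \<in> aaut_rel T"
  then obtain S where iso: "almost_iso \<phi>" "almost_iso \<psi>" and S: "finite_complete T S"
      "\<forall>v\<in>forest T S. \<phi> v = \<psi> v"
    unfolding aaut_rel_def honest_iff by blast
  obtain n where n: "{v \<in> verts T. n \<le> depth v} \<subseteq> forest T S"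
    using cofinite_forest_contains_deep cofinite_forest_forest S(1) by metis
  then have "almost_eq \<phi> \<psi>" using S iso by (intro almost_eq_if_deep[of _ _ n]) auto
  then show "almost_iso \<phi> \<and> almost_iso \<psi> \<and> almost_eq \<phi> \<psi>" using iso by blast
next
  assume a: "almost_iso \<phi> \<and> almost_iso \<psi> \<and> almost_eq \<phi> \<psi>"
  then obtain S\<^sub>1 S\<^sub>2 S\<^sub>1' S\<^sub>2' where h: "honest T S\<^sub>1 S\<^sub>2 \<phi>" "honest T S\<^sub>1' S\<^sub>2' \<psi>"
    using honest_aauts_eq unfolding honest_aauts_def by blast
  then have fin: "finite (S\<^sub>1 \<union> S\<^sub>1')" and V: "S\<^sub>1 \<union> S\<^sub>1' \<subseteq> verts T"
    by (auto simp: honest_def finite_complete_def connected_in_def)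
  obtain k where k: "\<And>v. v \<in> S\<^sub>1 \<union> S\<^sub>1' \<Longrightarrow> depth v < k" using depth_bounded[OF fin] by blast
  obtain n where n: "\<And>v. n \<le> depth v \<Longrightarrow> \<phi> v = \<psi> v" using almost_eq_deep a by blast
  obtain S where S: "finite_complete T S" "forest T S = {v \<in> verts T. max k n \<le> depth v}"
      "verts T - {v \<in> verts T. max k n \<le> depth v} \<subseteq> S"
    using forest_of_cofinite[OF cofinite_forest_deep[of "max k n"]] .
  have "S\<^sub>1 \<union> S\<^sub>1' \<subseteq> S" using S(3) k V by force
  moreover have "\<forall>v\<in>forest T S. \<phi> v = \<psi> v" using S(2) n by auto
  ultimately show "(\<phi>, \<psi>) \<in> aaut_rel T" unfolding aaut_rel_def using h S(1) by blast
qed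

text \<open>Classes of almost automorphisms; agreement off a finite set replaces agreement on a common forest.\<close>

definition germ :: "('v \<rightharpoonup> 'v) \<Rightarrow> ('v \<rightharpoonup> 'v) set" where
  "germ \<phi> = {\<theta>. almost_iso \<theta> \<and> almost_eq \<phi> \<theta>}"

lemma aaut_class_eq: "almost_iso \<phi> \<Longrightarrow> aaut_rel T `` {\<phi>} = germ \<phi>"
  unfolding germ_def Image_def aaut_rel_iff by blast

lemma germ_eq_iff: "almost_iso \<phi> \<Longrightarrow> almost_iso \<psi> \<Longrightarrow> germ \<phi> = germ \<psi> \<longleftrightarrow> almost_eq \<phi> \<psi>"
  unfolding germ_def using almost_eq_sym almost_eq_trans almost_eq_refl by blast

lemma in_germ: "almost_iso \<phi> \<Longrightarrow> \<phi> \<in> germ \<phi>"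
  by (simp add: germ_def)

lemma carrier_AAut: "carrier (AAut T) = germ ` {\<phi>. almost_iso \<phi>}"
  unfolding AAut_def quotient_def honest_aauts_eq by (auto simp: aaut_class_eq)

text \<open>The domain of a composite is again closed under children, because children are carried to children, and
it misses only finitely many vertices, because both maps are injective.\<close>

lemma almost_iso_comp:
  assumes \<phi>: "almost_iso \<phi>" and \<psi>: "almost_iso \<psi>" shows "almost_iso (\<psi> \<circ>\<^sub>m \<phi>)"
proof -
  let ?\<theta> = "\<psi> \<circ>\<^sub>m \<phi>"
  have \<theta>: "?\<theta> v = Some w \<longleftrightarrow> (\<exists>u. \<phi> v = Some u \<and> \<psi> u = Some w)" for v w
    by (auto simp: map_comp_def split: option.split)
  have sub: "dom ?\<theta> \<subseteq> verts T" "ran ?\<theta> \<subseteq> verts T"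
    using almost_iso_verts[OF \<phi>] almost_iso_verts[OF \<psi>] \<theta> by (auto simp: dom_def ran_def)
  have down: "v \<in> dom ?\<theta>" if e: "u \<in> dom ?\<theta>" "(u, v) \<in> edges T" for u v
  proof -
    obtain u1 u2 where u: "\<phi> u = Some u1" "\<psi> u1 = Some u2" using e(1) \<theta> by blast
    obtain v1 where "\<phi> v = Some v1" "(u1, v1) \<in> edges T" using almost_iso_child[OF \<phi> u(1) e(2)] .
    then show ?thesis using almost_iso_child[OF \<psi> u(2)] \<theta> by blast
  qed
  have up: "v \<in> ran ?\<theta>" if e: "u \<in> ran ?\<theta>" "(u, v) \<in> edges T" for u v
  proof -
    obtain u1 u2 where u: "\<phi> u2 = Some u1" "\<psi> u1 = Some u" using e(1) \<theta> by (auto simp: ran_def)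
    obtain v1 where "\<psi> v1 = Some v" "(u1, v1) \<in> edges T" using almost_iso_child_inv[OF \<psi> u(2) e(2)] .
    then show ?thesis using almost_iso_child_inv[OF \<phi> u(1)] \<theta> by (metis ranI)
  qed
  have "verts T - dom ?\<theta> \<subseteq> (verts T - dom \<phi>) \<union> \<phi> -` Some ` (verts T - dom \<psi>) \<inter> dom \<phi>"
    using \<theta> almost_iso_verts[OF \<phi>] by (fastforce simp: dom_def)
  moreover have "finite (\<phi> -` Some ` (verts T - dom \<psi>) \<inter> dom \<phi>)"
    using \<psi> \<phi> by (auto simp: almost_iso_def cofinite_forest_def intro!: finite_vimage_IntI)
  ultimately have fin1: "finite (verts T - dom ?\<theta>)"
    using \<phi> finite_subset by (auto simp: almost_iso_def cofinite_forest_def)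
  have "verts T - ran ?\<theta> \<subseteq> (verts T - ran \<psi>) \<union> (the \<circ> \<psi>) ` (verts T - ran \<phi>)"
  proof
    fix w assume w: "w \<in> verts T - ran ?\<theta>"
    show "w \<in> (verts T - ran \<psi>) \<union> (the \<circ> \<psi>) ` (verts T - ran \<phi>)"
    proof (cases "w \<in> ran \<psi>")
      case True
      then obtain u where u: "\<psi> u = Some w" by (auto simp: ran_def)
      then have "u \<in> verts T - ran \<phi>"
        using w \<theta> almost_iso_verts[OF \<psi>] by (auto simp: ran_def)
      then show ?thesis using u by force
    qed (use w in simp)
  qed
  moreover have "finite ((the \<circ> \<psi>) ` (verts T - ran \<phi>))" "finite (verts T - ran \<psi>)"
    using \<psi> \<phi> by (auto simp: almost_iso_def cofinite_forest_def)
  ultimately have fin2: "finite (verts T - ran ?\<theta>)" using finite_subset by blast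
  have "inj_on ?\<theta> (dom ?\<theta>)"
    using almost_iso_inj[OF \<phi>] almost_iso_inj[OF \<psi>] \<theta> by (fastforce simp: inj_on_def dom_def)
  moreover have "(u, v) \<in> edges T \<longleftrightarrow> (u', v') \<in> edges T" if e: "?\<theta> u = Some u'" "?\<theta> v = Some v'" for u v u' v'
  proof -
    obtain u1 v1 where "\<phi> u = Some u1" "\<psi> u1 = Some u'" "\<phi> v = Some v1" "\<psi> v1 = Some v'"
      using e unfolding \<theta> by blast
    then show ?thesis using almost_iso_edge[OF \<phi>] almost_iso_edge[OF \<psi>] by simp
  qed
  moreover have "cofinite_forest (dom ?\<theta>)" unfolding cofinite_forest_def using sub fin1 down by blast
  moreover have "cofinite_forest (ran ?\<theta>)" unfolding cofinite_forest_def using sub fin2 up by blast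
  ultimately show ?thesis unfolding almost_iso_def by blast
qed

lemma almost_eq_comp:
  assumes \<phi>: "almost_iso \<phi>" "almost_iso \<phi>'" and eq: "almost_eq \<phi> \<phi>'" "almost_eq \<psi> \<psi>'"
  shows "almost_eq (\<psi> \<circ>\<^sub>m \<phi>) (\<psi>' \<circ>\<^sub>m \<phi>')"
proof -
  let ?B = "\<phi> -` Some ` {v. \<psi> v \<noteq> \<psi>' v} \<inter> dom \<phi>"
  have "(\<psi> \<circ>\<^sub>m \<phi>) v = (\<psi>' \<circ>\<^sub>m \<phi>') v" if "\<phi> v = \<phi>' v" "v \<notin> ?B" for v
  proof (cases "\<phi> v")
    case (Some a)
    then have "\<psi> a = \<psi>' a" using that(2) by (auto simp: dom_def)
    moreover have "\<phi>' v = Some a" using that(1) Some by simp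
    ultimately show ?thesis using Some by (simp add: map_comp_def)
  qed (use that(1) in \<open>simp add: map_comp_def\<close>)
  then have "{v. (\<psi> \<circ>\<^sub>m \<phi>) v \<noteq> (\<psi>' \<circ>\<^sub>m \<phi>') v} \<subseteq> {v. \<phi> v \<noteq> \<phi>' v} \<union> ?B" by blast
  moreover have "finite ?B"
    using eq \<phi> by (auto simp: almost_iso_def almost_eq_def intro!: finite_vimage_IntI)
  ultimately show ?thesis using eq finite_subset unfolding almost_eq_def by blast
qed

lemma almost_iso_id_on: "cofinite_forest F \<Longrightarrow> almost_iso (Some |` F)"
proof -
  have "dom (Some |` F) = F" "ran (Some |` F) = F"
    by (auto simp: ran_def restrict_map_def split: if_splits)
  then show "cofinite_forest F \<Longrightarrow> almost_iso (Some |` F)"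
    by (auto simp: almost_iso_def inj_on_def restrict_map_def split: if_splits)
qed

lemma almost_iso_restrict:
  assumes \<phi>: "almost_iso \<phi>" and F: "cofinite_forest F" shows "almost_iso (\<phi> |` F)"
proof -
  have "\<phi> |` F = \<phi> \<circ>\<^sub>m (Some |` F)"
    by (auto simp: map_comp_def restrict_map_def fun_eq_iff)
  then show ?thesis using almost_iso_comp almost_iso_id_on[OF F] \<phi> by simp
qed

definition inv_map :: "('v \<rightharpoonup> 'v) \<Rightarrow> ('v \<rightharpoonup> 'v)" where
  "inv_map \<phi> w = (if w \<in> ran \<phi> then Some (THE v. \<phi> v = Some w) else None)"

lemma inv_map_iff:
  assumes "almost_iso \<phi>" shows "inv_map \<phi> w = Some v \<longleftrightarrow> \<phi> v = Some w"
  using almost_iso_inj[OF assms] by (auto simp: inv_map_def ran_def intro: theI the_equality)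

lemma almost_iso_inv:
  assumes \<phi>: "almost_iso \<phi>" shows "almost_iso (inv_map \<phi>)"
proof -
  have "dom (inv_map \<phi>) = ran \<phi>" "ran (inv_map \<phi>) = dom \<phi>"
    using inv_map_iff[OF \<phi>] by (auto simp: dom_def ran_def)
  then have "cofinite_forest (dom (inv_map \<phi>))" "cofinite_forest (ran (inv_map \<phi>))"
    using almost_isoD(1,2)[OF \<phi>] by simp_all
  moreover have "inj_on (inv_map \<phi>) (dom (inv_map \<phi>))"
  proof (rule inj_onI)
    fix w w' assume "w \<in> dom (inv_map \<phi>)" "inv_map \<phi> w = inv_map \<phi> w'"
    then obtain v where "inv_map \<phi> w = Some v" "inv_map \<phi> w' = Some v" by force
    then show "w = w'" by (simp add: inv_map_iff[OF \<phi>])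
  qed
  moreover have "(u, v) \<in> edges T \<longleftrightarrow> (u', v') \<in> edges T"
    if "inv_map \<phi> u = Some u'" "inv_map \<phi> v = Some v'" for u v u' v'
    using that almost_iso_edge[OF \<phi>] by (simp add: inv_map_iff[OF \<phi>])
  ultimately show ?thesis unfolding almost_iso_def by blast
qed

lemma inv_map_comp:
  assumes \<phi>: "almost_iso \<phi>" shows "inv_map \<phi> \<circ>\<^sub>m \<phi> = Some |` dom \<phi>" "\<phi> \<circ>\<^sub>m inv_map \<phi> = Some |` ran \<phi>"
proof -
  show "inv_map \<phi> \<circ>\<^sub>m \<phi> = Some |` dom \<phi>"
    by (rule ext) (auto simp: map_comp_def restrict_map_def inv_map_iff[OF \<phi>] split: option.split)
  have "dom (inv_map \<phi>) = ran \<phi>"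
    using inv_map_iff[OF \<phi>] by (auto simp: dom_def ran_def)
  moreover have "(\<phi> \<circ>\<^sub>m inv_map \<phi>) w = Some w" if "inv_map \<phi> w = Some v" for v w
  proof -
    have "\<phi> v = Some w" using that inv_map_iff[OF \<phi>] by blast
    then show ?thesis using that by (simp add: map_comp_def)
  qed
  moreover have "(\<phi> \<circ>\<^sub>m inv_map \<phi>) w = None" if "inv_map \<phi> w = None" for w
    using that by (simp add: map_comp_def)
  ultimately show "\<phi> \<circ>\<^sub>m inv_map \<phi> = Some |` ran \<phi>"
    by (intro ext) (metis domIff not_Some_eq restrict_in restrict_out)
qed

lemma almost_iso_id: "almost_iso (Some |` verts T)"
  by (rule almost_iso_id_on) (use edge_verts in \<open>auto simp: cofinite_forest_def\<close>)

lemma almost_eq_id_restrict: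
  assumes "cofinite_forest F" shows "almost_eq (Some |` F) (Some |` verts T)"
proof -
  have "{v. (Some |` F) v \<noteq> (Some |` verts T) v} \<subseteq> verts T - F"
    using assms by (auto simp: restrict_map_def cofinite_forest_def)
  then show ?thesis unfolding almost_eq_def
    using assms finite_subset by (auto simp: cofinite_forest_def)
qed

text \<open>The product of classes is defined by composing representatives with matching domain and image.
Restricting two given representatives produces such a pair, and it changes the composite only at
finitely many vertices.\<close>

lemma germ_mult:
  assumes \<phi>: "almost_iso \<phi>" and \<psi>: "almost_iso \<psi>"
  shows "germ \<psi> \<otimes>\<^bsub>AAut T\<^esub> germ \<phi> = germ (\<psi> \<circ>\<^sub>m \<phi>)"
proof -
  let ?A = "{\<psi>' \<circ>\<^sub>m \<phi>' | \<psi>' \<phi>'. \<psi>' \<in> germ \<psi> \<and> \<phi>' \<in> germ \<phi> \<and> dom \<psi>' = ran \<phi>'}"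
  have A: "almost_iso \<theta> \<and> almost_eq (\<psi> \<circ>\<^sub>m \<phi>) \<theta>" if "\<theta> \<in> ?A" for \<theta>
    using that almost_iso_comp almost_eq_comp \<phi> unfolding germ_def by blast
  have "\<exists>\<theta>. \<theta> \<in> ?A"
  proof -
    let ?F = "dom (\<psi> \<circ>\<^sub>m \<phi>)" and ?E = "ran (Some |` dom \<psi> \<circ>\<^sub>m \<phi>)"
    have F: "cofinite_forest ?F" using almost_isoD(1) almost_iso_comp \<phi> \<psi> by blast
    have E: "cofinite_forest ?E"
      using almost_isoD(2)[OF almost_iso_comp[OF \<phi> almost_iso_id_on[OF almost_isoD(1)[OF \<psi>]]]] .
    have sub: "dom \<psi> \<inter> ?E = ?E" by (auto simp: ran_def map_comp_def restrict_map_def split: option.splits if_splits)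
    have "dom (\<psi> |` ?E) = ran (\<phi> |` ?F)"
      unfolding dom_restrict sub
      by (auto simp: ran_def map_comp_def restrict_map_def dom_def split: option.splits if_splits)
    moreover have "almost_eq \<phi> (\<phi> |` ?F)" "almost_eq \<psi> (\<psi> |` ?E)"
    proof -
      have "almost_eq \<phi> (\<phi> |` F)" if \<phi>: "almost_iso \<phi>" and F: "cofinite_forest F" for \<phi> F
      proof -
        have "{v. \<phi> v \<noteq> (\<phi> |` F) v} \<subseteq> verts T - F"
          using almost_isoD(1)[OF \<phi>] by (auto simp: restrict_map_def cofinite_forest_def)
        then show ?thesis unfolding almost_eq_def
          using F finite_subset by (auto simp: cofinite_forest_def)
      qed
      then show "almost_eq \<phi> (\<phi> |` ?F)" "almost_eq \<psi> (\<psi> |` ?E)" using \<phi> \<psi> E F by auto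
    qed
    ultimately have "\<psi> |` ?E \<circ>\<^sub>m \<phi> |` ?F \<in> ?A"
      unfolding germ_def using almost_iso_restrict \<phi> \<psi> E F by blast
    then show ?thesis by blast
  qed
  then obtain \<theta> where \<theta>: "\<theta> \<in> ?A" by blast
  have "germ \<psi> \<otimes>\<^bsub>AAut T\<^esub> germ \<phi> = aaut_rel T `` ?A" by (simp add: AAut_def)
  also have "\<dots> = germ (\<psi> \<circ>\<^sub>m \<phi>)"
  proof (rule Set.set_eqI)
    fix \<omega>
    have "\<omega> \<in> aaut_rel T `` ?A \<longleftrightarrow> (\<exists>\<theta>\<in>?A. almost_iso \<omega> \<and> almost_eq \<theta> \<omega>)"
      using A by (auto simp only: Image_iff aaut_rel_iff)
    also have "\<dots> \<longleftrightarrow> almost_iso \<omega> \<and> almost_eq (\<psi> \<circ>\<^sub>m \<phi>) \<omega>"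
      using A \<theta> by (meson almost_eq_trans almost_eq_sym)
    finally show "\<omega> \<in> aaut_rel T `` ?A \<longleftrightarrow> \<omega> \<in> germ (\<psi> \<circ>\<^sub>m \<phi>)" by (simp only: germ_def mem_Collect_eq)
  qed
  finally show ?thesis .
qed

lemma one_AAut: "\<one>\<^bsub>AAut T\<^esub> = germ (Some |` verts T)"
  by (simp add: AAut_def aaut_class_eq almost_iso_id)

lemma germ_inv_left:
  assumes "almost_iso \<phi>" shows "germ (inv_map \<phi>) \<otimes>\<^bsub>AAut T\<^esub> germ \<phi> = \<one>\<^bsub>AAut T\<^esub>"
  unfolding germ_mult[OF assms almost_iso_inv[OF assms]] one_AAut inv_map_comp[OF assms]
  using almost_eq_id_restrict almost_isoD(1)[OF assms] almost_iso_comp[OF assms almost_iso_inv[OF assms]]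
  by (simp add: inv_map_comp[OF assms] germ_eq_iff almost_iso_id)

theorem group_AAut: "group (AAut T)"
proof (rule groupI)
  show "\<one>\<^bsub>AAut T\<^esub> \<in> carrier (AAut T)"
    using almost_iso_id by (auto simp: one_AAut carrier_AAut)
next
  fix x y z
  assume "x \<in> carrier (AAut T)" "y \<in> carrier (AAut T)" "z \<in> carrier (AAut T)"
  then obtain \<phi> \<psi> \<theta> where r: "almost_iso \<phi>" "almost_iso \<psi>" "almost_iso \<theta>" "x = germ \<phi>" "y = germ \<psi>" "z = germ \<theta>"
    by (auto simp: carrier_AAut)
  show "x \<otimes>\<^bsub>AAut T\<^esub> y \<otimes>\<^bsub>AAut T\<^esub> z = x \<otimes>\<^bsub>AAut T\<^esub> (y \<otimes>\<^bsub>AAut T\<^esub> z)"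
    using r by (simp add: germ_mult almost_iso_comp map_comp_assoc)
next
  fix x y
  assume "x \<in> carrier (AAut T)" "y \<in> carrier (AAut T)"
  then show "x \<otimes>\<^bsub>AAut T\<^esub> y \<in> carrier (AAut T)"
    by (auto simp: carrier_AAut germ_mult almost_iso_comp)
next
  fix x assume "x \<in> carrier (AAut T)"
  then obtain \<phi> where \<phi>: "almost_iso \<phi>" "x = germ \<phi>" by (auto simp: carrier_AAut)
  have "Some |` verts T \<circ>\<^sub>m \<phi> = \<phi>"
    using almost_iso_verts[OF \<phi>(1)] by (auto simp: map_comp_def restrict_map_def fun_eq_iff split: option.split)
  then show "\<one>\<^bsub>AAut T\<^esub> \<otimes>\<^bsub>AAut T\<^esub> x = x" using \<phi> by (simp add: one_AAut germ_mult almost_iso_id)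
  show "\<exists>y\<in>carrier (AAut T). y \<otimes>\<^bsub>AAut T\<^esub> x = \<one>\<^bsub>AAut T\<^esub>"
    using germ_inv_left[OF \<phi>(1)] almost_iso_inv[OF \<phi>(1)] \<phi> by (auto simp: carrier_AAut)
qed

end

section \<open>Patterned maps\<close>

locale patterned_tree = leafless_tree T depth
  for T :: "('v, 'x) rooted_tree_scheme" and depth +
  fixes P :: "('v, 'l, 'c, 'y) patterning_scheme"
  assumes patterning: "is_patterning T P"
begin

abbreviation "G \<equiv> AAut_pat T P"

lemma colouring: "is_colouring T P"
  using patterning by (simp add: is_patterning_def)

lemma label_mem: "v \<in> verts T \<Longrightarrow> v \<noteq> base T \<Longrightarrow> lab P v \<in> labels P"
proof -
  have "lab P ` (verts T - {base T}) \<subseteq> labels P"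
    using colouring unfolding is_colouring_def by (elim conjE)
  then show "v \<in> verts T \<Longrightarrow> v \<noteq> base T \<Longrightarrow> lab P v \<in> labels P" by blast
qed

lemma child_vert: "u \<in> children T v \<Longrightarrow> u \<in> verts T \<and> u \<noteq> base T"
  using edge_verts not_edge_base by (auto simp: children_def)

lemma colour_bij:
  assumes "v \<in> verts T" "v \<noteq> base T" "l \<in> labels P"
  shows "bij_betw (ccol P) {e \<in> out_edges T v. lab P (snd e) = l} (cols P (lab P v) l)"
proof -
  have "\<forall>v\<in>verts T - {base T}. \<forall>l\<in>labels P. card (cols P (lab P v) l) = card {u \<in> children T v. lab P u = l} \<and>
      bij_betw (ccol P) {e \<in> out_edges T v. lab P (snd e) = l} (cols P (lab P v) l)"
    using colouring unfolding is_colouring_def by (elim conjE)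
  then show ?thesis using assms by simp
qed

lemma colour_mem:
  assumes "v \<in> verts T" "v \<noteq> base T" "u \<in> children T v"
  shows "ccol P (v, u) \<in> cols P (lab P v) (lab P u)"
proof -
  have "(v, u) \<in> {e \<in> out_edges T v. lab P (snd e) = lab P u}"
    using assms by (simp add: out_edges_def children_def)
  then show ?thesis
    using bij_betwE[OF colour_bij[OF assms(1,2), of "lab P u"]] label_mem child_vert[OF assms(3)] by blast
qed

lemma colour_mem_all:
  assumes "v \<in> verts T" "v \<noteq> base T" "u \<in> children T v"
  shows "ccol P (v, u) \<in> all_cols P (lab P v)"
  unfolding all_cols_def using colour_mem[OF assms] label_mem child_vert[OF assms(3)] by blast

lemma cols_disjoint:
  assumes "c \<in> cols P l k" "c \<in> cols P l' k'" "l \<in> labels P" "k \<in> labels P" "l' \<in> labels P" "k' \<in> labels P"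
  shows "l = l' \<and> k = k'"
proof -
  have "disjoint_family_on (\<lambda>(l, l'). cols P l l') (labels P \<times> labels P)"
    using colouring unfolding is_colouring_def by (elim conjE)
  then have "(l, k) \<noteq> (l', k') \<Longrightarrow> cols P l k \<inter> cols P l' k' = {}"
    using assms(3-6) disjoint_family_onD[of "\<lambda>(l, l'). cols P l l'" _ "(l, k)" "(l', k')"] by simp
  then show ?thesis using assms(1,2) by blast
qed

lemma colour_inj:
  assumes v: "v \<in> verts T" "v \<noteq> base T" and u: "u \<in> children T v" "u' \<in> children T v"
    and eq: "ccol P (v, u) = ccol P (v, u')"
  shows "u = u'"
proof -
  have "lab P u = lab P u'"
    using cols_disjoint[OF colour_mem[OF v u(1)], of "lab P v" "lab P u'"] colour_mem[OF v u(2)] eq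
      label_mem[OF v] label_mem[of u] label_mem[of u'] child_vert[OF u(1)] child_vert[OF u(2)] by simp
  then have "(v, u) \<in> {e \<in> out_edges T v. lab P (snd e) = lab P u'}"
      "(v, u') \<in> {e \<in> out_edges T v. lab P (snd e) = lab P u'}"
    using u by (auto simp: out_edges_def children_def)
  moreover have "lab P u' \<in> labels P" using label_mem child_vert[OF u(2)] by blast
  ultimately have "(v, u) = (v, u')"
    using inj_onD[OF bij_betw_imp_inj_on[OF colour_bij[OF v]] eq] by blast
  then show ?thesis by simp
qed

lemma colour_surj:
  assumes v: "v \<in> verts T" "v \<noteq> base T" and c: "c \<in> all_cols P (lab P v)"
  obtains u where "u \<in> children T v" "ccol P (v, u) = c"
proof -
  obtain l where l: "l \<in> labels P" "c \<in> cols P (lab P v) l" using c by (auto simp: all_cols_def)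
  have "ccol P ` {e \<in> out_edges T v. lab P (snd e) = l} = cols P (lab P v) l"
    by (rule bij_betw_imp_surj_on[OF colour_bij[OF v l(1)]])
  then have "c \<in> ccol P ` {e \<in> out_edges T v. lab P (snd e) = l}" using l(2) by simp
  then obtain e where "e \<in> out_edges T v" "ccol P e = c" by blast
  then show thesis using that[of "snd e"] by (auto simp: out_edges_def children_def)
qed

lemma local_perm_colour:
  assumes v: "v \<in> verts T" "v \<noteq> base T" and u: "u \<in> children T v"
  shows "local_perm T P f v (ccol P (v, u)) = ccol P (f v, f u)"
proof -
  have "inj_on (ccol P) (out_edges T v)"
    using colour_inj[OF v] by (auto simp: inj_on_def out_edges_def children_def)
  moreover have "(v, u) \<in> out_edges T v" using u by (simp add: out_edges_def children_def)
  ultimately have "inv_into (out_edges T v) (ccol P) (ccol P (v, u)) = (v, u)" by (rule inv_into_f_f)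
  then show ?thesis using colour_mem_all[OF v u] by (simp add: local_perm_def)
qed

lemma perms_subgroup: "l \<in> labels P \<Longrightarrow> subgroup (perms P l) (BijGroup (all_cols P l))"
  using patterning by (simp add: is_patterning_def)

lemma perms_Bij: "l \<in> labels P \<Longrightarrow> \<sigma> \<in> perms P l \<Longrightarrow> \<sigma> \<in> Bij (all_cols P l)"
  using subgroup.mem_carrier[OF perms_subgroup] by (simp add: BijGroup_def)

lemma perms_compose:
  assumes "l \<in> labels P" "\<sigma> \<in> perms P l" "\<tau> \<in> perms P l"
  shows "compose (all_cols P l) \<sigma> \<tau> \<in> perms P l"
  using subgroup.m_closed[OF perms_subgroup[OF assms(1)] assms(2,3)] perms_Bij[OF assms(1)] assms(2,3)
  by (simp add: BijGroup_def)

lemma perms_id: "l \<in> labels P \<Longrightarrow> (\<lambda>c\<in>all_cols P l. c) \<in> perms P l"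
  using subgroup.one_closed[OF perms_subgroup] by (simp add: BijGroup_def)

lemma perms_inv:
  assumes "l \<in> labels P" "\<sigma> \<in> perms P l"
  shows "(\<lambda>c\<in>all_cols P l. inv_into (all_cols P l) \<sigma> c) \<in> perms P l"
  using subgroup.m_inv_closed[OF perms_subgroup[OF assms(1)] assms(2)] perms_Bij[OF assms]
  by (simp add: inv_BijGroup)

text \<open>The local permutation at \<open>v\<close>, expressed by a group element that tracks the colours of children.
In this form composites and inverses are immediate.\<close>

definition locally_patterned :: "('v \<Rightarrow> 'v) \<Rightarrow> 'v \<Rightarrow> bool" where
  "locally_patterned f v \<longleftrightarrow> lab P (f v) = lab P v \<and>
     (\<exists>\<sigma>\<in>perms P (lab P v). \<forall>u\<in>children T v. ccol P (f v, f u) = \<sigma> (ccol P (v, u)))"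

text \<open>A member of the local group is an extensional function on the colours of \<open>v\<close>, all of which occur at
children, so it is determined by its effect there.\<close>

lemma local_perm_mem_iff:
  assumes v: "v \<in> verts T" "v \<noteq> base T"
  shows "local_perm T P f v \<in> perms P (lab P v) \<longleftrightarrow>
    (\<exists>\<sigma>\<in>perms P (lab P v). \<forall>u\<in>children T v. ccol P (f v, f u) = \<sigma> (ccol P (v, u)))"
proof
  assume "local_perm T P f v \<in> perms P (lab P v)"
  then show "\<exists>\<sigma>\<in>perms P (lab P v). \<forall>u\<in>children T v. ccol P (f v, f u) = \<sigma> (ccol P (v, u))"
    using local_perm_colour[OF v] by (intro bexI[of _ "local_perm T P f v"]) auto
next
  assume "\<exists>\<sigma>\<in>perms P (lab P v). \<forall>u\<in>children T v. ccol P (f v, f u) = \<sigma> (ccol P (v, u))"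
  then obtain \<sigma> where \<sigma>: "\<sigma> \<in> perms P (lab P v)"
      "\<And>u. u \<in> children T v \<Longrightarrow> ccol P (f v, f u) = \<sigma> (ccol P (v, u))" by blast
  have "local_perm T P f v = \<sigma>"
  proof (rule extensionalityI[of _ "all_cols P (lab P v)"])
    show "local_perm T P f v \<in> extensional (all_cols P (lab P v))" by (simp add: local_perm_def)
    show "\<sigma> \<in> extensional (all_cols P (lab P v))"
      using perms_Bij[OF label_mem[OF v] \<sigma>(1)] by (rule Bij_imp_extensional)
    fix c assume "c \<in> all_cols P (lab P v)"
    then obtain u where "u \<in> children T v" "ccol P (v, u) = c" using colour_surj[OF v] by blast
    then show "local_perm T P f v c = \<sigma> c" using local_perm_colour[OF v, of u f] \<sigma>(2)[of u] by simp
  qed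
  then show "local_perm T P f v \<in> perms P (lab P v)" using \<sigma> by simp
qed

lemma locally_patterned_iff:
  assumes "v \<in> verts T" "v \<noteq> base T"
  shows "locally_patterned f v \<longleftrightarrow> lab P (f v) = lab P v \<and> local_perm T P f v \<in> perms P (lab P v)"
  using local_perm_mem_iff[OF assms] by (simp add: locally_patterned_def)

text \<open>The local groups preserve the parts \<open>D\<^sub>l\<^sub>,\<^sub>l\<^sub>'\<close>, and the part that contains the colour of an edge tells the
label of its terminus. So only the labels of leaves have to be required.\<close>

lemma child_label_eq:
  assumes f: "locally_patterned f v" and v: "v \<in> verts T" "v \<noteq> base T" "f v \<in> verts T" "f v \<noteq> base T"
    and u: "u \<in> children T v" "f u \<in> children T (f v)"
  shows "lab P (f u) = lab P u"
proof -
  obtain \<sigma> where lab: "lab P (f v) = lab P v" and \<sigma>: "\<sigma> \<in> perms P (lab P v)"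
      "\<forall>u\<in>children T v. ccol P (f v, f u) = \<sigma> (ccol P (v, u))"
    using f by (auto simp: locally_patterned_def)
  have l: "lab P v \<in> labels P" "lab P u \<in> labels P" "lab P (f u) \<in> labels P"
    using label_mem v child_vert u by blast+
  have "\<sigma> ` cols P (lab P v) (lab P u) = cols P (lab P v) (lab P u)"
    using patterning l \<sigma>(1) by (simp add: is_patterning_def)
  then have "\<sigma> (ccol P (v, u)) \<in> cols P (lab P v) (lab P u)"
    using colour_mem[OF v(1,2) u(1)] by blast
  then have "ccol P (f v, f u) \<in> cols P (lab P v) (lab P u)" using \<sigma>(2) u(1) by simp
  moreover have "ccol P (f v, f u) \<in> cols P (lab P v) (lab P (f u))"
    using colour_mem[OF v(3,4) u(2)] lab by simp
  ultimately show ?thesis using cols_disjoint[OF _ _ l(1,2,1,3)] by metis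
qed

lemma locally_patterned_if_colours_kept:
  assumes "v \<in> verts T" "v \<noteq> base T" "lab P (f v) = lab P v"
    and "\<And>u. u \<in> children T v \<Longrightarrow> ccol P (f v, f u) = ccol P (v, u)"
  shows "locally_patterned f v"
  unfolding locally_patterned_def
  using assms perms_id label_mem colour_mem_all
  by (intro conjI bexI[of _ "\<lambda>c\<in>all_cols P (lab P v). c"]) auto

lemma locally_patterned_comp:
  assumes \<phi>: "almost_iso \<phi>" and \<psi>: "almost_iso \<psi>"
    and v: "\<phi> v = Some u" "\<psi> u = Some w" "v \<noteq> base T"
    and p: "locally_patterned (the \<circ> \<phi>) v" "locally_patterned (the \<circ> \<psi>) u"
  shows "locally_patterned (the \<circ> (\<psi> \<circ>\<^sub>m \<phi>)) v"
proof -
  have vV: "v \<in> verts T" using almost_iso_verts[OF \<phi> v(1)] by simp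
  obtain \<sigma> where \<sigma>: "\<sigma> \<in> perms P (lab P v)" "lab P u = lab P v"
      "\<And>c. c \<in> children T v \<Longrightarrow> ccol P (u, the (\<phi> c)) = \<sigma> (ccol P (v, c))"
    using p(1) v by (auto simp: locally_patterned_def)
  obtain \<tau> where \<tau>: "\<tau> \<in> perms P (lab P v)" "lab P w = lab P v"
      "\<And>c. c \<in> children T u \<Longrightarrow> ccol P (w, the (\<psi> c)) = \<tau> (ccol P (u, c))"
    using p(2) v \<sigma>(2) by (auto simp: locally_patterned_def)
  have "ccol P ((the \<circ> (\<psi> \<circ>\<^sub>m \<phi>)) v, (the \<circ> (\<psi> \<circ>\<^sub>m \<phi>)) c) =
      compose (all_cols P (lab P v)) \<tau> \<sigma> (ccol P (v, c))" if c: "c \<in> children T v" for c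
  proof -
    obtain c' where c': "\<phi> c = Some c'" "c' \<in> children T u"
      using almost_iso_child[OF \<phi> v(1)] c by (auto simp: children_def)
    then obtain c'' where "\<psi> c' = Some c''"
      using almost_iso_child[OF \<psi> v(2)] by (auto simp: children_def)
    then show ?thesis
      using \<sigma>(3)[OF c] \<tau>(3)[OF c'(2)] c' v colour_mem_all[OF vV v(3) c] by (simp add: compose_def)
  qed
  then have "\<exists>\<rho>\<in>perms P (lab P v). \<forall>c\<in>children T v.
      ccol P ((the \<circ> (\<psi> \<circ>\<^sub>m \<phi>)) v, (the \<circ> (\<psi> \<circ>\<^sub>m \<phi>)) c) = \<rho> (ccol P (v, c))"
    by (intro bexI[OF _ perms_compose[OF label_mem[OF vV v(3)] \<tau>(1) \<sigma>(1)]] ballI)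
  then show ?thesis using \<tau>(2) v by (simp add: locally_patterned_def)
qed

lemma locally_patterned_inv:
  assumes \<phi>: "almost_iso \<phi>" and v: "\<phi> v = Some u" "v \<noteq> base T"
    and p: "locally_patterned (the \<circ> \<phi>) v"
  shows "locally_patterned (the \<circ> inv_map \<phi>) u"
proof -
  have vV: "v \<in> verts T" using almost_iso_verts[OF \<phi> v(1)] by simp
  let ?D = "all_cols P (lab P v)"
  obtain \<sigma> where \<sigma>: "\<sigma> \<in> perms P (lab P v)" "lab P u = lab P v"
      "\<And>c. c \<in> children T v \<Longrightarrow> ccol P (u, the (\<phi> c)) = \<sigma> (ccol P (v, c))"
    using p v by (auto simp: locally_patterned_def)
  have \<sigma>_bij: "bij_betw \<sigma> ?D ?D" using perms_Bij[OF label_mem[OF vV v(2)] \<sigma>(1)] by (simp add: Bij_def)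
  have inv: "inv_map \<phi> u = Some v" using inv_map_iff[OF \<phi>] v by simp
  have "ccol P (v, the (inv_map \<phi> c')) = (\<lambda>c\<in>?D. inv_into ?D \<sigma> c) (ccol P (u, c'))"
    if c': "c' \<in> children T u" for c'
  proof -
    obtain c where c: "\<phi> c = Some c'" "c \<in> children T v"
      using almost_iso_child_inv[OF \<phi> v(1)] c' by (auto simp: children_def)
    have D: "ccol P (v, c) \<in> ?D" using colour_mem_all[OF vV v(2) c(2)] .
    have "ccol P (u, c') = \<sigma> (ccol P (v, c))" using \<sigma>(3)[OF c(2)] c by simp
    moreover have "inv_into ?D \<sigma> (\<sigma> (ccol P (v, c))) = ccol P (v, c)"
      using \<sigma>_bij D by (simp add: bij_betw_def)
    moreover have "\<sigma> (ccol P (v, c)) \<in> ?D" using \<sigma>_bij D bij_betwE by blast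
    moreover have "inv_map \<phi> c' = Some c" using inv_map_iff[OF \<phi>] c by simp
    ultimately show ?thesis by simp
  qed
  then have "\<exists>\<tau>\<in>perms P (lab P v). \<forall>c'\<in>children T u.
      ccol P (v, the (inv_map \<phi> c')) = \<tau> (ccol P (u, c'))"
    by (intro bexI[OF _ perms_inv[OF label_mem[OF vV v(2)] \<sigma>(1)]] ballI)
  then show ?thesis using inv \<sigma>(2) by (simp add: locally_patterned_def)
qed

definition patterned_map :: "('v \<rightharpoonup> 'v) \<Rightarrow> bool" where
  "patterned_map \<phi> \<longleftrightarrow> almost_iso \<phi> \<and> base T \<notin> dom \<phi> \<and> base T \<notin> ran \<phi> \<and>
     (\<forall>v\<in>dom \<phi>. locally_patterned (the \<circ> \<phi>) v)"

lemma patterned_mapD: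
  assumes "patterned_map \<phi>"
  shows "almost_iso \<phi>" "\<phi> v = Some w \<Longrightarrow> v \<noteq> base T" "\<phi> v = Some w \<Longrightarrow> w \<noteq> base T"
    "\<phi> v = Some w \<Longrightarrow> locally_patterned (the \<circ> \<phi>) v"
    "\<phi> v = Some w \<Longrightarrow> lab P w = lab P v"
proof -
  show "almost_iso \<phi>" "\<phi> v = Some w \<Longrightarrow> v \<noteq> base T" "\<phi> v = Some w \<Longrightarrow> w \<noteq> base T"
    using assms unfolding patterned_map_def by (auto simp: ran_def)
  show "locally_patterned (the \<circ> \<phi>) v" if "\<phi> v = Some w"
    using assms that unfolding patterned_map_def by blast
  then show "\<phi> v = Some w \<Longrightarrow> lab P w = lab P v" by (simp add: locally_patterned_def)
qed

text \<open>Preservation of labels propagates from the leaves of \<open>S\<^sub>1\<close> to all vertices of the forest, and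
\<open>base_in_forest\<close> accounts for the condition that \<open>S\<^sub>1\<close> and \<open>S\<^sub>2\<close> are not trivial.\<close>

lemma patterned_iff: "patterned T P \<phi> \<longleftrightarrow> patterned_map \<phi>"
proof
  assume "patterned T P \<phi>"
  then obtain S\<^sub>1 S\<^sub>2 where h: "honest T S\<^sub>1 S\<^sub>2 \<phi>" "S\<^sub>1 \<noteq> {base T}" "S\<^sub>2 \<noteq> {base T}"
    and leaf: "\<forall>v\<in>leaves T S\<^sub>1. lab P (the (\<phi> v)) = lab P v"
    and perm: "\<forall>v\<in>forest T S\<^sub>1. local_perm T P (the \<circ> \<phi>) v \<in> perms P (lab P v)"
    by (auto simp: patterned_def)
  have \<phi>: "almost_iso \<phi>" and dom: "dom \<phi> = forest T S\<^sub>1" and ran: "ran \<phi> = forest T S\<^sub>2"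
    and base: "base T \<notin> dom \<phi>" "base T \<notin> ran \<phi>"
    using h base_in_forest unfolding honest_iff by auto
  have nonbase: "v \<in> verts T" "v \<noteq> base T" if "\<phi> v = Some w" for v w
    using that base almost_iso_verts[OF \<phi>] by auto
  have nonbase': "w \<in> verts T" "w \<noteq> base T" if "\<phi> v = Some w" for v w
    using that base almost_iso_verts[OF \<phi>] by (auto simp: ran_def)
  have lab: "lab P (the (\<phi> v)) = lab P v" if w: "w \<in> leaves T S\<^sub>1" "(w, v) \<in> (edges T)\<^sup>*" for w v
    using w(2)
  proof (induction rule: rtrancl_induct)
    case base
    then show ?case using leaf w by blast
  next
    case (step v u)
    have "v \<in> dom \<phi>" using w step by (auto simp: dom forest_def descendants_def)
    then obtain v' where v': "\<phi> v = Some v'" by blast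
    then obtain u' where u': "\<phi> u = Some u'" "(v', u') \<in> edges T"
      using almost_iso_child[OF \<phi> _ step(2)] by blast
    have "locally_patterned (the \<circ> \<phi>) v"
      using locally_patterned_iff nonbase[OF v'] step(3) perm \<open>v \<in> dom \<phi>\<close> dom by auto
    then show ?case
      using child_label_eq[of "the \<circ> \<phi>" v u] nonbase[OF v'] nonbase'[OF v'] v' u' step(2)
      by (simp add: children_def)
  qed
  have "locally_patterned (the \<circ> \<phi>) v" if v: "v \<in> dom \<phi>" for v
  proof -
    have "lab P (the (\<phi> v)) = lab P v"
      using lab v by (auto simp: dom forest_def descendants_def)
    moreover obtain w where "\<phi> v = Some w" using v by blast
    ultimately show ?thesis using locally_patterned_iff[OF nonbase] v perm dom by auto
  qed
  then show "patterned_map \<phi>" using \<phi> base by (simp add: patterned_map_def)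
next
  assume p: "patterned_map \<phi>"
  note \<phi> = patterned_mapD(1)[OF p]
  obtain S\<^sub>1 where S1: "finite_complete T S\<^sub>1" "forest T S\<^sub>1 = dom \<phi>"
    using forest_of_cofinite[OF almost_isoD(1)[OF \<phi>]] .
  obtain S\<^sub>2 where S2: "finite_complete T S\<^sub>2" "forest T S\<^sub>2 = ran \<phi>"
    using forest_of_cofinite[OF almost_isoD(2)[OF \<phi>]] .
  have ne: "S\<^sub>1 \<noteq> {base T}" "S\<^sub>2 \<noteq> {base T}"
    using base_in_forest[OF S1(1)] base_in_forest[OF S2(1)] S1 S2 p by (auto simp: patterned_map_def)
  have loc: "lab P (the (\<phi> v)) = lab P v \<and> local_perm T P (the \<circ> \<phi>) v \<in> perms P (lab P v)"
    if "v \<in> forest T S\<^sub>1" for v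
  proof -
    have "v \<in> dom \<phi>" using that S1 by simp
    then obtain w where w: "\<phi> v = Some w" by blast
    show ?thesis
      using locally_patterned_iff[of v "the \<circ> \<phi>"] patterned_mapD[OF p] w almost_iso_verts(1)[OF \<phi> w] by simp
  qed
  have "honest T S\<^sub>1 S\<^sub>2 \<phi>" using S1 S2 \<phi> by (simp add: honest_iff)
  then show "patterned T P \<phi>"
    unfolding patterned_def using ne loc leaves_subset_forest by (intro exI[of _ S\<^sub>1] exI[of _ S\<^sub>2]) blast
qed

lemma patterned_map_comp:
  assumes "patterned_map \<phi>" "patterned_map \<psi>" shows "patterned_map (\<psi> \<circ>\<^sub>m \<phi>)"
proof -
  note \<phi> = patterned_mapD[OF assms(1)] and \<psi> = patterned_mapD[OF assms(2)]
  have c: "\<exists>u. \<phi> v = Some u \<and> \<psi> u = Some w" if "(\<psi> \<circ>\<^sub>m \<phi>) v = Some w" for v w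
    using that by (auto simp: map_comp_def split: option.splits)
  have "locally_patterned (the \<circ> (\<psi> \<circ>\<^sub>m \<phi>)) v" if v: "v \<in> dom (\<psi> \<circ>\<^sub>m \<phi>)" for v
  proof -
    obtain w u where "\<phi> v = Some u" "\<psi> u = Some w" using c v by blast
    then show ?thesis using locally_patterned_comp[OF \<phi>(1) \<psi>(1)] \<phi>(2,4) \<psi>(4) by blast
  qed
  moreover have "base T \<notin> dom (\<psi> \<circ>\<^sub>m \<phi>)" "base T \<notin> ran (\<psi> \<circ>\<^sub>m \<phi>)"
    using c \<phi>(2) \<psi>(3) unfolding ran_def by blast+
  ultimately show ?thesis unfolding patterned_map_def using almost_iso_comp \<phi>(1) \<psi>(1) by blast
qed

lemma patterned_map_inv:
  assumes "patterned_map \<phi>" shows "patterned_map (inv_map \<phi>)"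
proof -
  note \<phi> = patterned_mapD[OF assms]
  have "locally_patterned (the \<circ> inv_map \<phi>) u" if u: "u \<in> dom (inv_map \<phi>)" for u
  proof -
    obtain v where "\<phi> v = Some u" using u inv_map_iff[OF \<phi>(1)] by blast
    then show ?thesis using locally_patterned_inv[OF \<phi>(1)] \<phi>(2,4) by blast
  qed
  moreover have "base T \<notin> dom (inv_map \<phi>)" "base T \<notin> ran (inv_map \<phi>)"
    using \<phi>(2,3) inv_map_iff[OF \<phi>(1)] unfolding ran_def dom_def by blast+
  ultimately show ?thesis unfolding patterned_map_def using almost_iso_inv[OF \<phi>(1)] by blast
qed

lemma cofinite_forest_nonbase: "cofinite_forest (verts T - {base T})"
  using edge_verts not_edge_base by (auto simp: cofinite_forest_def intro: finite_subset[of _ "{base T}"])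

lemma patterned_map_id: "patterned_map (Some |` (verts T - {base T}))"
proof -
  have "locally_patterned (the \<circ> Some |` (verts T - {base T})) v" if v: "v \<in> verts T - {base T}" for v
    using v child_vert by (intro locally_patterned_if_colours_kept) (auto simp: restrict_map_def)
  moreover have "dom (Some |` (verts T - {base T})) = verts T - {base T}"
      "ran (Some |` (verts T - {base T})) = verts T - {base T}"
    by (auto simp: ran_def restrict_map_def split: if_splits)
  ultimately show ?thesis
    unfolding patterned_map_def using almost_iso_id_on[OF cofinite_forest_nonbase] by auto
qed

lemma carrier_AAut_pat: "carrier G = germ ` {\<phi>. patterned_map \<phi>}"
proof -
  have "germ \<phi> \<in> germ ` {\<phi>. patterned_map \<phi>}"
    if "almost_iso \<phi>" "\<psi> \<in> germ \<phi>" "patterned_map \<psi>" for \<phi> \<psi>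
  proof -
    have "germ \<phi> = germ \<psi>" using that germ_eq_iff by (simp add: germ_def)
    then show ?thesis using that by blast
  qed
  then show ?thesis
    unfolding AAut_pat_def carrier_AAut patterned_iff
    using in_germ patterned_mapD(1) by auto
qed

lemma subgroup_AAut_pat: "subgroup (carrier G) (AAut T)"
proof -
  interpret A: group "AAut T" by (rule group_AAut)
  show ?thesis
  proof (rule A.subgroupI)
    show "carrier G \<subseteq> carrier (AAut T)" by (auto simp: AAut_pat_def)
    show "carrier G \<noteq> {}" using patterned_map_id by (auto simp: carrier_AAut_pat)
  next
    fix x assume "x \<in> carrier G"
    then obtain \<phi> where \<phi>: "patterned_map \<phi>" "x = germ \<phi>" by (auto simp: carrier_AAut_pat)
    note i = patterned_mapD(1)[OF \<phi>(1)]
    have "inv\<^bsub>AAut T\<^esub> x = germ (inv_map \<phi>)"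
      using germ_inv_left[OF i] almost_iso_inv[OF i] i \<phi>
      by (intro A.inv_equality) (auto simp: carrier_AAut)
    then show "inv\<^bsub>AAut T\<^esub> x \<in> carrier G"
      using patterned_map_inv \<phi> by (auto simp: carrier_AAut_pat)
  next
    fix x y assume "x \<in> carrier G" "y \<in> carrier G"
    then show "x \<otimes>\<^bsub>AAut T\<^esub> y \<in> carrier G"
      using patterned_map_comp patterned_mapD(1) by (auto simp: carrier_AAut_pat germ_mult)
  qed
qed

lemma mult_AAut_pat: "x \<otimes>\<^bsub>G\<^esub> y = x \<otimes>\<^bsub>AAut T\<^esub> y"
  by (simp add: AAut_pat_def)

lemma one_AAut_pat: "\<one>\<^bsub>G\<^esub> = germ (Some |` verts T)"
  by (simp add: AAut_pat_def one_AAut)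

theorem group_AAut_pat: "group G"
proof -
  have "G = (AAut T)\<lparr>carrier := carrier G\<rparr>" by (simp add: AAut_pat_def)
  then show ?thesis using subgroup.subgroup_is_group[OF subgroup_AAut_pat group_AAut] by simp
qed

lemma germ_in_carrier: "patterned_map \<phi> \<Longrightarrow> germ \<phi> \<in> carrier G"
  by (auto simp: carrier_AAut_pat)

lemma germ_mult_pat:
  "almost_iso \<phi> \<Longrightarrow> almost_iso \<psi> \<Longrightarrow> germ \<psi> \<otimes>\<^bsub>G\<^esub> germ \<phi> = germ (\<psi> \<circ>\<^sub>m \<phi>)"
  by (simp add: mult_AAut_pat germ_mult)

text \<open>The representative \<open>\<phi>\<close> may be defined at the root, so it need not be a patterned map, although its
class contains one.\<close>

lemma germ_inv_pat:
  assumes "almost_iso \<phi>" "germ \<phi> \<in> carrier G"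
  shows "inv\<^bsub>G\<^esub> germ \<phi> = germ (inv_map \<phi>)"
proof -
  interpret group "G" by (rule group_AAut_pat)
  obtain \<psi> where \<psi>: "patterned_map \<psi>" "germ \<phi> = germ \<psi>" using assms(2) by (auto simp: carrier_AAut_pat)
  note i = patterned_mapD(1)[OF \<psi>(1)]
  interpret A: group "AAut T" by (rule group_AAut)
  have inv: "inv\<^bsub>AAut T\<^esub> germ \<theta> = germ (inv_map \<theta>)" if "almost_iso \<theta>" for \<theta>
    using germ_inv_left almost_iso_inv that by (intro A.inv_equality) (auto simp: carrier_AAut)
  have "germ (inv_map \<phi>) = inv\<^bsub>AAut T\<^esub> germ \<phi>" "germ (inv_map \<psi>) = inv\<^bsub>AAut T\<^esub> germ \<psi>"
    using inv assms(1) i by simp_all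
  then have "germ (inv_map \<phi>) = germ (inv_map \<psi>)" using \<psi> by simp
  then show ?thesis
    using germ_inv_left[OF i] patterned_map_inv[OF \<psi>(1)] \<psi> assms(2)
    by (intro inv_equality) (auto simp: mult_AAut_pat one_AAut_pat one_AAut carrier_AAut_pat)
qed

section \<open>The topology given by stabilisers of balls\<close>

definition as_map :: "('v \<Rightarrow> 'v) \<Rightarrow> ('v \<rightharpoonup> 'v)" where
  "as_map g = (Some \<circ> g) |` verts T"

lemma as_map_iff: "as_map g v = Some w \<longleftrightarrow> v \<in> verts T \<and> g v = w"
  by (simp add: as_map_def restrict_map_def)

lemma AutD:
  assumes "g \<in> Aut T"
  shows "g \<in> extensional (verts T)" "bij_betw g (verts T) (verts T)" "g (base T) = base T"
    "u \<in> verts T \<Longrightarrow> v \<in> verts T \<Longrightarrow> (u, v) \<in> edges T \<longleftrightarrow> (g u, g v) \<in> edges T"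
  using assms by (auto simp: Aut_def Bij_def)

lemma Aut_verts: "g \<in> Aut T \<Longrightarrow> v \<in> verts T \<Longrightarrow> g v \<in> verts T"
  using AutD(2) bij_betwE by blast

lemma Aut_depth:
  assumes g: "g \<in> Aut T" and v: "v \<in> verts T" shows "depth (g v) = depth v"
  using v
proof (induction rule: tree_induct)
  case base
  then show ?case using AutD(3)[OF g] by simp
next
  case (child u v)
  then have "(g u, g v) \<in> edges T" using AutD(4)[OF g] edge_verts by blast
  then show ?case using child depth_edge by simp
qed

lemma Aut_nonbase: "g \<in> Aut T \<Longrightarrow> v \<in> verts T \<Longrightarrow> v \<noteq> base T \<Longrightarrow> g v \<noteq> base T"
  using Aut_depth depth_0 depth_base by metis

lemma almost_iso_as_map:
  assumes g: "g \<in> Aut T" shows "almost_iso (as_map g)"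
proof -
  have "dom (as_map g) = verts T" "ran (as_map g) = verts T"
  proof -
    have "ran (as_map g) = g ` verts T" by (auto simp: ran_def as_map_iff)
    then show "ran (as_map g) = verts T" using bij_betw_imp_surj_on[OF AutD(2)[OF g]] by simp
  qed (auto simp: dom_def as_map_iff)
  moreover have "cofinite_forest (verts T)" using edge_verts by (auto simp: cofinite_forest_def)
  moreover have "inj_on (as_map g) (verts T)"
    using AutD(2)[OF g] by (auto simp: inj_on_def as_map_def bij_betw_def)
  moreover have "(u, v) \<in> edges T \<longleftrightarrow> (u', v') \<in> edges T"
    if "as_map g u = Some u'" "as_map g v = Some v'" for u v u' v'
    using that AutD(4)[OF g, of u v] by (simp add: as_map_iff)
  ultimately show ?thesis unfolding almost_iso_def by simp
qed

lemma aaut_of_aut_eq: "g \<in> Aut T \<Longrightarrow> aaut_of_aut T g = germ (as_map g)"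
  using aaut_class_eq[OF almost_iso_as_map] by (simp add: aaut_of_aut_def as_map_def)

text \<open>An automorphism is determined by any germ, parents being unique.\<close>

lemma as_map_determined_by_germ:
  assumes \<phi>: "almost_iso \<phi>" "dom \<phi> = verts T" and \<psi>: "almost_iso \<psi>" "dom \<psi> = verts T"
    and eq: "almost_eq \<phi> \<psi>"
  shows "\<phi> = \<psi>"
proof
  obtain n where n: "\<And>v. n \<le> depth v \<Longrightarrow> \<phi> v = \<psi> v" using almost_eq_deep[OF eq] by blast
  have step: "\<phi> v = \<psi> v" if "v \<in> verts T" for v
    using that
  proof (induction "n - depth v" arbitrary: v)
    case 0
    then show ?case using n by simp
  next
    case (Suc k)
    obtain w where w: "(v, w) \<in> edges T" using child_ex Suc by blast
    then have "k = n - depth w" "w \<in> verts T" using Suc(2) depth_edge[OF w] edge_verts by auto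
    then have eq: "\<phi> w = \<psi> w" using Suc by blast
    obtain v1 where v1: "\<phi> v = Some v1" using Suc \<phi> by blast
    obtain v2 where v2: "\<psi> v = Some v2" using Suc \<psi> by blast
    obtain w1 where "\<phi> w = Some w1" "(v1, w1) \<in> edges T" using almost_iso_child[OF \<phi>(1) v1 w] .
    moreover obtain w2 where "\<psi> w = Some w2" "(v2, w2) \<in> edges T" using almost_iso_child[OF \<psi>(1) v2 w] .
    ultimately show ?case using eq parent_unique v1 v2 by simp
  qed
  fix v show "\<phi> v = \<psi> v"
    using step[of v] \<phi> \<psi> by (cases "v \<in> verts T") (simp, metis domIff)
qed

lemma as_map_inj: "g \<in> Aut T \<Longrightarrow> h \<in> Aut T \<Longrightarrow> as_map g = as_map h \<Longrightarrow> g = h"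
proof -
  assume a: "g \<in> Aut T" "h \<in> Aut T" "as_map g = as_map h"
  have "g v = h v" if "v \<in> verts T" for v
    using that as_map_iff[of g v "g v"] as_map_iff[of h v "g v"] a(3) by simp
  then show "g = h" using extensionalityI[OF AutD(1)[OF a(1)] AutD(1)[OF a(2)]] by blast
qed

lemma as_map_dom: "dom (as_map g) = verts T"
  by (auto simp: dom_def as_map_iff)

lemma Aut_pat_Aut: "g \<in> Aut_pat T P \<Longrightarrow> g \<in> Aut T"
  by (simp add: Aut_pat_def)

text \<open>As for patterned maps, labels are preserved at all vertices once they are at the children of the root.\<close>

lemma Aut_pat_iff:
  "g \<in> Aut_pat T P \<longleftrightarrow> g \<in> Aut T \<and> (\<forall>v\<in>verts T - {base T}. locally_patterned g v)"
proof (cases "g \<in> Aut T")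
  case g: True
  have lab: "lab P (g v) = lab P v"
    if a: "\<forall>v\<in>children T (base T). lab P (g v) = lab P v"
      "\<forall>v\<in>verts T - {base T}. local_perm T P g v \<in> perms P (lab P v)" "v \<in> verts T" "v \<noteq> base T" for v
    using a(3,4)
  proof (induction rule: tree_induct)
    case (child u v)
    show ?case
    proof (cases "u = base T")
      case True
      then show ?thesis using child a(1) by (simp add: children_def)
    next
      case False
      then have "locally_patterned g u" using child a(2) locally_patterned_iff by simp
      moreover have "g v \<in> children T (g u)"
        using child AutD(4)[OF g] edge_verts[OF child(2)] by (simp add: children_def)
      ultimately show ?thesis
        using child_label_eq[of g u v] child False Aut_verts[OF g] Aut_nonbase[OF g] 
        by (simp add: children_def)
    qed
  qed simp
  show ?thesis
    unfolding Aut_pat_def using g lab locally_patterned_iff child_vert by auto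
qed (simp add: Aut_pat_def)

text \<open>The patterned automorphisms that fix the ball of radius \<open>n\<close> pointwise. Their classes will form a
neighbourhood basis of the identity.\<close>

definition stabiliser :: "nat \<Rightarrow> ('v \<Rightarrow> 'v) set" where
  "stabiliser n = {g \<in> Aut_pat T P. \<forall>v\<in>verts T. depth v \<le> n \<longrightarrow> g v = v}"

definition stab_germs :: "nat \<Rightarrow> ('v \<rightharpoonup> 'v) set set" where
  "stab_germs n = aaut_of_aut T ` stabiliser n"

text \<open>An almost isomorphism with these properties need not make sense above level \<open>n\<close>, but it is the germ
of an automorphism. This is a convenient test for lying in \<open>stab_germs n\<close>.\<close>

definition level_fixing :: "nat \<Rightarrow> ('v \<rightharpoonup> 'v) \<Rightarrow> bool" where
  "level_fixing n \<phi> \<longleftrightarrow> almost_iso \<phi> \<and> (\<forall>v\<in>verts T. depth v = n \<longrightarrow> \<phi> v = Some v) \<and>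
     (\<forall>v\<in>verts T. n \<le> depth v \<longrightarrow> v \<in> dom \<phi> \<and> (v \<noteq> base T \<longrightarrow> locally_patterned (the \<circ> \<phi>) v))"

lemma level_fixing_depth:
  assumes \<phi>: "level_fixing n \<phi>" and v: "v \<in> verts T" "n \<le> depth v"
  obtains w where "\<phi> v = Some w" "depth w = depth v"
proof -
  have iso: "almost_iso \<phi>" and fx: "\<And>v. v \<in> verts T \<Longrightarrow> depth v = n \<Longrightarrow> \<phi> v = Some v"
    using \<phi> by (auto simp: level_fixing_def)
  have "n \<le> depth v \<longrightarrow> (\<exists>w. \<phi> v = Some w \<and> depth w = depth v)"
    using v(1)
  proof (induction rule: tree_induct)
    case base
    then show ?case using fx[OF base_in] depth_base by auto
  next
    case (child u v)
    show ?case
    proof (cases "n \<le> depth u")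
      case True
      then obtain u' where u': "\<phi> u = Some u'" "depth u' = depth u" using child by blast
      obtain v' where "\<phi> v = Some v'" "(u', v') \<in> edges T"
        using almost_iso_child[OF iso u'(1) child(2)] .
      then show ?thesis using u' depth_edge child(2) by metis
    next
      case False
      then have "n \<le> depth v \<Longrightarrow> depth v = n" using depth_edge[OF child(2)] by simp
      then show ?thesis using fx edge_verts[OF child(2)] by blast
    qed
  qed
  then show thesis using that v by blast
qed

text \<open>The part below level \<open>n\<close> is glued to the identity on the ball. No compatibility is needed other than on
level \<open>n\<close>, since all edges between the two parts start there.\<close>

lemma level_fixing_extends:
  assumes \<phi>: "level_fixing n \<phi>"
  obtains g where "g \<in> stabiliser n" "germ (as_map g) = germ \<phi>"
proof -
  have iso: "almost_iso \<phi>" and fx: "\<And>v. v \<in> verts T \<Longrightarrow> depth v = n \<Longrightarrow> \<phi> v = Some v"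
    and loc: "\<And>v. v \<in> verts T \<Longrightarrow> n \<le> depth v \<Longrightarrow> v \<noteq> base T \<Longrightarrow> locally_patterned (the \<circ> \<phi>) v"
    using \<phi> by (auto simp: level_fixing_def)
  define g where "g = (\<lambda>v\<in>verts T. if depth v \<le> n then v else the (\<phi> v))"
  have g_low: "g v = v" if "v \<in> verts T" "depth v \<le> n" for v using that by (simp add: g_def)
  have g_high: "\<phi> v = Some (g v)" if v: "v \<in> verts T" "n \<le> depth v" for v
  proof (cases "depth v = n")
    case True
    then show ?thesis using v fx[OF v(1)] g_low[OF v(1)] by simp
  next
    case False
    obtain w where "\<phi> v = Some w" using level_fixing_depth[OF \<phi> v] .
    then show ?thesis using v False by (simp add: g_def)
  qed
  have g_depth: "depth (g v) = depth v" if v: "v \<in> verts T" for v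
  proof (cases "depth v \<le> n")
    case True
    then show ?thesis using g_low v by simp
  next
    case False
    then have n: "n \<le> depth v" by simp
    obtain w where "\<phi> v = Some w" "depth w = depth v" using level_fixing_depth[OF \<phi> v n] .
    then show ?thesis using g_high[OF v n] by simp
  qed
  have g_verts: "g v \<in> verts T" if "v \<in> verts T" for v
  proof (cases "depth v \<le> n")
    case False
    then show ?thesis using almost_iso_verts(2)[OF iso g_high[OF that]] by simp
  next
    case True
    then show ?thesis using g_low that by simp
  qed
  have inj: "inj_on g (verts T)"
  proof (rule inj_onI)
    fix u v assume uv: "u \<in> verts T" "v \<in> verts T" "g u = g v"
    then have "depth u = depth v" using g_depth by metis
    then show "u = v"
      using uv g_low[of u] g_low[of v] g_high[of u] g_high[of v] almost_iso_inj[OF iso]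
      by (cases "depth u \<le> n") auto
  qed
  have surj: "\<exists>u\<in>verts T. g u = w" if "w \<in> verts T" for w
    using that
  proof (induction rule: tree_induct)
    case base
    then show ?case using g_low[OF base_in] base_in depth_base by (intro bexI[of _ "base T"]) simp_all
  next
    case (child v w)
    show ?case
    proof (cases "depth w \<le> n")
      case True
      then show ?thesis using g_low[of w] edge_verts[OF child(2)] by blast
    next
      case False
      obtain u where u: "u \<in> verts T" "g u = v" using child by blast
      then have "n \<le> depth u" using g_depth[of u] False depth_edge[OF child(2)] by simp
      then have "\<phi> u = Some v" using g_high u by blast
      then obtain x where x: "\<phi> x = Some w" "(u, x) \<in> edges T"
        using almost_iso_child_inv[OF iso _ child(2)] by blast
      then have "x \<in> verts T" "n \<le> depth x" using edge_verts depth_edge \<open>n \<le> depth u\<close> by auto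
      then show ?thesis using g_high[of x] x by (intro bexI[of _ x]) simp_all
    qed
  qed
  have edge: "(u, v) \<in> edges T \<longleftrightarrow> (g u, g v) \<in> edges T" if uv: "u \<in> verts T" "v \<in> verts T" for u v
  proof (cases "n \<le> depth u \<and> n \<le> depth v")
    case True
    then show ?thesis using almost_iso_edge[OF iso g_high[OF uv(1)] g_high[OF uv(2)]] by blast
  next
    case False
    show ?thesis
    proof (cases "depth v = Suc (depth u)")
      case True
      then have "g u = u" "g v = v" using False g_low[OF uv(1)] g_low[OF uv(2)] by auto
      then show ?thesis by simp
    next
      case False
      then show ?thesis
        using depth_edge[of u v] depth_edge[of "g u" "g v"] g_depth[OF uv(1)] g_depth[OF uv(2)] by auto
    qed
  qed
  have Aut: "g \<in> Aut T"
    unfolding Aut_def Bij_def bij_betw_def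
  proof (intro CollectI IntI conjI ballI)
    show "g \<in> extensional (verts T)" by (simp add: g_def)
    show "g ` verts T = verts T" using surj g_verts by blast
    show "g (base T) = base T" using g_low[OF base_in] depth_base by simp
  qed (use inj edge in blast)+
  have "locally_patterned g v" if v: "v \<in> verts T" "v \<noteq> base T" for v
  proof (cases "n \<le> depth v")
    case True
    have "the (\<phi> u) = g u" if "u \<in> children T v" for u
      using g_high[of u] edge_verts[of v u] depth_edge[of v u] that True by (simp add: children_def)
    moreover have "the (\<phi> v) = g v" using g_high v True by simp
    ultimately show ?thesis using loc[OF v(1) True v(2)] by (simp add: locally_patterned_def)
  next
    case False
    then have "g u = u" if "u \<in> children T v" for u
      using g_low[of u] edge_verts[of v u] depth_edge[of v u] that by (simp add: children_def)
    then show ?thesis using v g_low False by (intro locally_patterned_if_colours_kept) simp_all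
  qed
  then have "g \<in> stabiliser n" unfolding stabiliser_def Aut_pat_iff using Aut g_low by auto
  moreover have "almost_eq (as_map g) \<phi>"
    using almost_iso_as_map[OF Aut] iso g_high
    by (intro almost_eq_if_deep[of _ _ n]) (auto simp: as_map_iff)
  ultimately show thesis using that germ_eq_iff[OF almost_iso_as_map[OF Aut] iso] by blast
qed

lemma level_fixing_as_map:
  assumes "g \<in> stabiliser n" shows "level_fixing n (as_map g)"
proof -
  have g: "g \<in> Aut T" and p: "\<And>v. v \<in> verts T \<Longrightarrow> v \<noteq> base T \<Longrightarrow> locally_patterned g v"
    and f: "\<And>v. v \<in> verts T \<Longrightarrow> depth v \<le> n \<Longrightarrow> g v = v"
    using assms by (auto simp: stabiliser_def Aut_pat_iff)
  have "locally_patterned (the \<circ> as_map g) v" if v: "v \<in> verts T" "v \<noteq> base T" for v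
  proof -
    have "the (as_map g u) = g u" if "u \<in> verts T" for u using that by (simp add: as_map_def)
    then show ?thesis using p[OF v] v child_vert by (simp add: locally_patterned_def)
  qed
  then show ?thesis
    unfolding level_fixing_def using almost_iso_as_map[OF g] f by (auto simp: as_map_iff as_map_dom)
qed

lemma stab_germs_eq: "stab_germs n = germ ` {\<phi>. level_fixing n \<phi>}"
proof -
  have "aaut_of_aut T g = germ (as_map g)" if "g \<in> stabiliser n" for g
    using that aaut_of_aut_eq by (simp add: stabiliser_def Aut_pat_def)
  then have "stab_germs n = (\<lambda>g. germ (as_map g)) ` stabiliser n" by (simp add: stab_germs_def)
  also have "\<dots> = germ ` {\<phi>. level_fixing n \<phi>}"
  proof
    show "(\<lambda>g. germ (as_map g)) ` stabiliser n \<subseteq> germ ` {\<phi>. level_fixing n \<phi>}"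
      using level_fixing_as_map by blast
    show "germ ` {\<phi>. level_fixing n \<phi>} \<subseteq> (\<lambda>g. germ (as_map g)) ` stabiliser n"
    proof
      fix x assume "x \<in> germ ` {\<phi>. level_fixing n \<phi>}"
      then obtain \<phi> where "level_fixing n \<phi>" "x = germ \<phi>" by blast
      then obtain g where "g \<in> stabiliser n" "germ (as_map g) = x" using level_fixing_extends by metis
      then show "x \<in> (\<lambda>g. germ (as_map g)) ` stabiliser n" by blast
    qed
  qed
  finally show ?thesis .
qed

lemma level_fixing_comp:
  assumes \<phi>: "level_fixing n \<phi>" and \<psi>: "level_fixing n \<psi>" shows "level_fixing n (\<psi> \<circ>\<^sub>m \<phi>)"
proof -
  have iso: "almost_iso \<phi>" "almost_iso \<psi>" using \<phi> \<psi> by (auto simp: level_fixing_def)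
  have "(\<psi> \<circ>\<^sub>m \<phi>) v = Some v" if "v \<in> verts T" "depth v = n" for v
    using that \<phi> \<psi> by (simp add: level_fixing_def map_comp_def)
  moreover have "v \<in> dom (\<psi> \<circ>\<^sub>m \<phi>) \<and> (v \<noteq> base T \<longrightarrow> locally_patterned (the \<circ> (\<psi> \<circ>\<^sub>m \<phi>)) v)"
    if v: "v \<in> verts T" "n \<le> depth v" for v
  proof -
    obtain u where u: "\<phi> v = Some u" "depth u = depth v" using level_fixing_depth[OF \<phi> v] .
    have uV: "u \<in> verts T" using almost_iso_verts[OF iso(1) u(1)] by simp
    then obtain w where w: "\<psi> u = Some w" using level_fixing_depth[OF \<psi> uV] u v by metis
    have "locally_patterned (the \<circ> (\<psi> \<circ>\<^sub>m \<phi>)) v" if "v \<noteq> base T"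
    proof (rule locally_patterned_comp[OF iso u(1) w that])
      show "locally_patterned (the \<circ> \<phi>) v" using \<phi> v that by (simp add: level_fixing_def)
      have "u \<noteq> base T" using u(2) depth_base depth_0[OF v(1)] that by metis
      then show "locally_patterned (the \<circ> \<psi>) u" using \<psi> uV u v by (simp add: level_fixing_def)
    qed
    then show ?thesis using u w by (auto simp: dom_def map_comp_def)
  qed
  ultimately show ?thesis unfolding level_fixing_def using almost_iso_comp[OF iso] by blast
qed

lemma level_fixing_inv_as_map:
  assumes g: "g \<in> stabiliser n" shows "level_fixing n (inv_map (as_map g))"
proof -
  have gA: "g \<in> Aut T" using g by (simp add: stabiliser_def Aut_pat_def)
  note iso = almost_iso_as_map[OF gA]
  have lf: "level_fixing n (as_map g)" using level_fixing_as_map[OF g] .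
  have "inv_map (as_map g) v = Some v" if "v \<in> verts T" "depth v = n" for v
    using that lf inv_map_iff[OF iso] by (simp add: level_fixing_def)
  moreover have "v \<in> dom (inv_map (as_map g)) \<and> (v \<noteq> base T \<longrightarrow> locally_patterned (the \<circ> inv_map (as_map g)) v)"
    if v: "v \<in> verts T" "n \<le> depth v" for v
  proof -
    have "v \<in> g ` verts T" using bij_betw_imp_surj_on[OF AutD(2)[OF gA]] v by simp
    then obtain u where u: "u \<in> verts T" "g u = v" by blast
    then have t: "as_map g u = Some v" by (simp add: as_map_iff)
    have "locally_patterned (the \<circ> inv_map (as_map g)) v" if "v \<noteq> base T"
    proof (rule locally_patterned_inv[OF iso t])
      show "u \<noteq> base T" using that u AutD(3)[OF gA] by blast
      then show "locally_patterned (the \<circ> as_map g) u"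
        using lf u v Aut_depth[OF gA u(1)] by (simp add: level_fixing_def)
    qed
    then show ?thesis using t inv_map_iff[OF iso] by blast
  qed
  ultimately show ?thesis unfolding level_fixing_def using almost_iso_inv[OF iso] by blast
qed

lemma stabiliser_antimono: "n \<le> m \<Longrightarrow> stabiliser m \<subseteq> stabiliser n"
  by (auto simp: stabiliser_def)

lemma level_fixing_in_carrier:
  assumes "level_fixing n \<phi>" shows "germ \<phi> \<in> carrier G"
proof -
  obtain g where g: "g \<in> stabiliser n" "germ (as_map g) = germ \<phi>" using level_fixing_extends[OF assms] .
  then have "g \<in> stabiliser 0" using stabiliser_antimono by blast
  then have lf: "level_fixing 0 (as_map g)" by (rule level_fixing_as_map)
  have gA: "g \<in> Aut T" using g by (simp add: stabiliser_def Aut_pat_def)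
  let ?\<psi> = "as_map g |` (verts T - {base T})"
  have iso: "almost_iso ?\<psi>" using almost_iso_restrict[OF almost_iso_as_map[OF gA] cofinite_forest_nonbase] .
  have "dom ?\<psi> = verts T - {base T}" by (auto simp: as_map_dom)
  moreover have "base T \<notin> ran ?\<psi>"
    using Aut_nonbase[OF gA] by (auto simp: ran_def restrict_map_def as_map_iff split: if_splits)
  moreover have "locally_patterned (the \<circ> ?\<psi>) v" if v: "v \<in> verts T - {base T}" for v
    using lf v child_vert by (auto simp: level_fixing_def locally_patterned_def)
  ultimately have "patterned_map ?\<psi>" using iso by (auto simp: patterned_map_def)
  moreover have "almost_eq ?\<psi> (as_map g)"
    using depth_base by (intro almost_eq_if_deep[OF iso almost_iso_as_map[OF gA], of 1])
      (auto simp: restrict_map_def as_map_def)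
  ultimately show ?thesis
    using germ_in_carrier germ_eq_iff[OF iso almost_iso_as_map[OF gA]] g(2) by metis
qed

lemma stab_germs_subgroup: "subgroup (stab_germs n) G"
proof -
  interpret group "G" by (rule group_AAut_pat)
  show ?thesis
  proof (rule subgroupI)
    show "stab_germs n \<subseteq> carrier G"
      unfolding stab_germs_eq using level_fixing_in_carrier by blast
    have "level_fixing n (Some |` verts T)"
      unfolding level_fixing_def using almost_iso_id child_vert
      by (auto intro!: locally_patterned_if_colours_kept simp: restrict_map_def)
    then show "stab_germs n \<noteq> {}" unfolding stab_germs_eq by blast
  next
    fix x assume "x \<in> stab_germs n"
    then obtain g where g: "g \<in> stabiliser n" "x = germ (as_map g)"
      unfolding stab_germs_def using aaut_of_aut_eq by (auto simp: stabiliser_def Aut_pat_def)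
    then have gA: "g \<in> Aut T" by (simp add: stabiliser_def Aut_pat_def)
    have "inv\<^bsub>G\<^esub> x = germ (inv_map (as_map g))"
      using germ_inv_pat[OF almost_iso_as_map[OF gA]] level_fixing_in_carrier level_fixing_as_map g by blast
    then show "inv\<^bsub>G\<^esub> x \<in> stab_germs n"
      unfolding stab_germs_eq using level_fixing_inv_as_map[OF g(1)] by blast
  next
    fix x y assume "x \<in> stab_germs n" "y \<in> stab_germs n"
    then obtain \<phi> \<psi> where "level_fixing n \<phi>" "x = germ \<phi>" "level_fixing n \<psi>" "y = germ \<psi>"
      unfolding stab_germs_eq by blast
    then show "x \<otimes>\<^bsub>G\<^esub> y \<in> stab_germs n"
      unfolding stab_germs_eq using level_fixing_comp germ_mult_pat
      by (auto simp: level_fixing_def intro!: imageI)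
  qed
qed

text \<open>Choose \<open>m\<close> so large that level \<open>n'\<close> comes from depth less than \<open>m\<close> under the representative \<open>\<phi>\<close> of \<open>x\<close>
and that \<open>\<phi>\<close> is defined from depth \<open>m\<close> on. An automorphism that fixes the ball of radius \<open>m\<close> preserves
the domain of \<open>\<phi>\<close>, and its conjugate fixes level \<open>n'\<close>.\<close>

lemma stab_germs_conj:
  assumes x: "x \<in> carrier G"
  shows "\<exists>m. \<forall>u\<in>stab_germs m. x \<otimes>\<^bsub>G\<^esub> u \<otimes>\<^bsub>G\<^esub> inv\<^bsub>G\<^esub> x \<in> stab_germs n"
proof -
  obtain \<phi> where \<phi>: "patterned_map \<phi>" "x = germ \<phi>" using x by (auto simp: carrier_AAut_pat)
  note iso = patterned_mapD(1)[OF \<phi>(1)]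
  obtain k where k: "{v \<in> verts T. k \<le> depth v} \<subseteq> ran \<phi>"
    using cofinite_forest_contains_deep[OF almost_isoD(2)[OF iso]] .
  \<comment> \<open>The target level must lie in the image of \<open>\<phi>\<close> and below the root.\<close>
  define n' where "n' = max n (max k 1)"
  obtain j where j: "{v \<in> verts T. j \<le> depth v} \<subseteq> dom \<phi>"
    using cofinite_forest_contains_deep[OF almost_isoD(1)[OF iso]] .
  have fin: "finite ((the \<circ> inv_map \<phi>) ` {v \<in> verts T. depth v = n'})" using finite_level by simp
  obtain i where i: "\<And>w. w \<in> (the \<circ> inv_map \<phi>) ` {v \<in> verts T. depth v = n'} \<Longrightarrow> depth w < i"
    using depth_bounded[OF fin] by blast
  define m where "m = max i j"
  have "x \<otimes>\<^bsub>G\<^esub> u \<otimes>\<^bsub>G\<^esub> inv\<^bsub>G\<^esub> x \<in> stab_germs n"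
    if u: "u \<in> stab_germs m" for u
  proof -
    obtain g where g: "g \<in> stabiliser m" "u = germ (as_map g)"
      using u unfolding stab_germs_def using aaut_of_aut_eq by (auto simp: stabiliser_def Aut_pat_def)
    then have gA: "g \<in> Aut T" by (simp add: stabiliser_def Aut_pat_def)
    have g_fix: "g v = v" if "v \<in> verts T" "depth v \<le> m" for v using g that by (simp add: stabiliser_def)
    note isog = almost_iso_as_map[OF gA] and isoi = almost_iso_inv[OF iso]
    let ?\<omega> = "\<phi> \<circ>\<^sub>m (as_map g \<circ>\<^sub>m inv_map \<phi>)"
    have eq: "x \<otimes>\<^bsub>G\<^esub> u \<otimes>\<^bsub>G\<^esub> inv\<^bsub>G\<^esub> x = germ ?\<omega>"
      using germ_inv_pat[OF iso] x \<phi> g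
      by (simp add: germ_mult_pat almost_iso_comp iso isog isoi map_comp_assoc)
    have path: "\<exists>w w' v'. inv_map \<phi> v = Some w \<and> as_map g w = Some w' \<and> \<phi> w' = Some v' \<and> w \<in> verts T \<and>
        (depth v = n' \<longrightarrow> v' = v)" if v: "v \<in> verts T" "n' \<le> depth v" for v
    proof -
      have "v \<in> ran \<phi>" using k v by (auto simp: n'_def)
      then obtain w where w: "\<phi> w = Some v" by (auto simp: ran_def)
      then have iw: "inv_map \<phi> v = Some w" using inv_map_iff[OF iso] by simp
      have wV: "w \<in> verts T" using almost_iso_verts[OF iso w] by simp
      show ?thesis
      proof (cases "depth w \<le> m")
        case True
        then show ?thesis using g_fix wV w iw by (auto simp: as_map_iff)
      next
        case False
        then have "g w \<in> dom \<phi>"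
          using j Aut_depth[OF gA wV] Aut_verts[OF gA wV] by (auto simp: m_def)
        moreover have "depth v \<noteq> n'"
        proof
          assume "depth v = n'"
          then have "depth w < i" using i[of w] v iw by force
          then show False using False by (simp add: m_def)
        qed
        ultimately show ?thesis using wV iw by (auto simp: as_map_iff)
      qed
    qed
    have "level_fixing n' ?\<omega>"
      unfolding level_fixing_def
    proof (intro conjI ballI impI)
      show "almost_iso ?\<omega>" using almost_iso_comp iso isog isoi by blast
      fix v assume v: "v \<in> verts T"
      show "?\<omega> v = Some v" if "depth v = n'" using path[OF v] that by (auto simp: map_comp_def)
      assume "n' \<le> depth v"
      then obtain w w' v' where p: "inv_map \<phi> v = Some w" "as_map g w = Some w'" "\<phi> w' = Some v'" "w \<in> verts T"
        using path[OF v] by blast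
      then have "?\<omega> v = Some v'" by (simp add: map_comp_def)
      then show "v \<in> dom ?\<omega>" by blast
      have wv: "\<phi> w = Some v" using p inv_map_iff[OF iso] by simp
      have wb: "w \<noteq> base T" using patterned_mapD(2)[OF \<phi>(1) wv] .
      show "locally_patterned (the \<circ> ?\<omega>) v" if "v \<noteq> base T"
      proof (rule locally_patterned_comp[OF _ iso _ p(3) that])
        show "almost_iso (as_map g \<circ>\<^sub>m inv_map \<phi>)" using almost_iso_comp isog isoi by blast
        show "(as_map g \<circ>\<^sub>m inv_map \<phi>) v = Some w'" using p by (simp add: map_comp_def)
        show "locally_patterned (the \<circ> \<phi>) w'" using patterned_mapD(4)[OF \<phi>(1) p(3)] .
        show "locally_patterned (the \<circ> (as_map g \<circ>\<^sub>m inv_map \<phi>)) v"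
        proof (rule locally_patterned_comp[OF isoi isog p(1) p(2) that])
          show "locally_patterned (the \<circ> inv_map \<phi>) v"
            using locally_patterned_inv[OF iso wv wb] patterned_mapD(4)[OF \<phi>(1) wv] by blast
          have "level_fixing 0 (as_map g)" using level_fixing_as_map stabiliser_antimono g(1) by blast
          then show "locally_patterned (the \<circ> as_map g) w" using p wb by (simp add: level_fixing_def)
        qed
      qed
    qed
    then have "germ ?\<omega> \<in> stab_germs n'" unfolding stab_germs_eq by blast
    then show ?thesis unfolding eq using stabiliser_antimono[of n n'] by (auto simp: stab_germs_def n'_def)
  qed
  then show ?thesis by blast
qed

sublocale filtered_group G stab_germs
proof (intro filtered_group.intro filtered_group_axioms.intro)
  show "group G" by (rule group_AAut_pat)
  show "subgroup (stab_germs n) G" for n by (rule stab_germs_subgroup)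
  show "stab_germs m \<subseteq> stab_germs n" if "n \<le> m" for n m
    unfolding stab_germs_def using stabiliser_antimono[OF that] by blast
qed (rule stab_germs_conj)

lemma stabiliser_0: "stabiliser 0 = Aut_pat T P"
  using depth_0 AutD(3) by (auto simp: stabiliser_def Aut_pat_def)

abbreviation "Aut_pat_topology \<equiv> subtopology (Aut_topology T) (Aut_pat T P)"

lemma Aut_pat_topology_eq:
  "Aut_pat_topology = subtopology (product_topology (\<lambda>_. discrete_topology (verts T)) (verts T)) (Aut_pat T P)"
proof -
  have "Aut T \<inter> Aut_pat T P = Aut_pat T P" by (auto simp: Aut_pat_def)
  then show ?thesis by (simp add: Aut_topology_def subtopology_subtopology)
qed

lemma Aut_pat_PiE: "Aut_pat T P \<subseteq> verts T \<rightarrow>\<^sub>E verts T"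
  using AutD(1) Aut_verts Aut_pat_Aut by (auto simp: PiE_def)

lemma topspace_Aut_pat_topology: "topspace Aut_pat_topology = Aut_pat T P"
  unfolding Aut_pat_topology_eq using Aut_pat_PiE by auto

text \<open>Pointwise convergence tests finitely many vertices, and these lie in a ball; balls are finite.\<close>

lemma openin_Aut_pat_topology:
  "openin Aut_pat_topology A \<longleftrightarrow> A \<subseteq> Aut_pat T P \<and>
     (\<forall>g\<in>A. \<exists>n. \<forall>h\<in>Aut_pat T P. (\<forall>v\<in>verts T. depth v \<le> n \<longrightarrow> h v = g v) \<longrightarrow> h \<in> A)" (is "_ \<longleftrightarrow> ?R")
proof
  let ?Pi = "product_topology (\<lambda>_. discrete_topology (verts T)) (verts T)"
  assume op: "openin Aut_pat_topology A"
  then obtain U where U: "openin ?Pi U" "A = U \<inter> Aut_pat T P"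
    unfolding Aut_pat_topology_eq openin_subtopology by blast
  have "\<exists>n. \<forall>h\<in>Aut_pat T P. (\<forall>v\<in>verts T. depth v \<le> n \<longrightarrow> h v = g v) \<longrightarrow> h \<in> A" if g: "g \<in> A" for g
  proof -
    have "g \<in> U" using g U by blast
    then obtain B where B: "finite {v \<in> verts T. B v \<noteq> verts T}" "g \<in> PiE (verts T) B" "PiE (verts T) B \<subseteq> U"
      using U(1) unfolding openin_product_topology_alt topspace_discrete_topology by meson
    obtain n where n: "\<And>v. v \<in> {v \<in> verts T. B v \<noteq> verts T} \<Longrightarrow> depth v < n"
      using depth_bounded[OF B(1)] by blast
    have "h \<in> A" if h: "h \<in> Aut_pat T P" "\<forall>v\<in>verts T. depth v \<le> n \<longrightarrow> h v = g v" for h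
    proof -
      have "h v \<in> B v" if v: "v \<in> verts T" for v
      proof (cases "B v = verts T")
        case True
        then show ?thesis using h(1) v Aut_pat_PiE by blast
      next
        case False
        then have "h v = g v" using h(2) v n[of v] by simp
        then show ?thesis using B(2) v by (simp add: PiE_mem)
      qed
      then have "h \<in> PiE (verts T) B" using h(1) Aut_pat_PiE by (auto simp: PiE_def)
      then show ?thesis using B(3) U h(1) by blast
    qed
    then show ?thesis by blast
  qed
  then show ?R using U by blast
next
  let ?Pi = "product_topology (\<lambda>_. discrete_topology (verts T)) (verts T)"
  assume R: ?R
  have "\<exists>U. openin Aut_pat_topology U \<and> g \<in> U \<and> U \<subseteq> A" if g: "g \<in> A" for g
  proof -
    obtain n where n: "\<forall>h\<in>Aut_pat T P. (\<forall>v\<in>verts T. depth v \<le> n \<longrightarrow> h v = g v) \<longrightarrow> h \<in> A" using R g by blast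
    have gP: "g \<in> Aut_pat T P" using R g by blast
    define B where "B v = (if depth v \<le> n then {g v} else verts T)" for v
    have "{v \<in> verts T. B v \<noteq> verts T} \<subseteq> {v \<in> verts T. depth v \<le> n}" by (auto simp: B_def)
    then have "finite {v \<in> verts T. B v \<noteq> verts T}" using finite_ball finite_subset by blast
    moreover have "B v \<subseteq> verts T" if "v \<in> verts T" for v
      using Aut_verts[OF Aut_pat_Aut[OF gP] that] by (simp add: B_def)
    ultimately have "openin ?Pi (PiE (verts T) B)"
      unfolding openin_PiE_gen by simp
    then have "openin Aut_pat_topology (PiE (verts T) B \<inter> Aut_pat T P)"
      unfolding Aut_pat_topology_eq openin_subtopology by blast
    moreover have "g \<in> PiE (verts T) B \<inter> Aut_pat T P"
    proof -
      have "g v \<in> B v" if "v \<in> verts T" for v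
        using Aut_verts[OF Aut_pat_Aut[OF gP] that] by (simp add: B_def)
      then show ?thesis using gP AutD(1)[OF Aut_pat_Aut[OF gP]] by (simp add: PiE_def)
    qed
    moreover have "h \<in> A" if h: "h \<in> PiE (verts T) B" "h \<in> Aut_pat T P" for h
    proof -
      have "h v = g v" if "v \<in> verts T" "depth v \<le> n" for v
        using PiE_mem[OF h(1) that(1)] that by (simp add: B_def)
      then show ?thesis using n h by blast
    qed
    ultimately show ?thesis by (intro exI[of _ "PiE (verts T) B \<inter> Aut_pat T P"]) auto
  qed
  then show "openin Aut_pat_topology A" using openin_subopen by metis
qed

lemma aaut_of_aut_inj: "inj_on (aaut_of_aut T) (Aut_pat T P)"
proof (rule inj_onI)
  fix g h assume gh: "g \<in> Aut_pat T P" "h \<in> Aut_pat T P" "aaut_of_aut T g = aaut_of_aut T h"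
  note A = Aut_pat_Aut[OF gh(1)] Aut_pat_Aut[OF gh(2)]
  have "almost_eq (as_map g) (as_map h)"
    using gh(3) aaut_of_aut_eq[OF A(1)] aaut_of_aut_eq[OF A(2)]
      germ_eq_iff[OF almost_iso_as_map[OF A(1)] almost_iso_as_map[OF A(2)]] by simp
  then have "as_map g = as_map h"
    using as_map_determined_by_germ almost_iso_as_map A as_map_dom by blast
  then show "g = h" using as_map_inj A by blast
qed

lemma stab_germs_0: "stab_germs 0 = aaut_of_aut T ` Aut_pat T P"
  by (simp add: stab_germs_def stabiliser_0)

text \<open>Products of classes of automorphisms are classes of composites. As the hypothesis is an equation
between germs, this needs that automorphisms are determined by their germs.\<close>

lemma aut_mult:
  assumes g: "g \<in> Aut_pat T P" and k: "k \<in> Aut_pat T P" and h: "h \<in> Aut_pat T P"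
    and eq: "aaut_of_aut T g \<otimes>\<^bsub>G\<^esub> aaut_of_aut T k = aaut_of_aut T h" and v: "v \<in> verts T"
  shows "h v = g (k v)"
proof -
  note A = Aut_pat_Aut[OF g] Aut_pat_Aut[OF k] Aut_pat_Aut[OF h]
  note iso = almost_iso_as_map[OF A(1)] almost_iso_as_map[OF A(2)] almost_iso_as_map[OF A(3)]
  have comp: "(as_map g \<circ>\<^sub>m as_map k) w = Some (g (k w))" if "w \<in> verts T" for w
    using that Aut_verts[OF A(2) that] by (simp add: map_comp_def as_map_def)
  have "dom (as_map g \<circ>\<^sub>m as_map k) = verts T"
  proof
    show "dom (as_map g \<circ>\<^sub>m as_map k) \<subseteq> verts T"
      using almost_iso_verts(1)[OF almost_iso_comp[OF iso(2,1)]] by blast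
    show "verts T \<subseteq> dom (as_map g \<circ>\<^sub>m as_map k)" using comp by blast
  qed
  moreover have "almost_eq (as_map g \<circ>\<^sub>m as_map k) (as_map h)"
    using eq germ_eq_iff[OF almost_iso_comp[OF iso(2,1)] iso(3)]
    by (simp add: aaut_of_aut_eq A germ_mult_pat iso)
  ultimately have "as_map g \<circ>\<^sub>m as_map k = as_map h"
    using as_map_determined_by_germ[OF almost_iso_comp[OF iso(2,1)] _ iso(3) as_map_dom] by blast
  then have "Some (g (k v)) = as_map h v" using comp[OF v] by simp
  then show ?thesis using v by (simp add: as_map_def)
qed

text \<open>Two automorphisms \<open>g\<close>, \<open>h\<close> agree on the ball of radius \<open>n\<close> exactly if \<open>g\<inverse>h\<close> lies in \<open>stabiliser n\<close>, so both
topologies have the same basic neighbourhoods.\<close>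

lemma openin_aaut_of_aut_image:
  assumes A: "A \<subseteq> Aut_pat T P"
  shows "openin (filtration_topology G stab_germs) (aaut_of_aut T ` A) \<longleftrightarrow>
    openin Aut_pat_topology A"
proof
  let ?e = "aaut_of_aut T"
  assume "openin (filtration_topology G stab_germs) (?e ` A)"
  then have op: "\<forall>x\<in>?e ` A. \<exists>n. \<forall>u\<in>stab_germs n. x \<otimes>\<^bsub>G\<^esub> u \<in> ?e ` A"
    unfolding openin_filtration_topology by blast
  have "\<exists>n. \<forall>h\<in>Aut_pat T P. (\<forall>v\<in>verts T. depth v \<le> n \<longrightarrow> h v = g v) \<longrightarrow> h \<in> A" if g: "g \<in> A" for g
  proof -
    obtain n where n: "\<forall>u\<in>stab_germs n. ?e g \<otimes>\<^bsub>G\<^esub> u \<in> ?e ` A" using op g by blast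
    have gP: "g \<in> Aut_pat T P" using A g by blast
    have "h \<in> A" if h: "h \<in> Aut_pat T P" "\<forall>v\<in>verts T. depth v \<le> n \<longrightarrow> h v = g v" for h
    proof -
      have e: "?e g \<in> stab_germs 0" "?e h \<in> stab_germs 0" using gP h by (auto simp: stab_germs_0)
      then have c: "?e g \<in> carrier G" "?e h \<in> carrier G" using W_carrier by auto
      have "inv\<^bsub>G\<^esub> ?e g \<otimes>\<^bsub>G\<^esub> ?e h \<in> stab_germs 0"
        using e stab_germs_subgroup subgroup.m_closed subgroup.m_inv_closed by metis
      then obtain k where k: "k \<in> Aut_pat T P" "?e k = inv\<^bsub>G\<^esub> ?e g \<otimes>\<^bsub>G\<^esub> ?e h"
        by (auto simp: stab_germs_0)
      have eq: "?e g \<otimes>\<^bsub>G\<^esub> ?e k = ?e h" using k(2) c by (simp add: m_assoc[symmetric])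
      have "k v = v" if v: "v \<in> verts T" "depth v \<le> n" for v
      proof -
        have "g (k v) = g v" using aut_mult[OF gP k(1) h(1) eq v(1)] h(2) v by simp
        then show ?thesis
          using inj_onD[OF bij_betw_imp_inj_on[OF AutD(2)[OF Aut_pat_Aut[OF gP]]]]
            Aut_verts[OF Aut_pat_Aut[OF k(1)] v(1)] v(1) by blast
      qed
      then have "k \<in> stabiliser n" using k by (simp add: stabiliser_def)
      then have "?e k \<in> stab_germs n" by (simp add: stab_germs_def)
      then have "?e h \<in> ?e ` A" using n unfolding eq[symmetric] by blast
      then show ?thesis using inj_on_image_mem_iff[OF aaut_of_aut_inj h(1) A] by simp
    qed
    then show ?thesis by blast
  qed
  then show "openin Aut_pat_topology A" unfolding openin_Aut_pat_topology using A by blast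
next
  let ?e = "aaut_of_aut T"
  assume op: "openin Aut_pat_topology A"
  have "\<exists>n. \<forall>u\<in>stab_germs n. ?e g \<otimes>\<^bsub>G\<^esub> u \<in> ?e ` A" if g: "g \<in> A" for g
  proof -
    obtain n where n: "\<forall>h\<in>Aut_pat T P. (\<forall>v\<in>verts T. depth v \<le> n \<longrightarrow> h v = g v) \<longrightarrow> h \<in> A"
      using op g unfolding openin_Aut_pat_topology by blast
    have gP: "g \<in> Aut_pat T P" using A g by blast
    have "?e g \<otimes>\<^bsub>G\<^esub> ?e k \<in> ?e ` A" if k: "k \<in> stabiliser n" for k
    proof -
      have kP: "k \<in> Aut_pat T P" using k by (simp add: stabiliser_def)
      have "?e g \<otimes>\<^bsub>G\<^esub> ?e k \<in> stab_germs 0"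
        using gP kP stab_germs_subgroup subgroup.m_closed unfolding stab_germs_0 by (metis imageI stab_germs_0)
      then obtain h where h: "h \<in> Aut_pat T P" "?e g \<otimes>\<^bsub>G\<^esub> ?e k = ?e h" by (auto simp: stab_germs_0)
      have "h v = g v" if v: "v \<in> verts T" "depth v \<le> n" for v
        using aut_mult[OF gP kP h v(1)] k v by (simp add: stabiliser_def)
      then show ?thesis using n h by auto
    qed
    then show ?thesis unfolding stab_germs_def by blast
  qed
  moreover have "?e ` A \<subseteq> carrier G" using A W_carrier stab_germs_0 by blast
  ultimately show "openin (filtration_topology G stab_germs) (?e ` A)"
    unfolding openin_filtration_topology by blast
qed

lemma embedding_aaut_of_aut:
  "embedding_map Aut_pat_topology (filtration_topology G stab_germs) (aaut_of_aut T)"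
proof -
  let ?\<tau> = "filtration_topology G stab_germs" and ?e = "aaut_of_aut T"
  let ?S = "subtopology ?\<tau> (?e ` Aut_pat T P)"
  have W: "openin ?\<tau> (?e ` Aut_pat T P)" using openin_W[of 0] stab_germs_0 by simp
  have S: "openin ?S B \<longleftrightarrow> openin ?\<tau> B \<and> B \<subseteq> ?e ` Aut_pat T P" for B
    using openin_open_subtopology[OF W] .
  have top: "topspace ?S = ?e ` Aut_pat T P"
    using openin_subset[OF W] by (simp add: Int_absorb1 inf.absorb2)
  have "homeomorphic_map Aut_pat_topology ?S ?e"
    unfolding homeomorphic_eq_everything_map
  proof (intro conjI)
    show "inj_on ?e (topspace Aut_pat_topology)" "?e ` topspace Aut_pat_topology = topspace ?S"
      unfolding topspace_Aut_pat_topology top using aaut_of_aut_inj by simp_all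
    show op: "open_map Aut_pat_topology ?S ?e"
      unfolding open_map_def S
      using openin_aaut_of_aut_image openin_subset topspace_Aut_pat_topology by blast
    show cont: "continuous_map Aut_pat_topology ?S ?e"
      unfolding continuous_map top topspace_Aut_pat_topology
    proof (intro conjI allI impI)
      fix B assume B: "openin ?S B"
      let ?A = "{g \<in> Aut_pat T P. ?e g \<in> B}"
      have "?e ` ?A = B" using B S by blast
      then show "openin Aut_pat_topology ?A"
        using openin_aaut_of_aut_image[of ?A] B S by simp
    qed simp
    show "closed_map Aut_pat_topology ?S ?e"
      using bijective_open_imp_closed_map[OF op] aaut_of_aut_inj
      unfolding topspace_Aut_pat_topology top by simp
  qed
  then show ?thesis unfolding embedding_map_def topspace_Aut_pat_topology .
qed

theorem AAut_pat_topology_eq: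
  "AAut_pat_topology T P = filtration_topology G stab_germs"
  unfolding AAut_pat_topology_def
proof (rule the_equality)
  have "open_subgroup (aaut_of_aut T ` Aut_pat T P) G (filtration_topology G stab_germs)"
    unfolding open_subgroup_def using openin_W[of 0] stab_germs_subgroup[of 0] stab_germs_0 by simp
  then show *: "topological_group G (filtration_topology G stab_germs) \<and>
    open_subgroup (aaut_of_aut T ` Aut_pat T P) G (filtration_topology G stab_germs) \<and>
    embedding_map Aut_pat_topology (filtration_topology G stab_germs) (aaut_of_aut T)"
    using topological_group_filtration embedding_aaut_of_aut by blast
  fix \<tau>
  assume "topological_group G \<tau> \<and>
    open_subgroup (aaut_of_aut T ` Aut_pat T P) G \<tau> \<and>
    embedding_map Aut_pat_topology \<tau> (aaut_of_aut T)"
  then show "\<tau> = filtration_topology G stab_germs"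
    using * group_topology_unique[of "G" \<tau> _ "aaut_of_aut T" Aut_pat_topology]
    unfolding topspace_Aut_pat_topology by blast
qed

lemma aaut_of_aut_eq_one:
  assumes g: "g \<in> Aut T"
  shows "aaut_of_aut T g = \<one>\<^bsub>G\<^esub> \<longleftrightarrow> (\<forall>v\<in>verts T. g v = v)"
proof -
  note iso = almost_iso_as_map[OF g]
  have "aaut_of_aut T g = \<one>\<^bsub>G\<^esub> \<longleftrightarrow> almost_eq (as_map g) (Some |` verts T)"
    using germ_eq_iff[OF iso almost_iso_id] by (simp add: aaut_of_aut_eq[OF g] one_AAut_pat)
  also have "\<dots> \<longleftrightarrow> as_map g = Some |` verts T"
    using as_map_determined_by_germ[OF iso as_map_dom almost_iso_id] by auto
  also have "\<dots> \<longleftrightarrow> (\<forall>v\<in>verts T. g v = v)"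
  proof
    assume eq: "as_map g = Some |` verts T"
    show "\<forall>v\<in>verts T. g v = v"
    proof
      fix v assume v: "v \<in> verts T"
      have "as_map g v = Some v" using v by (simp add: eq)
      then show "g v = v" by (simp add: as_map_iff)
    qed
  qed (auto simp: as_map_def restrict_map_def)
  finally show ?thesis .
qed

lemma aaut_of_aut_in_stab_germs: "g \<in> stabiliser n \<Longrightarrow> aaut_of_aut T g \<in> stab_germs n"
  by (simp add: stab_germs_def)

text \<open>Powers are computed by induction with \<open>aut_mult\<close>. A function \<open>h\<close> other than \<open>g ^^ k\<close> appears because
automorphisms are extensional.\<close>

lemma aaut_of_aut_pow:
  assumes g: "g \<in> Aut_pat T P"
  obtains h where "h \<in> Aut_pat T P" "aaut_of_aut T g [^]\<^bsub>G\<^esub> (k::nat) = aaut_of_aut T h"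
    "\<And>v. v \<in> verts T \<Longrightarrow> h v = (g ^^ k) v"
proof -
  note gA = Aut_pat_Aut[OF g]
  have eW: "aaut_of_aut T g \<in> stab_germs 0" using g by (simp add: stab_germs_0)
  have "\<exists>h\<in>Aut_pat T P. aaut_of_aut T g [^]\<^bsub>G\<^esub> k = aaut_of_aut T h \<and>
      (\<forall>v\<in>verts T. h v = (g ^^ k) v)"
  proof (induction k)
    case 0
    have "\<one>\<^bsub>G\<^esub> \<in> aaut_of_aut T ` Aut_pat T P" using one_in_W[of 0] stab_germs_0 by simp
    then obtain h where h: "h \<in> Aut_pat T P" "aaut_of_aut T h = \<one>\<^bsub>G\<^esub>" by auto
    then have "\<forall>v\<in>verts T. h v = v" using aaut_of_aut_eq_one[OF Aut_pat_Aut[OF h(1)]] by blast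
    then show ?case using h by (intro bexI[of _ h]) simp_all
  next
    case (Suc k)
    then obtain h where h: "h \<in> Aut_pat T P" "aaut_of_aut T g [^]\<^bsub>G\<^esub> k = aaut_of_aut T h"
        "\<forall>v\<in>verts T. h v = (g ^^ k) v" by blast
    have "aaut_of_aut T h \<otimes>\<^bsub>G\<^esub> aaut_of_aut T g \<in> stab_germs 0"
      using subgroup.m_closed[OF stab_germs_subgroup _ eW] h(1) by (simp add: stab_germs_0)
    then obtain h' where h': "h' \<in> Aut_pat T P"
        "aaut_of_aut T h \<otimes>\<^bsub>G\<^esub> aaut_of_aut T g = aaut_of_aut T h'"
      unfolding stab_germs_0 by blast
    have "h' v = (g ^^ Suc k) v" if v: "v \<in> verts T" for v
      using aut_mult[OF h(1) g h' v] h(3) Aut_verts[OF gA v] by (simp add: funpow_swap1)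
    then show ?case using h' h(2) by (intro bexI[of _ h']) simp_all
  qed
  then show thesis using that by blast
qed

lemma aaut_of_aut_pow_eq_one:
  assumes g: "g \<in> Aut_pat T P"
  shows "aaut_of_aut T g [^]\<^bsub>G\<^esub> (k::nat) = \<one>\<^bsub>G\<^esub> \<longleftrightarrow>
    (\<forall>v\<in>verts T. (g ^^ k) v = v)"
proof -
  obtain h where h: "h \<in> Aut_pat T P" "aaut_of_aut T g [^]\<^bsub>G\<^esub> k = aaut_of_aut T h"
      "\<And>v. v \<in> verts T \<Longrightarrow> h v = (g ^^ k) v"
    using aaut_of_aut_pow[OF g] by blast
  then show ?thesis using aaut_of_aut_eq_one[OF Aut_pat_Aut[OF h(1)]] by simp
qed

text \<open>Finitely many values, and equal values mean equal cosets of \<open>stab_germs n\<close>: the finite index witness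
required by \<open>commensurated_preimage\<close>.\<close>

definition ball_action :: "nat \<Rightarrow> ('v \<rightharpoonup> 'v) set \<Rightarrow> 'v \<Rightarrow> 'v" where
  "ball_action n x = restrict (inv_into (Aut_pat T P) (aaut_of_aut T) x) {v \<in> verts T. depth v \<le> n}"

lemma ball_action_aaut_of_aut:
  "g \<in> Aut_pat T P \<Longrightarrow> ball_action n (aaut_of_aut T g) = restrict g {v \<in> verts T. depth v \<le> n}"
  by (simp add: ball_action_def inv_into_f_f[OF aaut_of_aut_inj])

lemma finite_ball_action: "finite (ball_action n ` stab_germs 0)"
proof -
  let ?B = "{v \<in> verts T. depth v \<le> n}"
  have "ball_action n ` stab_germs 0 \<subseteq> ?B \<rightarrow>\<^sub>E ?B"
  proof
    fix f assume "f \<in> ball_action n ` stab_germs 0"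
    then obtain g where g: "g \<in> Aut_pat T P" "f = restrict g ?B"
      using ball_action_aaut_of_aut unfolding stab_germs_0 by blast
    note gA = Aut_pat_Aut[OF g(1)]
    show "f \<in> ?B \<rightarrow>\<^sub>E ?B" using g(2) Aut_verts[OF gA] Aut_depth[OF gA] by simp
  qed
  moreover have "finite (?B \<rightarrow>\<^sub>E ?B)" using finite_ball by (intro finite_PiE) auto
  ultimately show ?thesis by (rule finite_subset)
qed

lemma ball_action_eq:
  assumes ab: "a \<in> stab_germs 0" "b \<in> stab_germs 0" and eq: "ball_action n a = ball_action n b"
  shows "a \<otimes>\<^bsub>G\<^esub> inv\<^bsub>G\<^esub> b \<in> stab_germs n"
proof -
  let ?B = "{v \<in> verts T. depth v \<le> n}"
  obtain g where g: "g \<in> Aut_pat T P" "a = aaut_of_aut T g" using ab(1) unfolding stab_germs_0 by blast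
  obtain h where h: "h \<in> Aut_pat T P" "b = aaut_of_aut T h" using ab(2) unfolding stab_germs_0 by blast
  have "restrict g ?B = restrict h ?B"
    using eq ball_action_aaut_of_aut[OF g(1)] ball_action_aaut_of_aut[OF h(1)] g(2) h(2) by simp
  then have agree: "g v = h v" if "v \<in> verts T" "depth v \<le> n" for v
  proof -
    have "restrict g ?B v = restrict h ?B v" by (simp only: \<open>restrict g ?B = restrict h ?B\<close>)
    then show ?thesis using that by simp
  qed
  have "a \<otimes>\<^bsub>G\<^esub> inv\<^bsub>G\<^esub> b \<in> stab_germs 0"
    using subgroup.m_closed[OF W_subgroup ab(1) subgroup.m_inv_closed[OF W_subgroup ab(2)]] .
  then obtain k where k: "k \<in> Aut_pat T P" "a \<otimes>\<^bsub>G\<^esub> inv\<^bsub>G\<^esub> b = aaut_of_aut T k"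
    unfolding stab_germs_0 by blast
  have eq2: "aaut_of_aut T k \<otimes>\<^bsub>G\<^esub> aaut_of_aut T h = aaut_of_aut T g"
    unfolding k(2)[symmetric] g(2)[symmetric] h(2)[symmetric]
    using ab W_carrier by (simp add: m_assoc)
  have "k w = w" if w: "w \<in> verts T" "depth w \<le> n" for w
  proof -
    note hA = Aut_pat_Aut[OF h(1)]
    have "w \<in> h ` verts T" using bij_betw_imp_surj_on[OF AutD(2)[OF hA]] w by simp
    then obtain v where v: "v \<in> verts T" "w = h v" by blast
    then have "depth v \<le> n" using Aut_depth[OF hA v(1)] w by simp
    then show ?thesis using aut_mult[OF k(1) h(1) g(1) eq2 v(1)] agree[OF v(1)] v(2) by simp
  qed
  then have "k \<in> stabiliser n" using k(1) by (simp add: stabiliser_def)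
  then show ?thesis unfolding k(2) by (rule aaut_of_aut_in_stab_germs)
qed

end

section \<open>Thompson's group as prefix replacements\<close>

lemma mem_cylinder_iff: "x \<in> cylinder u \<longleftrightarrow> (\<exists>y. x = u \<frown> y)"
  by (auto simp: cylinder_def)

lemma conc_in_cylinder: "u \<frown> y \<in> cylinder u"
  by (simp add: cylinder_def)

lemma conc_eq_compare:
  assumes "u \<frown> x = w \<frown> y" "length u \<le> length w"
  obtains z where "w = u @ z" "x = z \<frown> y"
proof -
  have "u \<frown> x = take (length u) w \<frown> (drop (length u) w \<frown> y)"
    using assms(1) by simp
  moreover have "length u = length (take (length u) w)" using assms(2) by simp
  ultimately have "u = take (length u) w" "x = drop (length u) w \<frown> y"
    using concat_eq by blast+
  then show thesis using that[of "drop (length u) w"] by (metis append_take_drop_id)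
qed

text \<open>If \<open>w\<close> were a proper extension of \<open>u\<close>, then a suitable constant infinite word \<open>y\<close> would disagree with
the letter that follows \<open>u\<close> in \<open>w\<close>.\<close>

lemma conc_determines_word:
  fixes u w :: "bool list"
  assumes eq: "\<And>y. u \<frown> y = w \<frown> y" shows "u = w"
proof -
  have *: "w = u" if le: "length u \<le> length w" and eq: "\<And>y. u \<frown> y = w \<frown> y" for u w :: "bool list"
  proof -
    define y where "y = (\<lambda>_ :: nat. \<not> w ! length u)"
    obtain z where z: "w = u @ z" "y = z \<frown> y" using conc_eq_compare[OF eq le] .
    have "z = []"
    proof (rule ccontr)
      assume "z \<noteq> []"
      then have "(z \<frown> y) 0 = w ! length u" using z(1) by (simp add: nth_append)
      then show False using z(2) by (metis y_def)
    qed
    then show ?thesis using z by simp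
  qed
  show ?thesis
  proof (cases "length u \<le> length w")
    case True
    show ?thesis using *[OF True eq] by (rule sym)
  next
    case False
    then show ?thesis using *[of w u, OF _ eq[symmetric]] by linarith
  qed
qed

lemma conc_split: obtains u y where "length u = n" "x = u \<frown> y"
proof -
  have "x = map x [0..<n] \<frown> (\<lambda>i. x (i + n))" by (auto simp: conc_def fun_eq_iff)
  then show thesis using that[of "map x [0..<n]"] by simp
qed

lemma cylinder_partitionI:
  assumes "distinct us" "\<And>x. \<exists>!u. u \<in> set us \<and> x \<in> cylinder u"
  shows "cylinder_partition us"
proof -
  have "disjoint (cylinder ` set us)"
  proof (rule disjointI)
    fix A B assume "A \<in> cylinder ` set us" "B \<in> cylinder ` set us" "A \<noteq> B"
    then obtain u w where "u \<in> set us" "w \<in> set us" "u \<noteq> w" "A = cylinder u" "B = cylinder w" by blast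
    then show "A \<inter> B = {}" using assms(2) by blast
  qed
  moreover have "\<Union> (cylinder ` set us) = UNIV" using assms(2) by blast
  moreover have "{} \<notin> cylinder ` set us" by (auto simp: cylinder_def)
  ultimately show ?thesis using assms(1) by (simp add: cylinder_partition_def partition_on_def)
qed

text \<open>An element of \<open>V\<close> by means of one finite partition into cylinders of equal length. The image words
then automatically give a partition, and closure under composition and inverses is easily checked.\<close>

definition prefix_replacing :: "((nat \<Rightarrow> bool) \<Rightarrow> (nat \<Rightarrow> bool)) \<Rightarrow> bool" where
  "prefix_replacing g \<longleftrightarrow> bij g \<and> (\<exists>n. \<forall>u. length u = n \<longrightarrow> (\<exists>w. \<forall>y. g (u \<frown> y) = w \<frown> y))"

lemma prefix_replacing_long:
  assumes "prefix_replacing g"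
  obtains n where "\<And>u. n \<le> length u \<Longrightarrow> \<exists>w. \<forall>y. g (u \<frown> y) = w \<frown> y"
proof -
  obtain n where n: "\<And>u. length u = n \<Longrightarrow> \<exists>w. \<forall>y. g (u \<frown> y) = w \<frown> y"
    using assms unfolding prefix_replacing_def by blast
  have "\<exists>w. \<forall>y. g (u \<frown> y) = w \<frown> y" if "n \<le> length u" for u
  proof -
    obtain w where w: "\<forall>y. g (take n u \<frown> y) = w \<frown> y" using n[of "take n u"] \<open>n \<le> length u\<close> by auto
    have "g (u \<frown> y) = (w @ drop n u) \<frown> y" for y
      using w[rule_format, of "drop n u \<frown> y"] by simp
    then show ?thesis by blast
  qed
  then show thesis using that by blast
qed

lemma finite_words: "finite {u :: bool list. length u = n}"
  using finite_lists_length_eq[of "UNIV :: bool set" n] by simp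

lemma prefix_replacing_comp:
  assumes g: "prefix_replacing g" and h: "prefix_replacing h" shows "prefix_replacing (g \<circ> h)"
proof -
  obtain n where n: "\<And>u. n \<le> length u \<Longrightarrow> \<exists>w. \<forall>y. g (u \<frown> y) = w \<frown> y"
    using prefix_replacing_long[OF g] by blast
  obtain m where m: "\<And>u. m \<le> length u \<Longrightarrow> \<exists>w. \<forall>y. h (u \<frown> y) = w \<frown> y"
    using prefix_replacing_long[OF h] by blast
  have "\<exists>w. \<forall>y. (g \<circ> h) (u \<frown> y) = w \<frown> y" if u: "length u = m + n" for u
  proof -
    obtain w where w: "\<forall>y. h (take m u \<frown> y) = w \<frown> y" using m[of "take m u"] u by auto
    obtain w' where w': "\<forall>y. g ((w @ drop m u) \<frown> y) = w' \<frown> y" using n[of "w @ drop m u"] u by auto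
    have "(g \<circ> h) (u \<frown> y) = w' \<frown> y" for y
      using w[rule_format, of "drop m u \<frown> y"] w'[rule_format, of y] by simp
    then show ?thesis by blast
  qed
  moreover have "bij (g \<circ> h)" using g h by (simp add: prefix_replacing_def bij_comp)
  ultimately show ?thesis unfolding prefix_replacing_def by blast
qed

text \<open>Every word at least as long as all the image words extends one of them.\<close>

lemma prefix_replacing_inv:
  assumes g: "prefix_replacing g" shows "prefix_replacing (inv_into UNIV g)"
proof -
  have bij: "bij g" using g by (simp add: prefix_replacing_def)
  obtain n where "\<And>u. length u = n \<Longrightarrow> \<exists>w. \<forall>y. g (u \<frown> y) = w \<frown> y"
    using g unfolding prefix_replacing_def by blast
  then obtain w where w: "\<And>u y. length u = n \<Longrightarrow> g (u \<frown> y) = w u \<frown> y" by metis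
  have fin: "finite ((length \<circ> w) ` {u. length u = n})" using finite_words by blast
  obtain k where k: "\<And>u. length u = n \<Longrightarrow> length (w u) \<le> k"
    using Max_ge[OF fin] by (metis (mono_tags, lifting) comp_apply imageI mem_Collect_eq)
  have "\<exists>v'. \<forall>y. inv_into UNIV g (v \<frown> y) = v' \<frown> y" if v: "length v = k" for v
  proof -
    obtain u y where u: "length u = n" "inv_into UNIV g (v \<frown> (\<lambda>_. False)) = u \<frown> y" using conc_split .
    then have "v \<frown> (\<lambda>_. False) = g (u \<frown> y)" using bij by (metis bij_inv_eq_iff)
    then have "w u \<frown> y = v \<frown> (\<lambda>_. False)" using w[OF u(1)] by simp
    then obtain z where z: "v = w u @ z" using conc_eq_compare k[OF u(1)] v by metis
    have "inv_into UNIV g (v \<frown> y) = (u @ z) \<frown> y" for y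
      using w[OF u(1), of "z \<frown> y"] z bij by (metis bij_inv_eq_iff conc_conc)
    then show ?thesis by blast
  qed
  then show ?thesis unfolding prefix_replacing_def using bij bij_imp_bij_inv by blast
qed

lemma prefix_replacing_id: "prefix_replacing id"
  unfolding prefix_replacing_def by auto

lemma open_if_determined_by_prefix:
  fixes S :: "(nat \<Rightarrow> bool) set"
  assumes "\<And>x y. x \<in> S \<Longrightarrow> (\<forall>i<n. y i = x i) \<Longrightarrow> y \<in> S"
  shows "open S"
proof -
  have "open {y :: nat \<Rightarrow> bool. \<forall>i<n. y i = x i}" for x :: "nat \<Rightarrow> bool"
  proof -
    have "open ((\<lambda>y :: nat \<Rightarrow> bool. y i) -` {x i})" for i
      by (intro open_vimage open_discrete continuous_on_product_coordinates)
    then have "open (\<Inter>i<n. (\<lambda>y :: nat \<Rightarrow> bool. y i) -` {x i})" by (intro open_INT) auto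
    moreover have "(\<Inter>i<n. (\<lambda>y :: nat \<Rightarrow> bool. y i) -` {x i}) = {y. \<forall>i<n. y i = x i}" by auto
    ultimately show ?thesis by simp
  qed
  then have "open (\<Union>x\<in>S. {y. \<forall>i<n. y i = x i})" by blast
  moreover have "(\<Union>x\<in>S. {y. \<forall>i<n. y i = x i}) = S" using assms by blast
  ultimately show ?thesis by simp
qed

text \<open>The first \<open>n + i + 1\<close> letters of \<open>x\<close> determine letter \<open>i\<close> of \<open>g x\<close>: the replaced prefix has length
\<open>n\<close>, and the new prefix can only delay the letters that follow.\<close>

lemma continuous_prefix_replacing:
  assumes g: "prefix_replacing g" shows "continuous_on UNIV g"
proof (rule continuous_on_coordinatewise_then_product)
  fix i
  obtain n where n: "\<And>u. n \<le> length u \<Longrightarrow> \<exists>w. \<forall>y. g (u \<frown> y) = w \<frown> y"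
    using prefix_replacing_long[OF g] by blast
  have agree: "g y i = g x i" if xy: "\<forall>j<n + Suc i. y j = x j" for x y
  proof -
    obtain u x' where u: "length u = n" "x = u \<frown> x'" using conc_split .
    obtain u' y' where u': "length u' = n" "y = u' \<frown> y'" using conc_split .
    have "u ! j = u' ! j" if "j < n" for j using xy[rule_format, of j] that u u' by simp
    then have uu: "u = u'" using u(1) u'(1) by (simp add: nth_equalityI)
    have tail: "x' j = y' j" if "j \<le> i" for j
      using xy[rule_format, of "n + j"] that u u' by simp
    obtain w where "\<forall>y. g (u \<frown> y) = w \<frown> y" using n[of u] u by auto
    then show ?thesis using u(2) u'(2) uu tail[of "i - length w"] by (simp add: conc_def)
  qed
  show "continuous_on UNIV (\<lambda>x. g x i)"
    unfolding continuous_on_open_vimage[OF open_UNIV]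
  proof (intro allI impI)
    fix B :: "bool set"
    have "open {x. g x i \<in> B}"
    proof (rule open_if_determined_by_prefix[of _ "n + Suc i"])
      fix x y assume x: "x \<in> {x. g x i \<in> B}" and xy: "\<forall>j<n + Suc i. y j = x j"
      show "y \<in> {x. g x i \<in> B}" using x agree[OF xy] by simp
    qed
    then show "open ((\<lambda>x. g x i) -` B \<inter> UNIV)" by (simp add: vimage_def)
  qed
qed

lemma homeomorphic_prefix_replacing:
  assumes g: "prefix_replacing g" shows "homeomorphic_map euclidean euclidean g"
proof -
  have "bij g" using g by (simp add: prefix_replacing_def)
  then have "homeomorphic_maps euclidean euclidean g (inv_into UNIV g)"
    unfolding homeomorphic_maps_def
    using continuous_prefix_replacing[OF g] continuous_prefix_replacing[OF prefix_replacing_inv[OF g]]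
    by (simp add: bij_is_inj bij_is_surj surj_f_inv_f)
  then show ?thesis using homeomorphic_maps_imp_map by blast
qed

text \<open>A partition into cylinders is refined by the partition into all words whose length is the sum of
the lengths of the given words.\<close>

theorem thompson_V_iff: "g \<in> carrier thompson_V \<longleftrightarrow> prefix_replacing g"
proof
  assume "g \<in> carrier thompson_V"
  then obtain us ws where hom: "homeomorphic_map euclidean euclidean g" and us: "cylinder_partition us"
    and g: "\<And>i x. i < length us \<Longrightarrow> g (us ! i \<frown> x) = ws ! i \<frown> x"
    unfolding thompson_V_def by auto
  have "inj g" "surj g"
    using homeomorphic_imp_injective_map[OF hom] homeomorphic_imp_surjective_map[OF hom] by simp_all
  then have "bij g" by (rule bijI)
  moreover have "\<exists>w. \<forall>y. g (u \<frown> y) = w \<frown> y" if u: "length u = sum_list (map length us)" for u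
  proof -
    have "u \<frown> (\<lambda>_. False) \<in> \<Union> (cylinder ` set us)"
      using us by (simp add: cylinder_partition_def partition_on_def)
    then obtain u' where u': "u' \<in> set us" "u \<frown> (\<lambda>_. False) \<in> cylinder u'" by blast
    obtain x where x: "u \<frown> (\<lambda>_. False) = u' \<frown> x" using u'(2) unfolding mem_cylinder_iff by blast
    obtain i where i': "i < length us" "us ! i = u'" using u'(1) unfolding in_set_conv_nth by blast
    have i: "i < length us" "us ! i \<frown> x = u \<frown> (\<lambda>_. False)" using i' x by simp_all
    then have "length (us ! i) \<le> length u" using u by (simp add: member_le_sum_list)
    then obtain z where "u = us ! i @ z" using conc_eq_compare[OF i(2)] by blast
    then have "g (u \<frown> y) = (ws ! i @ z) \<frown> y" for y using g[OF i(1), of "z \<frown> y"] by simp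
    then show ?thesis by blast
  qed
  ultimately show "prefix_replacing g" unfolding prefix_replacing_def by blast
next
  assume g: "prefix_replacing g"
  then have bij: "bij g" by (simp add: prefix_replacing_def)
  obtain n where "\<And>u. length u = n \<Longrightarrow> \<exists>w. \<forall>y. g (u \<frown> y) = w \<frown> y"
    using g unfolding prefix_replacing_def by blast
  then obtain w where w: "\<And>u y. length u = n \<Longrightarrow> g (u \<frown> y) = w u \<frown> y" by metis
  obtain us :: "bool list list" where us: "set us = {u. length u = n}" "distinct us"
    using finite_distinct_list[OF finite_words] by blast
  have level: "\<exists>!u. u \<in> set us \<and> x \<in> cylinder u" for x
  proof -
    obtain u y where u: "length u = n" "x = u \<frown> y" using conc_split .
    show ?thesis
    proof (rule ex1I[of _ u])
      show "u \<in> set us \<and> x \<in> cylinder u" using u us conc_in_cylinder by simp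
      fix u' assume u': "u' \<in> set us \<and> x \<in> cylinder u'"
      then obtain y' where "u' \<frown> y' = u \<frown> y" using u(2) unfolding mem_cylinder_iff by metis
      moreover have "length u' = length u" using u(1) u' us(1) by simp
      ultimately show "u' = u" using concat_eq by blast
    qed
  qed
  have inj: "u = u'" if "length u = n" "length u' = n" and x: "x \<in> cylinder (w u)" "x \<in> cylinder (w u')" for u u' x
  proof -
    obtain y y' where "x = w u \<frown> y" "x = w u' \<frown> y'" using x unfolding mem_cylinder_iff by blast
    then have "g (u \<frown> y) = g (u' \<frown> y')" using w that by simp
    then have "u \<frown> y = u' \<frown> y'" by (rule injD[OF bij_is_inj[OF bij]])
    moreover have "length u = length u'" using that by simp
    ultimately show ?thesis using concat_eq by blast
  qed
  have "inj_on w (set us)"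
  proof (rule inj_onI)
    fix u u' assume "u \<in> set us" "u' \<in> set us" "w u = w u'"
    then show "u = u'" using inj[of u u' "w u \<frown> undefined"] us(1) conc_in_cylinder by simp
  qed
  then have dist: "distinct (map w us)" using us by (simp add: distinct_map)
  have img: "\<exists>!v. v \<in> set (map w us) \<and> x \<in> cylinder v" for x
  proof -
    obtain u y where u: "length u = n" "inv_into UNIV g x = u \<frown> y" using conc_split .
    then have "x = w u \<frown> y" using w bij by (metis bij_inv_eq_iff)
    then have x: "x \<in> cylinder (w u)" by (simp add: conc_in_cylinder)
    show ?thesis
    proof (rule ex1I[of _ "w u"])
      show "w u \<in> set (map w us) \<and> x \<in> cylinder (w u)" using u us x by auto
      fix v assume v: "v \<in> set (map w us) \<and> x \<in> cylinder v"
      then obtain u' where "u' \<in> set us" "v = w u'" by auto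
      then show "v = w u" using inj[OF u(1) _ x, of u'] us(1) v by simp
    qed
  qed
  have "\<forall>i<length us. \<forall>y. g (us ! i \<frown> y) = map w us ! i \<frown> y"
  proof (intro allI impI)
    fix i y assume i: "i < length us"
    then have "us ! i \<in> set us" by simp
    then show "g (us ! i \<frown> y) = map w us ! i \<frown> y" using w us(1) i by simp
  qed
  then have "\<exists>us ws. length us = length ws \<and> cylinder_partition us \<and> cylinder_partition ws \<and>
      (\<forall>i<length us. \<forall>y. g (us ! i \<frown> y) = ws ! i \<frown> y)"
    using cylinder_partitionI[OF us(2) level] cylinder_partitionI[OF dist img]
    by (intro exI[of _ us] exI[of _ "map w us"]) simp
  then show "g \<in> carrier thompson_V"
    unfolding thompson_V_def using homeomorphic_prefix_replacing[OF g] by simp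
qed

lemma mult_thompson_V:
  assumes "g \<in> carrier thompson_V" "h \<in> carrier thompson_V"
  shows "g \<otimes>\<^bsub>thompson_V\<^esub> h = g \<circ> h"
  using assms unfolding thompson_V_iff prefix_replacing_def
  by (simp add: thompson_V_def BijGroup_def Bij_def compose_def comp_def restrict_def)

lemma one_thompson_V: "\<one>\<^bsub>thompson_V\<^esub> = id"
  by (auto simp: thompson_V_def BijGroup_def)

theorem group_thompson_V: "group thompson_V"
proof (rule groupI)
  fix g h k assume a: "g \<in> carrier thompson_V" "h \<in> carrier thompson_V"
  show gh: "g \<otimes>\<^bsub>thompson_V\<^esub> h \<in> carrier thompson_V"
    unfolding mult_thompson_V[OF a] using a prefix_replacing_comp by (simp add: thompson_V_iff)
next
  fix g h k assume a: "g \<in> carrier thompson_V" "h \<in> carrier thompson_V" "k \<in> carrier thompson_V"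
  then have "g \<circ> h \<in> carrier thompson_V" "h \<circ> k \<in> carrier thompson_V"
    using prefix_replacing_comp by (simp_all add: thompson_V_iff)
  then show "g \<otimes>\<^bsub>thompson_V\<^esub> h \<otimes>\<^bsub>thompson_V\<^esub> k = g \<otimes>\<^bsub>thompson_V\<^esub> (h \<otimes>\<^bsub>thompson_V\<^esub> k)"
    using a by (simp add: mult_thompson_V comp_assoc)
next
  show one: "\<one>\<^bsub>thompson_V\<^esub> \<in> carrier thompson_V"
    by (simp add: one_thompson_V thompson_V_iff prefix_replacing_id)
  fix g assume g: "g \<in> carrier thompson_V"
  show "\<one>\<^bsub>thompson_V\<^esub> \<otimes>\<^bsub>thompson_V\<^esub> g = g" using mult_thompson_V[OF one g] by (simp add: one_thompson_V)
  have "inv_into UNIV g \<in> carrier thompson_V" using g prefix_replacing_inv by (simp add: thompson_V_iff)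
  moreover have "inv_into UNIV g \<circ> g = id" using g by (simp add: thompson_V_iff prefix_replacing_def bij_is_inj)
  ultimately show "\<exists>h\<in>carrier thompson_V. h \<otimes>\<^bsub>thompson_V\<^esub> g = \<one>\<^bsub>thompson_V\<^esub>"
    using mult_thompson_V[OF _ g] one_thompson_V by metis
qed

section \<open>Trees spelled by binary words\<close>

lemma ex1_unique: "\<exists>!x. Q x \<Longrightarrow> Q a \<Longrightarrow> Q b \<Longrightarrow> a = b"
  by blast

text \<open>The boundary of the tree is identified with the Cantor set by spelling out paths. The last
assumption says that from some length on a suffix \<open>z\<close> decides whether \<open>s @ z\<close> is the word of a vertex,
and of which label. This is what makes prefix replacements act on vertices.\<close>

locale word_tree = patterned_tree T depth P
  for T :: "('v, 'x) rooted_tree_scheme" and depth and P :: "('v, 'l, 'c, 'y) patterning_scheme" +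
  fixes word :: "'v \<Rightarrow> bool list" and code :: "'c \<Rightarrow> bool list" and K :: nat
  assumes word_base: "word (base T) = []"
    and word_edge: "(u, v) \<in> edges T \<Longrightarrow> word v = word u @ code (ccol P (u, v))"
    and code_nonempty: "(u, v) \<in> edges T \<Longrightarrow> code (ccol P (u, v)) \<noteq> []"
    and child_cylinder: "v \<in> verts T \<Longrightarrow> x \<in> cylinder (word v) \<Longrightarrow>
      \<exists>!c. c \<in> children T v \<and> x \<in> cylinder (word c)"
    and K_pos: "0 < K"
    and synchronised: "v \<in> verts T \<Longrightarrow> word v = s @ z \<Longrightarrow> K \<le> length z \<Longrightarrow>
      \<exists>v'\<in>verts T. word v' = s' @ z \<and> lab P v' = lab P v"
begin

lemma cylinder_child: "(u, v) \<in> edges T \<Longrightarrow> cylinder (word v) \<subseteq> cylinder (word u)"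
proof
  fix x assume e: "(u, v) \<in> edges T" and "x \<in> cylinder (word v)"
  then obtain y where "x = word u \<frown> (code (ccol P (u, v)) \<frown> y)"
    unfolding mem_cylinder_iff word_edge[OF e] by auto
  then show "x \<in> cylinder (word u)" using conc_in_cylinder by metis
qed

text \<open>So the words on each level form a partition into cylinders.\<close>

lemma level_cylinder: "\<exists>!v. v \<in> verts T \<and> depth v = n \<and> x \<in> cylinder (word v)"
proof (induction n)
  case 0
  have "x \<in> cylinder (word (base T))" by (auto simp: word_base mem_cylinder_iff)
  then show ?case
    by (intro ex1I[of _ "base T"]) (use base_in depth_base in \<open>blast intro: depth_0\<close>)+
next
  case (Suc n)
  obtain u where u: "u \<in> verts T \<and> depth u = n \<and> x \<in> cylinder (word u)"
    using ex1_implies_ex[OF Suc.IH] by blast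
  then have ex1: "\<exists>!c. c \<in> children T u \<and> x \<in> cylinder (word c)" using child_cylinder by simp
  obtain c where c: "c \<in> children T u \<and> x \<in> cylinder (word c)"
    using ex1_implies_ex[OF ex1] by blast
  show ?case
  proof (rule ex1I[of _ c])
    have e: "(u, c) \<in> edges T" using c by (simp add: children_def)
    show "c \<in> verts T \<and> depth c = Suc n \<and> x \<in> cylinder (word c)"
      using edge_verts[OF e] depth_edge[OF e] u c by simp
  next
    fix c' assume c': "c' \<in> verts T \<and> depth c' = Suc n \<and> x \<in> cylinder (word c')"
    then have "c' \<noteq> base T" using depth_base by auto
    then obtain u' where e: "(u', c') \<in> edges T" using parent_ex c' by blast
    have "u' \<in> verts T \<and> depth u' = n \<and> x \<in> cylinder (word u')"
      using edge_verts[OF e] depth_edge[OF e] cylinder_child[OF e] c' by auto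
    then have "u' = u" using ex1_unique[OF Suc.IH] u by blast
    then have "c' \<in> children T u \<and> x \<in> cylinder (word c')" using e c' by (simp add: children_def)
    then show "c' = c" using ex1_unique[OF ex1] c by blast
  qed
qed

lemma cylinder_meet_descend:
  assumes v: "v \<in> verts T" "x \<in> cylinder (word v)" and w: "w \<in> verts T" "x \<in> cylinder (word w)"
    and le: "depth v \<le> depth w"
  shows "(v, w) \<in> (edges T)\<^sup>*"
proof -
  have "x \<in> cylinder (word w) \<longrightarrow> depth v \<le> depth w \<longrightarrow> (v, w) \<in> (edges T)\<^sup>*"
    using w(1)
  proof (induction rule: tree_induct)
    case base
    show ?case
    proof (intro impI)
      assume "depth v \<le> depth (base T)"
      then have "depth v = 0" using depth_base by simp
      then have "v = base T" by (rule depth_0[OF v(1)])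
      then show "(v, base T) \<in> (edges T)\<^sup>*" by simp
    qed
  next
    case (child u w)
    show ?case
    proof (intro impI)
      assume x: "x \<in> cylinder (word w)" and le: "depth v \<le> depth w"
      show "(v, w) \<in> (edges T)\<^sup>*"
      proof (cases "depth v = depth w")
        case True
        have "v = w"
          by (rule ex1_unique[OF level_cylinder[of "depth v" x]])
            (use v x True edge_verts[OF child(2)] in simp_all)
        then show ?thesis by simp
      next
        case False
        then have "depth v \<le> depth u" using le depth_edge[OF child(2)] by simp
        moreover have "x \<in> cylinder (word u)" using cylinder_child[OF child(2)] x by blast
        ultimately have "(v, u) \<in> (edges T)\<^sup>*" using child(3) by blast
        then show ?thesis using child(2) by (rule rtrancl_into_rtrancl)
      qed
    qed
  qed
  then show ?thesis using w le by blast
qed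

lemma word_length_descend: "(v, w) \<in> (edges T)\<^sup>+ \<Longrightarrow> length (word v) < length (word w)"
proof (induction rule: trancl_induct)
  case (base w)
  then show ?case using word_edge[OF base] code_nonempty[OF base] by simp
next
  case (step u w)
  then show ?case using word_edge[OF step(2)] by simp
qed

lemma word_inj: "inj_on word (verts T)"
proof -
  have *: "v = w" if "v \<in> verts T" "w \<in> verts T" "word v = word w" "depth v \<le> depth w" for v w
  proof (rule ccontr)
    assume "v \<noteq> w"
    have "(v, w) \<in> (edges T)\<^sup>*"
      using cylinder_meet_descend[of v "word v \<frown> undefined" w] that conc_in_cylinder by simp
    then have "(v, w) \<in> (edges T)\<^sup>+" using \<open>v \<noteq> w\<close> by (simp add: rtrancl_eq_or_trancl)
    then show False using word_length_descend that(3) by fastforce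
  qed
  show ?thesis
  proof (rule inj_onI)
    fix v w assume "v \<in> verts T" "w \<in> verts T" "word v = word w"
    then show "v = w" using *[of v w] *[of w v] by (cases "depth v \<le> depth w") simp_all
  qed
qed

definition roots :: "'v set \<Rightarrow> 'v set" where
  "roots F = {v \<in> F. \<forall>u. (u, v) \<in> edges T \<longrightarrow> u \<notin> F}"

text \<open>Every infinite word follows exactly one path; it enters \<open>F\<close> because \<open>F\<close> is cofinite, and it stays
there because \<open>F\<close> is closed under children. The root is the vertex at which it enters.\<close>

lemma roots_cylinder:
  assumes F: "cofinite_forest F" shows "\<exists>!v. v \<in> roots F \<and> x \<in> cylinder (word v)"
proof -
  have FV: "v \<in> verts T" if "v \<in> F" for v using F that by (auto simp: cofinite_forest_def)
  obtain n where n: "{v \<in> verts T. n \<le> depth v} \<subseteq> F" using cofinite_forest_contains_deep[OF F] .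
  obtain v0 where "v0 \<in> verts T" "depth v0 = n" "x \<in> cylinder (word v0)"
    using ex1_implies_ex[OF level_cylinder, of n x] by blast
  then have "v0 \<in> F \<and> x \<in> cylinder (word v0)" using n by auto
  then obtain v where v: "v \<in> F \<and> x \<in> cylinder (word v)"
    and least: "\<And>w. w \<in> F \<and> x \<in> cylinder (word w) \<Longrightarrow> depth v \<le> depth w"
    using ex_has_least_nat[of "\<lambda>v. v \<in> F \<and> x \<in> cylinder (word v)" v0 depth] by blast
  have root: "v \<in> roots F"
    unfolding roots_def
  proof (intro CollectI conjI allI impI)
    show "v \<in> F" using v by simp
    fix u assume e: "(u, v) \<in> edges T"
    have "x \<in> cylinder (word u)" using cylinder_child[OF e] v by blast
    then show "u \<notin> F" using least[of u] depth_edge[OF e] by auto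
  qed
  have unique: "v = w" if "v \<in> roots F" "w \<in> roots F" "x \<in> cylinder (word v)" "x \<in> cylinder (word w)"
      "depth v \<le> depth w" for v w
  proof (rule ccontr)
    assume "v \<noteq> w"
    have F': "v \<in> F" "w \<in> F" using that(1,2) by (simp_all add: roots_def)
    have "(v, w) \<in> (edges T)\<^sup>*" using cylinder_meet_descend[OF FV _ FV] F' that by blast
    then show False
    proof (cases rule: rtranclE)
      case (step u)
      then show False using cofinite_forest_descend[OF F F'(1)] that(2) unfolding roots_def by blast
    qed (use \<open>v \<noteq> w\<close> in simp)
  qed
  show ?thesis
  proof (rule ex1I[of _ v])
    show "v \<in> roots F \<and> x \<in> cylinder (word v)" using root v by simp
    fix w assume w: "w \<in> roots F \<and> x \<in> cylinder (word w)"
    show "w = v" using unique[of v w] unique[of w v] w root v by (cases "depth v \<le> depth w") simp_all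
  qed
qed

definition matches :: "((nat \<Rightarrow> bool) \<Rightarrow> (nat \<Rightarrow> bool)) \<Rightarrow> 'v \<Rightarrow> 'v \<Rightarrow> bool" where
  "matches g v w \<longleftrightarrow> v \<in> verts T \<and> w \<in> verts T \<and> v \<noteq> base T \<and> w \<noteq> base T \<and> lab P v = lab P w \<and>
     (\<forall>y. g (word v \<frown> y) = word w \<frown> y)"

text \<open>The largest colour-preserving map of vertices induced by \<open>g\<close>. Taking the largest one avoids any
choice of representatives.\<close>

definition vertex_map :: "((nat \<Rightarrow> bool) \<Rightarrow> (nat \<Rightarrow> bool)) \<Rightarrow> ('v \<rightharpoonup> 'v)" where
  "vertex_map g v = (if \<exists>w. matches g v w then Some (SOME w. matches g v w) else None)"

lemma matches_unique: "matches g v w \<Longrightarrow> matches g v w' \<Longrightarrow> w = w'"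
proof -
  assume m: "matches g v w" "matches g v w'"
  then have "word w \<frown> y = word w' \<frown> y" for y unfolding matches_def by metis
  then have "word w = word w'" by (rule conc_determines_word)
  then show "w = w'" using inj_onD[OF word_inj] m by (simp add: matches_def)
qed

lemma vertex_map_iff: "vertex_map g v = Some w \<longleftrightarrow> matches g v w"
proof
  assume "matches g v w"
  then have "matches g v (SOME w. matches g v w)" by (rule someI)
  then show "vertex_map g v = Some w" using matches_unique \<open>matches g v w\<close> by (auto simp: vertex_map_def)
qed (auto simp: vertex_map_def split: if_splits intro: someI)

text \<open>The children of \<open>v\<close> and \<open>w\<close> correspond by colours, and the colour of an edge determines the word
that is appended.\<close>

lemma matches_child:
  assumes m: "matches g v w" and c: "c \<in> children T v"
  obtains c' where "c' \<in> children T w" "matches g c c'" "ccol P (w, c') = ccol P (v, c)"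
proof -
  have vw: "v \<in> verts T" "v \<noteq> base T" "w \<in> verts T" "w \<noteq> base T" "lab P v = lab P w"
    and g: "\<And>y. g (word v \<frown> y) = word w \<frown> y" using m by (auto simp: matches_def)
  have "ccol P (v, c) \<in> all_cols P (lab P w)" using colour_mem_all[OF vw(1,2) c] vw(5) by simp
  then obtain c' where c': "c' \<in> children T w" "ccol P (w, c') = ccol P (v, c)"
    by (rule colour_surj[OF vw(3,4)])
  have e: "(v, c) \<in> edges T" "(w, c') \<in> edges T" using c c' by (auto simp: children_def)
  have cv: "c \<in> verts T" "c \<noteq> base T" "c' \<in> verts T" "c' \<noteq> base T"
    using child_vert[OF c] child_vert[OF c'(1)] by auto
  have "ccol P (v, c) \<in> cols P (lab P v) (lab P c)" using colour_mem[OF vw(1,2) c] .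
  moreover have "ccol P (v, c) \<in> cols P (lab P v) (lab P c')"
    using colour_mem[OF vw(3,4) c'(1)] c'(2) vw(5) by simp
  ultimately have "lab P c = lab P c'"
    using cols_disjoint[OF _ _ label_mem[OF vw(1,2)] label_mem[OF cv(1,2)] label_mem[OF vw(1,2)] label_mem[OF cv(3,4)]]
    by simp
  moreover have "g (word c \<frown> y) = word c' \<frown> y" for y
    using g[of "code (ccol P (v, c)) \<frown> y"] word_edge[OF e(1)] word_edge[OF e(2)] c'(2) by simp
  ultimately have "matches g c c'" using cv by (simp add: matches_def)
  then show thesis using that c' by blast
qed

lemma matches_inv: "bij g \<Longrightarrow> matches (inv_into UNIV g) w v \<longleftrightarrow> matches g v w"
proof -
  assume bij: "bij g"
  have "(\<forall>y. inv_into UNIV g (word w \<frown> y) = word v \<frown> y) \<longleftrightarrow> (\<forall>y. g (word v \<frown> y) = word w \<frown> y)"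
    using bij by (metis bij_inv_eq_iff)
  then show ?thesis unfolding matches_def by auto
qed

lemma matches_comp: "matches h u v \<Longrightarrow> matches g v w \<Longrightarrow> matches (g \<circ> h) u w"
  by (simp add: matches_def)

text \<open>A vertex whose word has at least \<open>n + K\<close> letters has the form \<open>u @ z\<close> with \<open>g\<close> replacing \<open>u\<close> and \<open>z\<close> long
enough for synchronisation. Only finitely many vertices have shorter words.\<close>

lemma cofinite_dom_vertex_map:
  assumes g: "prefix_replacing g" shows "cofinite_forest (dom (vertex_map g))"
proof -
  obtain n where n: "\<And>u. n \<le> length u \<Longrightarrow> \<exists>w. \<forall>y. g (u \<frown> y) = w \<frown> y"
    using prefix_replacing_long[OF g] by blast
  have long: "v \<in> dom (vertex_map g)" if v: "v \<in> verts T" "n + K \<le> length (word v)" for v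
  proof -
    let ?u = "take n (word v)" and ?z = "drop n (word v)"
    have uz: "word v = ?u @ ?z" "K \<le> length ?z" using v by simp_all
    obtain w where w: "\<forall>y. g (?u \<frown> y) = w \<frown> y" using n[of ?u] v by auto
    obtain v' where v': "v' \<in> verts T" "word v' = w @ ?z" "lab P v' = lab P v"
      using synchronised[OF v(1) uz, of w] by blast
    have "?z \<noteq> []" using uz(2) K_pos by auto
    then have "v \<noteq> base T" "v' \<noteq> base T" using word_base uz(1) v'(2) by auto
    moreover have "g (word v \<frown> y) = word v' \<frown> y" for y
    proof -
      have "word v \<frown> y = ?u \<frown> (?z \<frown> y)" by simp
      then have "g (word v \<frown> y) = w \<frown> (?z \<frown> y)" using w by metis
      then show ?thesis using v'(2) by simp
    qed
    ultimately have "matches g v v'" using v v' by (simp add: matches_def)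
    then show ?thesis using vertex_map_iff by blast
  qed
  have "finite {u :: bool list. length u \<le> n + K}"
    using finite_lists_length_le[of "UNIV :: bool set" "n + K"] by simp
  moreover have "word ` {v \<in> verts T. length (word v) \<le> n + K} \<subseteq> {u. length u \<le> n + K}" by auto
  ultimately have "finite (word ` {v \<in> verts T. length (word v) \<le> n + K})" by (rule finite_subset[rotated])
  then have "finite {v \<in> verts T. length (word v) \<le> n + K}"
    by (rule finite_imageD) (rule inj_on_subset[OF word_inj], blast)
  moreover have "verts T - dom (vertex_map g) \<subseteq> {v \<in> verts T. length (word v) \<le> n + K}"
    using long by force
  ultimately have "finite (verts T - dom (vertex_map g))" by (rule finite_subset[rotated])
  moreover have "dom (vertex_map g) \<subseteq> verts T" using vertex_map_iff by (auto simp: matches_def)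
  moreover have "c \<in> dom (vertex_map g)" if e: "v \<in> dom (vertex_map g)" "(v, c) \<in> edges T" for v c
  proof -
    obtain w where m: "matches g v w" using e vertex_map_iff by blast
    have "c \<in> children T v" using e by (simp add: children_def)
    then obtain c' where "matches g c c'" by (rule matches_child[OF m])
    then show ?thesis using vertex_map_iff by blast
  qed
  ultimately show ?thesis unfolding cofinite_forest_def by blast
qed

lemma patterned_vertex_map:
  assumes g: "prefix_replacing g" shows "patterned_map (vertex_map g)"
proof -
  have bij: "bij g" using g by (simp add: prefix_replacing_def)
  have ran: "ran (vertex_map g) = dom (vertex_map (inv_into UNIV g))"
    unfolding ran_def dom_def using vertex_map_iff matches_inv[OF bij] by auto
  have sub: "(u', v') \<in> edges T" if m: "matches g u u'" "matches g v v'" and e: "(u, v) \<in> edges T" for g u v u' v'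
  proof -
    have "v \<in> children T u" using e by (simp add: children_def)
    then obtain c where c: "c \<in> children T u'" "matches g v c" by (rule matches_child[OF m(1)])
    have "c = v'" using matches_unique c(2) m(2) .
    then show ?thesis using c(1) by (simp add: children_def)
  qed
  have "almost_iso (vertex_map g)"
    unfolding almost_iso_def
  proof (intro conjI allI impI)
    show "cofinite_forest (dom (vertex_map g))" "cofinite_forest (ran (vertex_map g))"
      using cofinite_dom_vertex_map g prefix_replacing_inv[OF g] by (simp_all add: ran)
    show "inj_on (vertex_map g) (dom (vertex_map g))"
    proof (rule inj_onI)
      fix u v assume "u \<in> dom (vertex_map g)" "vertex_map g u = vertex_map g v"
      then obtain w where "matches g u w" "matches g v w" using vertex_map_iff by (metis domD)
      then show "u = v" using matches_unique matches_inv[OF bij] by metis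
    qed
    fix u v u' v' assume "vertex_map g u = Some u'" "vertex_map g v = Some v'"
    then have m: "matches g u u'" "matches g v v'" by (simp_all add: vertex_map_iff)
    then have m': "matches (inv_into UNIV g) u' u" "matches (inv_into UNIV g) v' v"
      by (simp_all add: matches_inv[OF bij])
    show "(u, v) \<in> edges T \<longleftrightarrow> (u', v') \<in> edges T" using sub[OF m] sub[OF m'] by blast
  qed
  moreover have "locally_patterned (the \<circ> vertex_map g) v" if v: "v \<in> dom (vertex_map g)" for v
  proof -
    obtain w where vw: "vertex_map g v = Some w" using v by blast
    then have m: "matches g v w" by (simp add: vertex_map_iff)
    show ?thesis
    proof (rule locally_patterned_if_colours_kept)
      show "v \<in> verts T" "v \<noteq> base T" "lab P ((the \<circ> vertex_map g) v) = lab P v"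
        using m vw by (auto simp: matches_def)
      fix c assume "c \<in> children T v"
      then obtain c' where "matches g c c'" "ccol P (w, c') = ccol P (v, c)" by (rule matches_child[OF m])
      then show "ccol P ((the \<circ> vertex_map g) v, (the \<circ> vertex_map g) c) = ccol P (v, c)"
        using vw vertex_map_iff[of g c c'] by simp
    qed
  qed
  moreover have "base T \<notin> dom (vertex_map g)" "base T \<notin> ran (vertex_map g)"
    unfolding dom_def ran_def using vertex_map_iff by (auto simp: matches_def)
  ultimately show ?thesis unfolding patterned_map_def by blast
qed

lemmas almost_iso_vertex_map = patterned_mapD(1)[OF patterned_vertex_map]

definition embed :: "((nat \<Rightarrow> bool) \<Rightarrow> (nat \<Rightarrow> bool)) \<Rightarrow> ('v \<rightharpoonup> 'v) set" where
  "embed g = germ (vertex_map g)"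

text \<open>The vertex map of a composite extends the composite of the vertex maps, so their germs coincide.\<close>

lemma embed_hom: "embed \<in> hom thompson_V G"
proof (rule homI)
  show "embed g \<in> carrier G" if "g \<in> carrier thompson_V" for g
    using that germ_in_carrier patterned_vertex_map by (simp add: embed_def thompson_V_iff)
  fix g h assume gh: "g \<in> carrier thompson_V" "h \<in> carrier thompson_V"
  then have p: "prefix_replacing g" "prefix_replacing h" "prefix_replacing (g \<circ> h)"
    using prefix_replacing_comp by (simp_all add: thompson_V_iff)
  note iso = almost_iso_vertex_map[OF p(1)] almost_iso_vertex_map[OF p(2)] almost_iso_vertex_map[OF p(3)]
  note isoc = almost_iso_comp[OF iso(2,1)]
  obtain n where n: "{v \<in> verts T. n \<le> depth v} \<subseteq> dom (vertex_map g \<circ>\<^sub>m vertex_map h)"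
    using cofinite_forest_contains_deep[OF almost_isoD(1)[OF isoc]] .
  have "almost_eq (vertex_map (g \<circ> h)) (vertex_map g \<circ>\<^sub>m vertex_map h)"
  proof (rule almost_eq_if_deep[OF iso(3) isoc])
    fix v assume "v \<in> verts T" "n \<le> depth v"
    then obtain w where w: "(vertex_map g \<circ>\<^sub>m vertex_map h) v = Some w" using n by blast
    then obtain u where "vertex_map h v = Some u" "vertex_map g u = Some w"
      by (auto simp: map_comp_def split: option.splits)
    then have "vertex_map (g \<circ> h) v = Some w" using matches_comp by (simp add: vertex_map_iff)
    then show "vertex_map (g \<circ> h) v = (vertex_map g \<circ>\<^sub>m vertex_map h) v" using w by simp
  qed
  then show "embed (g \<otimes>\<^bsub>thompson_V\<^esub> h) = embed g \<otimes>\<^bsub>G\<^esub> embed h"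
    using mult_thompson_V[OF gh] germ_mult_pat[OF iso(2,1)] germ_eq_iff[OF iso(3) isoc]
    by (simp add: embed_def)
qed

text \<open>Each infinite word passes through deep vertices, and \<open>g\<close> is determined by where these go.\<close>

lemma embed_inj: "inj_on embed (carrier thompson_V)"
proof (rule inj_onI)
  fix g h assume gh: "g \<in> carrier thompson_V" "h \<in> carrier thompson_V" "embed g = embed h"
  then have p: "prefix_replacing g" "prefix_replacing h" by (simp_all add: thompson_V_iff)
  note iso = almost_iso_vertex_map[OF p(1)] almost_iso_vertex_map[OF p(2)]
  have "almost_eq (vertex_map g) (vertex_map h)"
    using gh(3) germ_eq_iff[OF iso] by (simp add: embed_def)
  then obtain n where n: "\<And>v. n \<le> depth v \<Longrightarrow> vertex_map g v = vertex_map h v"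
    using almost_eq_deep by blast
  obtain m where m: "{v \<in> verts T. m \<le> depth v} \<subseteq> dom (vertex_map g)"
    using cofinite_forest_contains_deep[OF almost_isoD(1)[OF iso(1)]] .
  show "g = h"
  proof
    fix x
    obtain v where v: "v \<in> verts T" "depth v = max n m" "x \<in> cylinder (word v)"
      using ex1_implies_ex[OF level_cylinder, of "max n m" x] by blast
    have "v \<in> dom (vertex_map g)" using m v by auto
    then obtain w where "vertex_map g v = Some w" by blast
    moreover have "vertex_map h v = vertex_map g v" using n[of v] v by simp
    ultimately have "matches g v w" "matches h v w" by (simp_all flip: vertex_map_iff)
    moreover obtain y where "x = word v \<frown> y" using v(3) unfolding mem_cylinder_iff by blast
    ultimately show "g x = h x" by (simp add: matches_def)
  qed
qed

text \<open>The words of level \<open>n\<close> are the source partition. Their images under \<open>\<phi>\<close> are the roots of the forest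
\<open>F\<close> onto which \<open>\<phi>\<close> maps the part from depth \<open>n\<close> on, so their words are a partition by \<open>roots_cylinder\<close>.\<close>

lemma level_realised:
  assumes \<phi>: "patterned_map \<phi>" and n: "{v \<in> verts T. n \<le> depth v} \<subseteq> dom \<phi>"
  obtains g where "g \<in> carrier thompson_V" "\<And>v. v \<in> verts T \<Longrightarrow> depth v = n \<Longrightarrow> vertex_map g v = \<phi> v"
proof -
  note iso = patterned_mapD(1)[OF \<phi>]
  let ?L = "{v \<in> verts T. depth v = n}"
  define f where "f v = the (\<phi> v)" for v
  have f: "\<phi> v = Some (f v)" if "v \<in> ?L" for v using n that by (force simp: f_def)
  define top where "top x = (THE v. v \<in> ?L \<and> x \<in> cylinder (word v))" for x
  have top_unique: "\<exists>!v. v \<in> ?L \<and> x \<in> cylinder (word v)" for x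
    using level_cylinder[of n x] by (simp add: conj_assoc)
  have topI: "top x = v" if "v \<in> ?L" "x \<in> cylinder (word v)" for x v
    unfolding top_def using the1_equality[OF top_unique] that by blast
  define g where "g x = word (f (top x)) \<frown> (\<lambda>i. x (i + length (word (top x))))" for x
  have g: "g (word v \<frown> y) = word (f v) \<frown> y" if "v \<in> ?L" for v y
  proof -
    have "top (word v \<frown> y) = v" using topI[OF that conc_in_cylinder] .
    then show ?thesis by (simp add: g_def conc_def)
  qed
  have split: "\<exists>v y. v \<in> ?L \<and> x = word v \<frown> y" for x
    using top_unique[of x] unfolding mem_cylinder_iff by blast
  define F where "F = ran (\<phi> |` {v \<in> verts T. n \<le> depth v})"
  have isoF: "almost_iso (\<phi> |` {v \<in> verts T. n \<le> depth v})"
    using almost_iso_restrict[OF iso cofinite_forest_deep] .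
  have F: "cofinite_forest F" unfolding F_def using almost_isoD(2)[OF isoF] .
  have F_iff: "w \<in> F \<longleftrightarrow> (\<exists>v\<in>verts T. n \<le> depth v \<and> \<phi> v = Some w)" for w
    unfolding F_def ran_def restrict_map_def by auto
  have rootI: "f v \<in> roots F" if v: "v \<in> ?L" for v
    unfolding roots_def
  proof (intro CollectI conjI allI impI)
    show "f v \<in> F" using f[OF v] v unfolding F_iff by auto
    fix u' assume e: "(u', f v) \<in> edges T"
    show "u' \<notin> F"
    proof
      assume "u' \<in> F"
      then obtain u where u: "n \<le> depth u" "\<phi> u = Some u'" unfolding F_iff by blast
      then have "(u, v) \<in> edges T" using almost_iso_edge[OF iso u(2) f[OF v]] e by blast
      then show False using depth_edge u v by fastforce
    qed
  qed
  have rootE: "\<exists>v\<in>?L. w = f v" if w: "w \<in> roots F" for w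
  proof -
    obtain v where v: "v \<in> verts T" "n \<le> depth v" "\<phi> v = Some w"
      using w unfolding roots_def F_iff by blast
    have "depth v = n"
    proof (rule ccontr)
      assume ne: "depth v \<noteq> n"
      then have "v \<noteq> base T" using v depth_base by auto
      then obtain u where e: "(u, v) \<in> edges T" using parent_ex v by blast
      then have u: "u \<in> verts T" "n \<le> depth u" using edge_verts depth_edge[OF e] v ne by auto
      then obtain u' where u': "\<phi> u = Some u'" using n by blast
      then have "(u', w) \<in> edges T" using almost_iso_edge[OF iso u' v(3)] e by blast
      then show False using w u u' unfolding roots_def F_iff by blast
    qed
    then show ?thesis using v f[of v] by auto
  qed
  have "inj g"
  proof (rule injI)
    fix x x' assume eq: "g x = g x'"
    obtain v y where x: "v \<in> ?L" "x = word v \<frown> y" using split by blast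
    obtain v' y' where x': "v' \<in> ?L" "x' = word v' \<frown> y'" using split by blast
    have gx: "g x = word (f v) \<frown> y" "g x' = word (f v') \<frown> y'" using g x x' by simp_all
    have "f v \<in> roots F \<and> g x \<in> cylinder (word (f v))" "f v' \<in> roots F \<and> g x \<in> cylinder (word (f v'))"
      using rootI[OF x(1)] rootI[OF x'(1)] gx eq conc_in_cylinder by metis+
    then have ff: "f v = f v'" using roots_cylinder[OF F] by blast
    then have "v = v'" using almost_iso_inj[OF iso] f x(1) x'(1) by metis
    moreover have "y = y'" using eq gx ff by simp
    ultimately show "x = x'" using x x' by simp
  qed
  moreover have "surj g"
    unfolding surj_def
  proof
    fix x
    obtain w where "w \<in> roots F" "x \<in> cylinder (word w)" using roots_cylinder[OF F, of x] by blast
    then obtain v y where "v \<in> ?L" "x = word (f v) \<frown> y" using rootE unfolding mem_cylinder_iff by blast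
    then have "x = g (word v \<frown> y)" using g by simp
    then show "\<exists>z. x = g z" by blast
  qed
  ultimately have "bij g" by (rule bijI)
  moreover have "\<exists>k. \<forall>u. length u = k \<longrightarrow> (\<exists>w. \<forall>y. g (u \<frown> y) = w \<frown> y)"
  proof -
    have fin: "finite ((length \<circ> word) ` ?L)" using finite_level by blast
    have "\<exists>w. \<forall>y. g (u \<frown> y) = w \<frown> y" if u: "length u = Max ((length \<circ> word) ` ?L)" for u
    proof -
      obtain v y0 where v: "v \<in> ?L" "u \<frown> (\<lambda>_. False) = word v \<frown> y0" using split by blast
      have "length (word v) \<le> length u" using Max_ge[OF fin, of "length (word v)"] v(1) u by force
      then obtain z where "u = word v @ z" using conc_eq_compare[OF v(2)[symmetric]] by blast
      then have "g (u \<frown> y) = (word (f v) @ z) \<frown> y" for y using g[OF v(1), of "z \<frown> y"] by simp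
      then show ?thesis by blast
    qed
    then show ?thesis by blast
  qed
  ultimately have "prefix_replacing g" unfolding prefix_replacing_def by blast
  moreover have "vertex_map g v = \<phi> v" if v: "v \<in> verts T" "depth v = n" for v
  proof -
    have fv: "\<phi> v = Some (f v)" using f v by simp
    have "matches g v (f v)"
      unfolding matches_def
      using patterned_mapD(2,3,5)[OF \<phi> fv] almost_iso_verts[OF iso fv] g[of v] v by simp
    then show ?thesis using fv by (simp add: vertex_map_iff[symmetric])
  qed
  ultimately show thesis using that by (simp add: thompson_V_iff)
qed

text \<open>A map that keeps colours is determined below level \<open>n\<close> by its values on that level.\<close>

lemma colour_preserving_germ_realised:
  assumes \<phi>: "patterned_map \<phi>" and n: "{v \<in> verts T. n \<le> depth v} \<subseteq> dom \<phi>"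
    and col: "\<And>u v. (u, v) \<in> edges T \<Longrightarrow> n \<le> depth u \<Longrightarrow> ccol P (the (\<phi> u), the (\<phi> v)) = ccol P (u, v)"
  obtains g where "g \<in> carrier thompson_V" "embed g = germ \<phi>"
proof -
  note iso = patterned_mapD(1)[OF \<phi>]
  obtain g where g: "g \<in> carrier thompson_V" "\<And>v. v \<in> verts T \<Longrightarrow> depth v = n \<Longrightarrow> vertex_map g v = \<phi> v"
    using level_realised[OF \<phi> n] by blast
  have isog: "almost_iso (vertex_map g)" using almost_iso_vertex_map g by (simp add: thompson_V_iff)
  have eq: "n \<le> depth v \<longrightarrow> vertex_map g v = \<phi> v" if "v \<in> verts T" for v
    using that
  proof (induction rule: tree_induct)
    case base
    then show ?case using g(2) base_in depth_base by simp
  next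
    case (child u v)
    show ?case
    proof (cases "n \<le> depth u")
      case True
      then obtain u' where u': "\<phi> u = Some u'" using n child by blast
      then have m: "matches g u u'" using child True by (simp add: vertex_map_iff[symmetric])
      have "v \<in> children T u" using child(2) by (simp add: children_def)
      then obtain w where w: "w \<in> children T u'" "matches g v w" "ccol P (u', w) = ccol P (u, v)"
        by (rule matches_child[OF m])
      obtain v' where v': "\<phi> v = Some v'" "(u', v') \<in> edges T" using almost_iso_child[OF iso u' child(2)] .
      have "ccol P (u', v') = ccol P (u, v)" using col[OF child(2) True] u' v' by simp
      then have "w = v'"
        using colour_inj[of u' w v'] w v' almost_iso_verts[OF iso u'] patterned_mapD(3)[OF \<phi> u']
        by (simp add: children_def)
      then show ?thesis using w(2) v' by (simp add: vertex_map_iff[symmetric])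
    next
      case False
      then have "n \<le> depth v \<Longrightarrow> depth v = n" using depth_edge[OF child(2)] by simp
      then show ?thesis using g(2) edge_verts[OF child(2)] by blast
    qed
  qed
  have "almost_eq (vertex_map g) \<phi>" by (rule almost_eq_if_deep[OF isog iso]) (use eq in blast)
  then have "embed g = germ \<phi>" using germ_eq_iff[OF isog iso] by (simp add: embed_def)
  then show thesis using that g by blast
qed

text \<open>Given a patterned map \<open>\<phi>\<close>, realise it on level \<open>N\<close> by an element \<open>g\<close> of \<open>V\<close>. Then \<open>\<phi>\<inverse>g\<close> fixes level
\<open>N\<close>, so \<open>g\<close> lies in \<open>\<phi> W\<^sub>N\<close>.\<close>

theorem embed_dense: "(filtration_topology G stab_germs) closure_of (embed ` carrier thompson_V) = carrier G"
proof
  let ?\<tau> = "filtration_topology G stab_germs"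
  show "?\<tau> closure_of (embed ` carrier thompson_V) \<subseteq> carrier G"
    using closure_of_subset_topspace topspace_filtration_topology by metis
  show "carrier G \<subseteq> ?\<tau> closure_of (embed ` carrier thompson_V)"
  proof
    fix x assume x: "x \<in> carrier G"
    then obtain \<phi> where \<phi>: "patterned_map \<phi>" "x = germ \<phi>" by (auto simp: carrier_AAut_pat)
    note iso = patterned_mapD(1)[OF \<phi>(1)]
    have "\<exists>y. y \<in> embed ` carrier thompson_V \<and> y \<in> B" if B: "x \<in> B" "openin ?\<tau> B" for B
    proof -
      obtain n where n: "\<forall>u\<in>stab_germs n. x \<otimes>\<^bsub>G\<^esub> u \<in> B"
        using B unfolding openin_filtration_topology by blast
      obtain m where m: "{v \<in> verts T. m \<le> depth v} \<subseteq> dom \<phi>"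
        using cofinite_forest_contains_deep[OF almost_isoD(1)[OF iso]] .
      define N where "N = max n m"
      have N: "{v \<in> verts T. N \<le> depth v} \<subseteq> dom \<phi>" using m by (auto simp: N_def)
      obtain g where g: "g \<in> carrier thompson_V"
          "\<And>v. v \<in> verts T \<Longrightarrow> depth v = N \<Longrightarrow> vertex_map g v = \<phi> v"
        using level_realised[OF \<phi>(1) N] by blast
      have pg: "patterned_map (vertex_map g)" using patterned_vertex_map g by (simp add: thompson_V_iff)
      note isog = patterned_mapD(1)[OF pg]
      \<comment> \<open>The correction \<open>\<phi>\<inverse>g\<close>, a small element.\<close>
      let ?\<theta> = "inv_map \<phi> \<circ>\<^sub>m vertex_map g"
      have p\<theta>: "patterned_map ?\<theta>" using patterned_map_comp[OF pg patterned_map_inv[OF \<phi>(1)]] .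
      have path: "N \<le> depth v \<longrightarrow> (\<exists>w u. vertex_map g v = Some w \<and> \<phi> u = Some w)" if "v \<in> verts T" for v
        using that
      proof (induction rule: tree_induct)
        case base
        show ?case
        proof
          assume "N \<le> depth (base T)"
          then have "depth (base T) = N" "base T \<in> dom \<phi>" using N base_in depth_base by auto
          then show "\<exists>w u. vertex_map g (base T) = Some w \<and> \<phi> u = Some w" using g(2)[OF base_in] by auto
        qed
      next
        case (child u v)
        show ?case
        proof (cases "N \<le> depth u")
          case True
          then obtain w t where w: "vertex_map g u = Some w" "\<phi> t = Some w" using child by blast
          obtain w' where w': "vertex_map g v = Some w'" "(w, w') \<in> edges T"
            using almost_iso_child[OF isog w(1) child(2)] .
          obtain t' where "\<phi> t' = Some w'" using almost_iso_child_inv[OF iso w(2) w'(2)] .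
          then show ?thesis using w' by blast
        next
          case False
          have "vertex_map g v = \<phi> v" "v \<in> dom \<phi>" if "N \<le> depth v"
          proof -
            have "depth v = N" using that False depth_edge[OF child(2)] by simp
            then show "vertex_map g v = \<phi> v" "v \<in> dom \<phi>" using g(2) N edge_verts[OF child(2)] by auto
          qed
          then show ?thesis by fastforce
        qed
      qed
      have "level_fixing N ?\<theta>"
        unfolding level_fixing_def
      proof (intro conjI ballI impI)
        show "almost_iso ?\<theta>" by (rule patterned_mapD(1)[OF p\<theta>])
        fix v assume v: "v \<in> verts T"
        show "?\<theta> v = Some v" if "depth v = N"
        proof -
          have "v \<in> dom \<phi>" using N v that by auto
          then obtain w where w: "\<phi> v = Some w" by blast
          then have "inv_map \<phi> w = Some v" using inv_map_iff[OF iso] by simp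
          then show ?thesis using w g(2)[OF v that] by (simp add: map_comp_def)
        qed
        assume "N \<le> depth v"
        then obtain w u where w: "vertex_map g v = Some w" "\<phi> u = Some w" using path[OF v] by blast
        have "inv_map \<phi> w = Some u" using w(2) inv_map_iff[OF iso] by simp
        then have "?\<theta> v = Some u" using w by (simp add: map_comp_def)
        then show "v \<in> dom ?\<theta>" "locally_patterned (the \<circ> ?\<theta>) v" using patterned_mapD(4)[OF p\<theta>] by blast+
      qed
      then have "germ ?\<theta> \<in> stab_germs N" unfolding stab_germs_eq by blast
      then have "germ ?\<theta> \<in> stab_germs n" using W_antimono[of n N] by (auto simp: N_def)
      then have "x \<otimes>\<^bsub>G\<^esub> germ ?\<theta> \<in> B" using n by blast
      moreover have "x \<otimes>\<^bsub>G\<^esub> germ ?\<theta> = embed g"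
      proof -
        note iso\<theta> = patterned_mapD(1)[OF p\<theta>]
        have "almost_eq (\<phi> \<circ>\<^sub>m ?\<theta>) (vertex_map g)"
        proof (rule almost_eq_if_deep[OF almost_iso_comp[OF iso\<theta> iso] isog])
          fix v assume "v \<in> verts T" "N \<le> depth v"
          then obtain w u where w: "vertex_map g v = Some w" "\<phi> u = Some w" using path by blast
          have "inv_map \<phi> w = Some u" using w(2) inv_map_iff[OF iso] by simp
          then show "(\<phi> \<circ>\<^sub>m ?\<theta>) v = vertex_map g v" using w by (simp add: map_comp_def)
        qed
        then show ?thesis
          using germ_eq_iff[OF almost_iso_comp[OF iso\<theta> iso] isog] germ_mult_pat[OF iso\<theta> iso] \<phi>(2)
          by (simp add: embed_def)
      qed
      ultimately show ?thesis using g by (metis imageI)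
    qed
    then show "x \<in> ?\<tau> closure_of (embed ` carrier thompson_V)"
      using x topspace_filtration_topology by (auto simp: in_closure_of)
  qed
qed

theorem thompson_V_embeds_densely:
  "embeds_densely thompson_V G (AAut_pat_topology T P)"
  unfolding embeds_densely_def AAut_pat_topology_eq
  using embed_hom embed_inj embed_dense by blast

end

section \<open>Binary words cut into tokens\<close>

text \<open>Tokens are numbered: \<open>t < m\<close> spells \<open>1\<^sup>t0\<close> and \<open>m\<close> spells \<open>1\<^sup>m\<close>, both available at label \<open>0\<close>, while \<open>m + 1\<close> and
\<open>m + 2\<close> spell \<open>0\<close> and \<open>1\<close> at label \<open>1\<close>. As no token is shared between the labels and each token
determines the label that it leads to, the tokens serve as edge colours.\<close>

definition tokens :: "nat \<Rightarrow> nat \<Rightarrow> nat set" where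
  "tokens m l = (if l = 0 then {0..m} else {m + 1, m + 2})"

text \<open>The last letter of the spelling of \<open>t\<close>.\<close>

definition tok_type :: "nat \<Rightarrow> nat \<Rightarrow> nat" where
  "tok_type m t = (if t < m \<or> t = m + 1 then 0 else 1)"

text \<open>The argument \<open>l\<close> is the label at which the sequence starts.\<close>

fun valid :: "nat \<Rightarrow> nat \<Rightarrow> nat list \<Rightarrow> bool" where
  "valid m l [] \<longleftrightarrow> True"
| "valid m l (t # ts) \<longleftrightarrow> t \<in> tokens m l \<and> valid m (tok_type m t) ts"

fun end_type :: "nat \<Rightarrow> nat \<Rightarrow> nat list \<Rightarrow> nat" where
  "end_type m l [] = l"
| "end_type m l (t # ts) = end_type m (tok_type m t) ts"

definition bits :: "nat \<Rightarrow> nat \<Rightarrow> bool list" where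
  "bits m t = (if t < m then replicate t True @ [False]
     else if t = m then replicate m True else if t = m + 1 then [False] else [True])"

definition spell :: "nat \<Rightarrow> nat list \<Rightarrow> bool list" where
  "spell m ts = concat (map (bits m) ts)"

lemma valid_append: "valid m l (xs @ ys) \<longleftrightarrow> valid m l xs \<and> valid m (end_type m l xs) ys"
  by (induction xs arbitrary: l) auto

lemma end_type_append: "end_type m l (xs @ ys) = end_type m (end_type m l xs) ys"
  by (induction xs arbitrary: l) auto

lemma end_type_snoc: "end_type m l (xs @ [t]) = tok_type m t"
  by (simp add: end_type_append)

lemma end_type_cases: "l \<in> {0, 1} \<Longrightarrow> end_type m l xs \<in> {0, 1}"
  by (induction xs arbitrary: l) (auto simp: tok_type_def)

lemma tok_type_cases: "tok_type m t \<in> {0, 1}"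
  by (simp add: tok_type_def)

lemma spell_snoc: "spell m (xs @ [t]) = spell m xs @ bits m t"
  by (simp add: spell_def)

lemma bits_nonempty: "0 < m \<Longrightarrow> bits m t \<noteq> []"
  by (simp add: bits_def)

text \<open>The words of vertices with label \<open>l\<close>, recognisable from their last \<open>m\<close> letters.\<close>

definition spelled :: "nat \<Rightarrow> nat \<Rightarrow> bool list \<Rightarrow> bool" where
  "spelled m l s \<longleftrightarrow> l = 0 \<and> (s = [] \<or> \<not> last s) \<or> l = 1 \<and> (\<exists>s'. s = s' @ replicate m True)"

text \<open>The only delicate token is \<open>m + 2\<close>: it appends a \<open>1\<close> to a word that already ends in \<open>1\<^sup>m\<close>.\<close>

lemma spelled_spell: "valid m 0 ts \<Longrightarrow> 0 < m \<Longrightarrow> spelled m (end_type m 0 ts) (spell m ts)"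
proof (induction ts rule: rev_induct)
  case Nil
  then show ?case by (simp add: spelled_def spell_def)
next
  case (snoc t ts)
  then have t: "t \<in> tokens m (end_type m 0 ts)" and IH: "spelled m (end_type m 0 ts) (spell m ts)"
    by (simp_all add: valid_append)
  show ?case
  proof (cases "t = m + 2")
    case True
    then have "end_type m 0 ts \<noteq> 0" using t by (cases "end_type m 0 ts = 0") (simp_all add: tokens_def)
    then obtain s where "spell m ts = s @ replicate m True" using IH by (auto simp: spelled_def)
    then have "spell m (ts @ [t]) = (s @ [True]) @ replicate m True"
      using True by (simp add: spell_snoc bits_def replicate_append_same)
    then show ?thesis using True by (auto simp: spelled_def end_type_snoc tok_type_def)
  next
    case False
    then have "t \<le> m + 1" using t by (auto simp: tokens_def split: if_splits)
    then show ?thesis by (auto simp: spelled_def end_type_snoc tok_type_def spell_snoc bits_def)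
  qed
qed

lemma split_trailing_ones:
  obtains s' r where "s = s' @ replicate r True" "s' = [] \<or> \<not> last s'"
proof -
  have "\<exists>s' r. s = s' @ replicate r True \<and> (s' = [] \<or> \<not> last s')"
  proof (induction s rule: rev_induct)
    case Nil
    show ?case by (intro exI[of _ "[]"] exI[of _ 0]) simp
  next
    case (snoc b s)
    then obtain s' r where s: "s = s' @ replicate r True" "s' = [] \<or> \<not> last s'" by blast
    show ?case
    proof (cases b)
      case True
      then show ?thesis using s
        by (intro exI[of _ s'] exI[of _ "Suc r"]) (simp add: replicate_append_same)
    next
      case False
      then show ?thesis by (intro exI[of _ "s @ [b]"] exI[of _ 0]) simp
    qed
  qed
  then show thesis using that by blast
qed

text \<open>The run of ones before the last token decides which token it is: a word \<open>s\<^sub>1 1\<^sup>r 0\<close> ends in the token \<open>r\<close> if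
\<open>r < m\<close> and in the token \<open>m + 1\<close> otherwise; a word \<open>s\<^sub>1 1\<^sup>r 1\<^sup>m\<close> ends in the token \<open>m\<close> if \<open>r = 0\<close> and in the token
\<open>m + 2\<close> otherwise.\<close>

lemma spelled_imp_spell:
  assumes m: "0 < m"
  shows "spelled m l s \<Longrightarrow> \<exists>ts. valid m 0 ts \<and> end_type m 0 ts = l \<and> spell m ts = s"
proof (induction "length s" arbitrary: s l rule: less_induct)
  case less
  have extend: "\<exists>ts. valid m 0 ts \<and> end_type m 0 ts = tok_type m t \<and> spell m ts = s"
    if s: "spelled m k s0" "s = s0 @ bits m t" "t \<in> tokens m k" for k s0 t
  proof -
    have "length s0 < length s" using s(2) bits_nonempty[OF m] by simp
    then obtain ts where "valid m 0 ts" "end_type m 0 ts = k" "spell m ts = s0" using less(1) s(1) by blast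
    then show ?thesis
      using s by (intro exI[of _ "ts @ [t]"]) (simp add: valid_append end_type_snoc spell_snoc)
  qed
  show ?case
  proof (cases "l = 0")
    case True
    show ?thesis
    proof (cases "s = []")
      case True
      then show ?thesis using \<open>l = 0\<close> by (intro exI[of _ "[]"]) (simp add: spell_def)
    next
      case False
      then have "\<not> last s" using less(2) True by (simp add: spelled_def)
      then obtain s0 where s0: "s = s0 @ [False]" using False by (metis append_butlast_last_id)
      obtain s1 r where s1: "s0 = s1 @ replicate r True" "s1 = [] \<or> \<not> last s1"
        by (rule split_trailing_ones)
      show ?thesis
      proof (cases "r < m")
        case r: True
        have "spelled m 0 s1" using s1 by (simp add: spelled_def)
        then show ?thesis
          using extend[of 0 s1 r] s0 s1 r True by (simp add: bits_def tokens_def tok_type_def)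
      next
        case False
        then have "s0 = (s1 @ replicate (r - m) True) @ replicate m True"
          using s1 by (simp flip: replicate_add)
        then have "spelled m 1 s0" by (auto simp: spelled_def)
        then show ?thesis
          using extend[of 1 s0 "m + 1"] s0 True by (simp add: bits_def tokens_def tok_type_def)
      qed
    qed
  next
    case False
    then obtain s' where l: "l = 1" and s': "s = s' @ replicate m True" using less(2) by (auto simp: spelled_def)
    obtain s1 r where s1: "s' = s1 @ replicate r True" "s1 = [] \<or> \<not> last s1"
      by (rule split_trailing_ones)
    show ?thesis
    proof (cases "r = 0")
      case True
      have "spelled m 0 s1" using s1 by (simp add: spelled_def)
      then show ?thesis
        using extend[of 0 s1 m] s' s1 True l by (simp add: bits_def tokens_def tok_type_def)
    next
      case False
      let ?s0 = "(s1 @ replicate (r - 1) True) @ replicate m True"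
      have "replicate r True = replicate (r - 1) True @ [True]"
        using False by (cases r) (simp_all add: replicate_append_same)
      then have "s = ?s0 @ [True]" using s' s1 by (simp add: replicate_append_same)
      moreover have "spelled m 1 ?s0" unfolding spelled_def by blast
      ultimately show ?thesis
        using extend[of 1 ?s0 "m + 2"] l by (simp add: bits_def tokens_def tok_type_def)
    qed
  qed
qed

lemma spelled_tail:
  assumes "spelled m l (s @ z)" "m \<le> length z" "0 < m" shows "spelled m l (s' @ z)"
proof -
  have z: "z \<noteq> []" using assms by auto
  have "\<exists>s''. s' @ z = s'' @ replicate m True" if "s @ z = s1 @ replicate m True" for s1
  proof -
    have len: "length s + length z = length s1 + m" using arg_cong[OF that, of length] by simp
    have "drop (length s1) (s @ z) = replicate m True" using that by simp
    moreover have "length s1 = length s + (length z - m)" using len assms(2) by simp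
    ultimately have "drop (length z - m) z = replicate m True" by simp
    then have "s' @ z = (s' @ take (length z - m) z) @ replicate m True"
      by (metis append.assoc append_take_drop_id)
    then show ?thesis by blast
  qed
  then show ?thesis using assms(1) z by (auto simp: spelled_def)
qed

lemma cylinder_nth: "y \<in> cylinder u \<longleftrightarrow> (\<forall>i<length u. y i = u ! i)"
proof
  assume "\<forall>i<length u. y i = u ! i"
  then have "y = u \<frown> (\<lambda>i. y (i + length u))" by (auto simp: conc_def fun_eq_iff)
  then show "y \<in> cylinder u" unfolding mem_cylinder_iff by blast
qed (auto simp: mem_cylinder_iff)

text \<open>At label \<open>0\<close> the position of the first zero of \<open>y\<close>, cut off at \<open>m\<close>, is the token.\<close>

lemma token_unique:
  assumes m: "0 < m" and l: "l \<in> {0, 1}"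
  shows "\<exists>!t. t \<in> tokens m l \<and> y \<in> cylinder (bits m t)"
proof (cases "l = 0")
  case True
  have short: "y \<in> cylinder (bits m t) \<longleftrightarrow> (\<forall>i<t. y i) \<and> \<not> y t" if "t < m" for t
    using that by (auto simp: cylinder_nth bits_def nth_append less_Suc_eq)
  have long: "y \<in> cylinder (bits m m) \<longleftrightarrow> (\<forall>i<m. y i)"
    by (auto simp: cylinder_nth bits_def)
  show ?thesis
  proof (cases "\<forall>i<m. y i")
    case all: True
    show ?thesis
    proof (rule ex1I[of _ m])
      show "m \<in> tokens m l \<and> y \<in> cylinder (bits m m)" using all long True by (simp add: tokens_def)
      fix t assume t: "t \<in> tokens m l \<and> y \<in> cylinder (bits m t)"
      then show "t = m" using all short[of t] True by (cases "t < m") (auto simp: tokens_def)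
    qed
  next
    case False
    then obtain i where i: "i < m" "\<not> y i" by blast
    define t where "t = (LEAST i. \<not> y i)"
    have t: "\<not> y t" "t \<le> i" "\<And>j. j < t \<Longrightarrow> y j"
      unfolding t_def using i(2) LeastI[of "\<lambda>i. \<not> y i" i] Least_le[of "\<lambda>i. \<not> y i" i] not_less_Least by blast+
    show ?thesis
    proof (rule ex1I[of _ t])
      show "t \<in> tokens m l \<and> y \<in> cylinder (bits m t)" using t i short[of t] True by (simp add: tokens_def)
      fix t' assume t': "t' \<in> tokens m l \<and> y \<in> cylinder (bits m t')"
      have "t' < m" using t' False long True by (cases "t' = m") (auto simp: tokens_def)
      then have "(\<forall>j<t'. y j) \<and> \<not> y t'" using t' short by blast
      then show "t' = t" using t by (meson linorder_neqE_nat)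
    qed
  qed
next
  case False
  have "y \<in> cylinder (bits m (m + 1)) \<longleftrightarrow> \<not> y 0" "y \<in> cylinder (bits m (m + 2)) \<longleftrightarrow> y 0"
    by (auto simp: cylinder_nth bits_def)
  then show ?thesis
    using False by (cases "y 0") (auto simp: tokens_def)
qed

section \<open>The tree with cyclic local groups\<close>

text \<open>Vertices are codes of valid token sequences. The code of the empty sequence is \<open>0\<close>.\<close>

definition cyc_tree :: "nat \<Rightarrow> nat rooted_tree" where
  "cyc_tree m = \<lparr>verts = {v. valid m 0 (list_decode v)},
     edges = {(u, v). valid m 0 (list_decode v) \<and> (\<exists>t. list_decode v = list_decode u @ [t])}, base = 0\<rparr>"

text \<open>Rotation by \<open>j\<close> of the colours \<open>0, \<dots>, m - 1\<close>, which lead to children with label \<open>0\<close>. The colour \<open>m\<close>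
leads to the child with label \<open>1\<close> and has to be fixed.\<close>

definition rot :: "nat \<Rightarrow> nat \<Rightarrow> nat \<Rightarrow> nat" where
  "rot m j = (\<lambda>t\<in>{0..m}. if t < m then (t + j) mod m else t)"

text \<open>The root counts as a vertex of label \<open>0\<close>, as the empty word is continued by the same tokens as a
word that ends in \<open>0\<close>.\<close>

definition vtype :: "nat \<Rightarrow> nat \<Rightarrow> nat" where
  "vtype m v = end_type m 0 (list_decode v)"

definition cyc_pat :: "nat \<Rightarrow> (nat, nat, nat) patterning" where
  "cyc_pat m = \<lparr>labels = {0, 1}, lab = vtype m, cols = (\<lambda>l l'. {t \<in> tokens m l. tok_type m t = l'}),
     ccol = (\<lambda>e. last (list_decode (snd e))),
     perms = (\<lambda>l. if l = 0 then range (rot m) else {\<lambda>t\<in>{m + 1, m + 2}. t})\<rparr>"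

definition vdepth :: "nat \<Rightarrow> nat" where
  "vdepth v = length (list_decode v)"

definition vword :: "nat \<Rightarrow> nat \<Rightarrow> bool list" where
  "vword m v = spell m (list_decode v)"

locale cyclic_tree =
  fixes m :: nat
  assumes m2: "2 \<le> m"
begin

abbreviation "T \<equiv> cyc_tree m"
abbreviation "P \<equiv> cyc_pat m"

lemma m0: "0 < m" using m2 by simp

lemma verts_iff: "v \<in> verts T \<longleftrightarrow> valid m 0 (list_decode v)"
  by (simp add: cyc_tree_def)

lemma edges_iff: "(u, v) \<in> edges T \<longleftrightarrow>
    valid m 0 (list_decode v) \<and> (\<exists>t. list_decode v = list_decode u @ [t])"
  by (simp add: cyc_tree_def)

lemma base_eq: "base T = 0"
  by (simp add: cyc_tree_def)

lemma decode_empty: "list_decode v = [] \<longleftrightarrow> v = 0"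
  by (metis list_decode.simps(1) list_decode_inverse)

lemma children_eq:
  assumes "v \<in> verts T"
  shows "children T v = (\<lambda>t. list_encode (list_decode v @ [t])) ` tokens m (vtype m v)"
proof (intro equalityI subsetI)
  fix c assume "c \<in> children T v"
  then obtain t where t: "valid m 0 (list_decode c)" "list_decode c = list_decode v @ [t]"
    by (auto simp: children_def edges_iff)
  then have "t \<in> tokens m (vtype m v)" by (simp add: valid_append vtype_def)
  moreover have "c = list_encode (list_decode v @ [t])" using t(2) by (metis list_decode_inverse)
  ultimately show "c \<in> (\<lambda>t. list_encode (list_decode v @ [t])) ` tokens m (vtype m v)" by blast
next
  fix c assume "c \<in> (\<lambda>t. list_encode (list_decode v @ [t])) ` tokens m (vtype m v)"
  then show "c \<in> children T v"
    using assms by (auto simp: children_def edges_iff verts_iff valid_append vtype_def)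
qed

lemma finite_tokens: "finite (tokens m l)"
  by (simp add: tokens_def)

lemma token_of_type: "l' \<in> {0, 1} \<Longrightarrow> \<exists>t\<in>tokens m l. tok_type m t = l'"
  using m0 by (cases "l = 0") (auto simp: tokens_def tok_type_def)

lemma two_tokens: "\<exists>s\<in>tokens m l. \<exists>t\<in>tokens m l. s \<noteq> t"
proof -
  have "(if l = 0 then 0 else m + 1) \<in> tokens m l" "(if l = 0 then m else m + 2) \<in> tokens m l"
      "(if l = 0 then 0 else m + 1) \<noteq> (if l = 0 then m else m + 2)"
    using m0 by (simp_all add: tokens_def)
  then show ?thesis by blast
qed

lemma leafless: "leafless_tree T vdepth"
proof
  show "base T \<in> verts T" by (simp add: base_eq verts_iff)
  show "u \<in> verts T \<and> v \<in> verts T" if "(u, v) \<in> edges T" for u v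
    using that by (auto simp: edges_iff verts_iff valid_append)
  show "vdepth (base T) = 0" by (simp add: base_eq vdepth_def)
  show "vdepth v = Suc (vdepth u)" if "(u, v) \<in> edges T" for u v
    using that by (auto simp: edges_iff vdepth_def)
  show "u = v" if "(u, w) \<in> edges T" "(v, w) \<in> edges T" for u v w
    using that by (auto simp: edges_iff list_decode_eq)
  show "\<exists>u. (u, v) \<in> edges T" if v: "v \<in> verts T" "v \<noteq> base T" for v
  proof -
    have "list_decode v \<noteq> []" using v(2) by (simp add: base_eq decode_empty)
    then obtain xs t where "list_decode v = xs @ [t]" by (metis rev_exhaust)
    then have "(list_encode xs, v) \<in> edges T" using v(1) by (simp add: edges_iff verts_iff)
    then show ?thesis by blast
  qed
  show "finite (children T v)" if "v \<in> verts T" for v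
    using children_eq[OF that] finite_tokens by simp
  show "\<exists>w. (v, w) \<in> edges T" if "v \<in> verts T" for v
  proof -
    obtain t where "t \<in> tokens m (vtype m v)" using two_tokens by blast
    then have "list_encode (list_decode v @ [t]) \<in> children T v" using children_eq[OF that] by blast
    then show ?thesis by (auto simp: children_def)
  qed
qed

sublocale leafless_tree T vdepth
  by (rule leafless)

lemma vtype_child: "vtype m (list_encode (xs @ [t])) = tok_type m t"
  by (simp add: vtype_def end_type_snoc)

lemma vtype_cases: "vtype m v = 0 \<or> vtype m v = 1"
  using end_type_cases[of 0 m "list_decode v"] by (auto simp: vtype_def)

lemma all_cols_eq: "all_cols P l = tokens m l"
  using tok_type_cases by (auto simp: all_cols_def cyc_pat_def)

text \<open>Below every vertex lie, in at least two branches, vertices of both labels, so a connected set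
  containing all vertices of one label contains every vertex.\<close>

lemma label_spreads:
  assumes l: "l \<in> {0, 1}" and S: "connected_in T S"
    and lS: "{v \<in> verts T - {base T}. vtype m v = l} \<subseteq> S"
  shows "S = verts T"
proof (rule ccontr)
  assume "S \<noteq> verts T"
  then obtain v where v: "v \<in> verts T" "v \<notin> S" using S by (auto simp: connected_in_def)
  let ?x = "list_decode v"
  obtain t1 t2 where t: "t1 \<in> tokens m (vtype m v)" "t2 \<in> tokens m (vtype m v)" "t1 \<noteq> t2"
    using two_tokens by blast
  have below: "\<exists>s. list_encode (?x @ [t, s]) \<in> S" if t: "t \<in> tokens m (vtype m v)" for t
  proof -
    obtain s where s: "s \<in> tokens m (tok_type m t)" "tok_type m s = l" using token_of_type[OF l] by blast
    let ?w = "list_encode (?x @ [t, s])"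
    have "?w \<in> verts T"
      using v(1) t s by (simp add: verts_iff valid_append vtype_def)
    moreover have "vtype m ?w = l" using s vtype_child[of "?x @ [t]" s] by simp
    moreover have "?w \<noteq> base T"
      unfolding base_eq by (metis Nil_is_append_conv decode_empty list.distinct(1) list_encode_inverse)
    ultimately show ?thesis using lS by blast
  qed
  obtain s1 where s1: "list_encode (?x @ [t1, s1]) \<in> S" using below t(1) by blast
  obtain s2 where s2: "list_encode (?x @ [t2, s2]) \<in> S" using below t(2) by blast
  have "(list_encode (?x @ [t1, s1]), list_encode (?x @ [t2, s2])) \<in> (adjacency T \<inter> S \<times> S)\<^sup>*"
    using S s1 s2 by (simp add: connected_in_def)
  then have "\<exists>zs. list_decode (list_encode (?x @ [t2, s2])) = ?x @ t1 # zs"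
  proof (induction rule: rtrancl_induct)
    case base
    show ?case by simp
  next
    case (step y z)
    then obtain zs where zs: "list_decode y = ?x @ t1 # zs" by blast
    have zS: "z \<in> S" using step(2) by blast
    from step(2) consider "(y, z) \<in> edges T" | "(z, y) \<in> edges T"
      by (auto simp: adjacency_def)
    then show ?case
    proof cases
      case 1
      then show ?thesis using zs by (auto simp: edges_iff)
    next
      case 2
      then obtain t where t: "list_decode z @ [t] = ?x @ t1 # zs" using zs by (auto simp: edges_iff)
      show ?thesis
      proof (cases zs rule: rev_cases)
        case Nil
        then have "list_decode z = ?x" using t by simp
        then have "z = v" by (simp add: list_decode_eq)
        then show ?thesis using zS v(2) by blast
      next
        case (snoc zs' a)
        then have "list_decode z @ [t] = (?x @ t1 # zs') @ [a]" using t by simp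
        then show ?thesis by (metis append1_eq_conv)
      qed
    qed
  qed
  then show False using t(3) by simp
qed

lemma colouring_bij:
  assumes v: "v \<in> verts T"
  shows "bij_betw (\<lambda>u. last (list_decode u)) {u \<in> children T v. vtype m u = l}
    {t \<in> tokens m (vtype m v). tok_type m t = l}"
proof (rule bij_betwI[where g = "\<lambda>t. list_encode (list_decode v @ [t])"])
  show "(\<lambda>u. last (list_decode u)) \<in> {u \<in> children T v. vtype m u = l} \<rightarrow>
      {t \<in> tokens m (vtype m v). tok_type m t = l}"
    unfolding children_eq[OF v] by (auto simp: vtype_child)
  show "(\<lambda>t. list_encode (list_decode v @ [t])) \<in> {t \<in> tokens m (vtype m v). tok_type m t = l} \<rightarrow>
      {u \<in> children T v. vtype m u = l}"
    unfolding children_eq[OF v] by (auto simp: vtype_child)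
qed (unfold children_eq[OF v], auto)

lemma is_colouring: "is_colouring T P"
  unfolding is_colouring_def
proof (intro conjI ballI allI impI)
  show "finite (labels P)" by (simp add: cyc_pat_def)
  show "lab P ` (verts T - {base T}) \<subseteq> labels P"
    using vtype_cases by (simp add: cyc_pat_def image_subset_iff)
next
  fix v w assume v: "v \<in> verts T - {base T}" and w: "w \<in> verts T - {base T}"
    and eq: "lab P v = lab P w"
  have vw: "v \<in> verts T" "w \<in> verts T" "vtype m v = vtype m w"
    using v w eq by (simp_all add: cyc_pat_def)
  let ?f = "\<lambda>c. list_encode (list_decode w @ [last (list_decode c)])"
  have "bij_betw ?f (children T v) (children T w)"
    by (rule bij_betwI[where g = "\<lambda>c. list_encode (list_decode v @ [last (list_decode c)])"])
      (auto simp: children_eq[OF vw(1)] children_eq[OF vw(2)] vw(3))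
  moreover have "\<forall>u\<in>children T v. lab P (?f u) = lab P u"
    by (auto simp: children_eq[OF vw(1)] cyc_pat_def vtype_child)
  ultimately show "\<exists>f. bij_betw f (children T v) (children T w) \<and>
      (\<forall>u\<in>children T v. lab P (f u) = lab P u)" by blast
next
  fix l S assume "l \<in> labels P"
    "connected_in T S \<and> {v \<in> verts T - {base T}. lab P v = l} \<subseteq> S"
  then show "S = verts T" using label_spreads[of l S] by (simp add: cyc_pat_def)
next
  fix l l' show "finite (cols P l l')" using finite_tokens by (simp add: cyc_pat_def)
next
  show "disjoint_family_on (\<lambda>(l, l'). cols P l l') (labels P \<times> labels P)"
    by (auto simp: disjoint_family_on_def cyc_pat_def tokens_def)
next
  fix v l assume v: "v \<in> verts T - {base T}" and l: "l \<in> labels P"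
  then have vV: "v \<in> verts T" by blast
  note bij = colouring_bij[OF vV, of l]
  show "card (cols P (lab P v) l) = card {u \<in> children T v. lab P u = l}"
    using bij_betw_same_card[OF bij] by (simp add: cyc_pat_def)
  have "bij_betw snd {e \<in> out_edges T v. vtype m (snd e) = l} {u \<in> children T v. vtype m u = l}"
    by (rule bij_betwI[where g = "\<lambda>u. (v, u)"]) (auto simp: out_edges_def children_def)
  from bij_betw_trans[OF this bij]
  show "bij_betw (ccol P) {e \<in> out_edges T v. lab P (snd e) = l}
      (cols P (lab P v) l)"
    by (simp add: cyc_pat_def comp_def)
qed

lemma rot_comp: "compose {0..m} (rot m i) (rot m j) = rot m (i + j)"
  using m0 by (auto simp: compose_def rot_def fun_eq_iff mod_add_right_eq mod_add_left_eq ac_simps)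

lemma rot_0: "rot m 0 = (\<lambda>t\<in>{0..m}. t)"
  by (auto simp: rot_def fun_eq_iff)

lemma rot_mod: "rot m (j mod m) = rot m j"
  by (auto simp: rot_def fun_eq_iff mod_add_right_eq)

lemma rot_inverse: "\<exists>i. rot m (i + j) = rot m 0"
proof -
  have "(m - j mod m + j) mod m = 0"
  proof -
    have "(m - j mod m + j) mod m = (m - j mod m + j mod m) mod m" by (simp add: mod_add_right_eq)
    also have "\<dots> = 0" using m0 by (simp add: less_imp_le)
    finally show ?thesis .
  qed
  then have "rot m (m - j mod m + j) = rot m 0" using rot_mod[of "m - j mod m + j"] by simp
  then show ?thesis by blast
qed

lemma rot_maps: "rot m j \<in> {0..m} \<rightarrow> {0..m}"
  using m0 by (auto simp: rot_def less_imp_le)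

lemma rot_Bij: "rot m j \<in> Bij {0..m}"
proof -
  obtain i where "rot m (i + j) = rot m 0" using rot_inverse by blast
  then have left: "rot m i (rot m j t) = t" if "t \<in> {0..m}" for t
    using fun_cong[OF rot_comp[of i j], of t] that by (simp add: compose_def rot_0)
  have right: "rot m j (rot m i t) = t" if "t \<in> {0..m}" for t
    using fun_cong[OF rot_comp[of j i], of t] \<open>rot m (i + j) = rot m 0\<close> that
    by (simp add: compose_def rot_0 add.commute)
  have "bij_betw (rot m j) {0..m} {0..m}"
    by (rule bij_betwI[of _ _ _ "rot m i"]) (use rot_maps left right in auto)
  then show ?thesis by (simp add: Bij_def rot_def)
qed

lemma subgroup_rot: "subgroup (range (rot m)) (BijGroup {0..m})"
proof -
  interpret group "BijGroup {0..m}" by (rule group_BijGroup)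
  have mult: "rot m i \<otimes>\<^bsub>BijGroup {0..m}\<^esub> rot m j = rot m (i + j)" for i j
    using rot_Bij rot_comp by (simp add: BijGroup_def)
  show ?thesis
  proof (rule subgroupI)
    show "range (rot m) \<subseteq> carrier (BijGroup {0..m})" using rot_Bij by (auto simp: BijGroup_def)
    fix a assume "a \<in> range (rot m)"
    then obtain j where j: "a = rot m j" by blast
    obtain i where "rot m (i + j) = rot m 0" using rot_inverse by blast
    then have "inv\<^bsub>BijGroup {0..m}\<^esub> a = rot m i"
      using j mult rot_Bij rot_0 by (intro inv_equality) (auto simp: BijGroup_def)
    then show "inv\<^bsub>BijGroup {0..m}\<^esub> a \<in> range (rot m)" by blast
  next
    fix a b assume "a \<in> range (rot m)" "b \<in> range (rot m)"
    then show "a \<otimes>\<^bsub>BijGroup {0..m}\<^esub> b \<in> range (rot m)" using mult by auto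
  qed auto
qed

lemma rot_preserves_type:
  assumes "l' \<in> {0, 1}"
  shows "rot m j ` {t \<in> tokens m 0. tok_type m t = l'} = {t \<in> tokens m 0. tok_type m t = l'}"
proof -
  have sub: "rot m i ` {t \<in> tokens m 0. tok_type m t = l'} \<subseteq> {t \<in> tokens m 0. tok_type m t = l'}" for i
  proof -
    have less: "(t + i) mod m < m" for t using m0 by simp
    have low: "tok_type m t = 0" if "t < m" for t using that by (simp add: tok_type_def)
    show ?thesis using less low by (auto simp: tokens_def rot_def less_imp_le)
  qed
  obtain i where i: "rot m (i + j) = rot m 0" using rot_inverse by blast
  have "t \<in> rot m j ` {t \<in> tokens m 0. tok_type m t = l'}" if t: "t \<in> {t \<in> tokens m 0. tok_type m t = l'}" for t
  proof (rule image_eqI)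
    show "rot m i t \<in> {t \<in> tokens m 0. tok_type m t = l'}" using sub t by blast
    have "t \<in> {0..m}" using t by (simp add: tokens_def)
    then show "t = rot m j (rot m i t)"
      using fun_cong[OF rot_comp[of j i], of t] i by (simp add: compose_def rot_0 add.commute)
  qed
  then show ?thesis using sub by blast
qed

lemma is_patterning: "is_patterning T P"
  unfolding is_patterning_def
proof (intro conjI ballI)
  show "is_colouring T P" by (rule is_colouring)
  fix l assume "l \<in> labels P"
  then have l: "l = 0 \<or> l = 1" by (simp add: cyc_pat_def)
  have triv: "subgroup {\<lambda>t\<in>{m + 1, m + 2}. t} (BijGroup {m + 1, m + 2})"
    using group.triv_subgroup[OF group_BijGroup, of "{m + 1, m + 2}"] by (simp add: BijGroup_def)
  show "subgroup (perms P l) (BijGroup (all_cols P l))"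
    unfolding all_cols_eq using l subgroup_rot triv by (auto simp: cyc_pat_def tokens_def)
  fix f l' assume f: "f \<in> perms P l" and "l' \<in> labels P"
  then have l': "l' \<in> {0, 1}" by (simp add: cyc_pat_def)
  show "f ` cols P l l' = cols P l l'"
  proof (cases "l = 0")
    case True
    then obtain j where "f = rot m j" using f by (auto simp: cyc_pat_def)
    then show ?thesis using True rot_preserves_type[OF l'] by (simp add: cyc_pat_def)
  next
    case False
    then have "f = (\<lambda>t\<in>{m + 1, m + 2}. t)" using f by (simp add: cyc_pat_def)
    then show ?thesis using False by (auto simp: cyc_pat_def tokens_def)
  qed
qed

sublocale word_tree T vdepth P "vword m" "bits m" m
proof
  show "is_patterning T P" by (rule is_patterning)
  show "vword m (base T) = []" by (simp add: base_eq vword_def spell_def)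
  show "0 < m" by (rule m0)
  fix u v assume "(u, v) \<in> edges T"
  then obtain t where t: "list_decode v = list_decode u @ [t]" by (auto simp: edges_iff)
  then have c: "ccol P (u, v) = t" by (simp add: cyc_pat_def)
  show "vword m v = vword m u @ bits m (ccol P (u, v))"
    unfolding c by (simp add: vword_def t spell_snoc)
  show "bits m (ccol P (u, v)) \<noteq> []" using bits_nonempty[OF m0] .
next
  fix v x assume v: "v \<in> verts T" and "x \<in> cylinder (vword m v)"
  then obtain y where y: "x = vword m v \<frown> y" unfolding mem_cylinder_iff by blast
  have cyl: "x \<in> cylinder (vword m (list_encode (list_decode v @ [t]))) \<longleftrightarrow> y \<in> cylinder (bits m t)" for t
  proof -
    have "x = vword m (list_encode (list_decode v @ [t])) \<frown> z \<longleftrightarrow> y = bits m t \<frown> z" for z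
      unfolding y vword_def list_encode_inverse spell_snoc conc_conc[symmetric] by (rule same_concat_eq)
    then show ?thesis unfolding mem_cylinder_iff by blast
  qed
  have ex1: "\<exists>!t. t \<in> tokens m (vtype m v) \<and> y \<in> cylinder (bits m t)"
    using token_unique[OF m0, of "vtype m v" y] vtype_cases by blast
  then obtain t where t: "t \<in> tokens m (vtype m v) \<and> y \<in> cylinder (bits m t)" by blast
  show "\<exists>!c. c \<in> children T v \<and> x \<in> cylinder (vword m c)"
  proof (rule ex1I[of _ "list_encode (list_decode v @ [t])"])
    show "list_encode (list_decode v @ [t]) \<in> children T v \<and>
        x \<in> cylinder (vword m (list_encode (list_decode v @ [t])))"
      using t cyl children_eq[OF v] by blast
    fix c assume c: "c \<in> children T v \<and> x \<in> cylinder (vword m c)"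
    then obtain t' where t': "t' \<in> tokens m (vtype m v)" "c = list_encode (list_decode v @ [t'])"
      unfolding children_eq[OF v] by blast
    then have "y \<in> cylinder (bits m t')" using c cyl by blast
    then have "t' = t" using ex1_unique[OF ex1] t t'(1) by blast
    then show "c = list_encode (list_decode v @ [t])" using t'(2) by simp
  qed
next
  fix v s z s' assume v: "v \<in> verts T" and w: "vword m v = s @ z" and z: "m \<le> length z"
  have "spelled m (vtype m v) (s @ z)"
    using spelled_spell[OF _ m0, of "list_decode v"] v w by (simp add: verts_iff vword_def vtype_def)
  then have "spelled m (vtype m v) (s' @ z)" using spelled_tail z m0 by blast
  then obtain ts where "valid m 0 ts" "end_type m 0 ts = vtype m v" "spell m ts = s' @ z"
    using spelled_imp_spell[OF m0] by blast
  then show "\<exists>v'\<in>verts T. vword m v' = s' @ z \<and> lab P v' = lab P v"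
    by (intro bexI[of _ "list_encode ts"]) (simp_all add: verts_iff vword_def cyc_pat_def vtype_def)
qed

section \<open>Rotations below a vertex\<close>

text \<open>Rotates the token after the prefix \<open>pre\<close>, provided that it is one of the first \<open>m\<close> tokens.\<close>

definition rot_at :: "nat list \<Rightarrow> nat \<Rightarrow> nat list \<Rightarrow> nat list" where
  "rot_at pre j xs = (if length pre < length xs \<and> take (length pre) xs = pre \<and> xs ! length pre < m
     then pre @ ((xs ! length pre + j) mod m) # drop (Suc (length pre)) xs else xs)"

lemma rot_at_in: "t < m \<Longrightarrow> rot_at pre j (pre @ t # zs) = pre @ ((t + j) mod m) # zs"
  by (simp add: rot_at_def)

lemma rot_at_out:
  assumes "\<And>t zs. t < m \<Longrightarrow> xs \<noteq> pre @ t # zs" shows "rot_at pre j xs = xs"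
proof -
  have "xs = pre @ xs ! length pre # drop (Suc (length pre)) xs"
    if "length pre < length xs" "take (length pre) xs = pre"
    using id_take_nth_drop[OF that(1)] that(2) by simp
  then show ?thesis using assms by (auto simp: rot_at_def)
qed

lemma rot_at_cases:
  obtains (inside) t zs where "xs = pre @ t # zs" "t < m" | (outside) "\<And>t zs. t < m \<Longrightarrow> xs \<noteq> pre @ t # zs"
  by blast

lemma mod_less_m: "a mod m < m"
  using m0 by simp

lemma rot_at_comp: "rot_at pre i (rot_at pre j xs) = rot_at pre (i + j) xs"
proof (cases xs pre rule: rot_at_cases)
  case (inside t zs)
  have "((t + j) mod m + i) mod m = (t + j + i) mod m" by (rule mod_add_left_eq)
  also have "t + j + i = t + (i + j)" by simp
  finally have "((t + j) mod m + i) mod m = (t + (i + j)) mod m" .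
  then show ?thesis using inside mod_less_m by (simp add: rot_at_in)
next
  case outside
  then show ?thesis by (simp add: rot_at_out)
qed

lemma rot_at_multiple: "j mod m = 0 \<Longrightarrow> rot_at pre j xs = xs"
proof (cases xs pre rule: rot_at_cases)
  case (inside t zs)
  assume "j mod m = 0"
  then have "(t + j) mod m = t" using inside(2) by (metis add.right_neutral mod_add_right_eq mod_less)
  then show ?thesis using inside by (simp add: rot_at_in)
qed (simp add: rot_at_out)

text \<open>Away from \<open>pre\<close> itself the rotation leaves the last token alone. So the automorphism built from it
has a nontrivial local permutation at one vertex only.\<close>

lemma rot_at_snoc:
  assumes "xs \<noteq> pre" shows "rot_at pre j (xs @ [t]) = rot_at pre j xs @ [t]"
proof (cases xs pre rule: rot_at_cases)
  case (inside s zs)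
  then show ?thesis using rot_at_in[of s pre j "zs @ [t]"] by (simp add: rot_at_in)
next
  case outside
  have "xs @ [t] \<noteq> pre @ s # zs" if s: "s < m" for s zs
  proof (cases zs rule: rev_cases)
    case Nil
    then show ?thesis using assms by simp
  next
    case (snoc zs' a)
    then show ?thesis using outside[OF s, of zs'] by simp
  qed
  then show ?thesis using outside by (simp add: rot_at_out)
qed

lemma rot_at_short: "length xs \<le> length pre \<Longrightarrow> rot_at pre j xs = xs"
  by (simp add: rot_at_def)

lemma rot_at_child: "t \<in> {0..m} \<Longrightarrow> rot_at pre j (pre @ [t]) = pre @ [rot m j t]"
  by (simp add: rot_at_def rot_def)

lemma valid_rot_at: "valid m 0 xs \<Longrightarrow> valid m 0 (rot_at pre j xs) \<and> end_type m 0 (rot_at pre j xs) = end_type m 0 xs"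
proof (cases xs pre rule: rot_at_cases)
  case (inside t zs)
  assume v: "valid m 0 xs"
  have types: "tok_type m t = 0" "tok_type m ((t + j) mod m) = 0"
    using inside mod_less_m by (simp_all add: tok_type_def)
  have "end_type m 0 pre = 0" using v inside by (auto simp: valid_append tokens_def split: if_splits)
  then show ?thesis
    using v inside types mod_less_m[of "t + j"]
    by (simp add: rot_at_in valid_append end_type_append tokens_def less_imp_le)
qed (simp add: rot_at_out)

definition twist :: "nat list \<Rightarrow> nat \<Rightarrow> nat \<Rightarrow> nat" where
  "twist pre j = (\<lambda>v\<in>verts T. list_encode (rot_at pre j (list_decode v)))"

lemma twist_decode: "v \<in> verts T \<Longrightarrow> list_decode (twist pre j v) = rot_at pre j (list_decode v)"
  by (simp add: twist_def)

lemma twist_verts: "v \<in> verts T \<Longrightarrow> twist pre j v \<in> verts T"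
  using valid_rot_at by (simp add: verts_iff twist_decode)

lemma twist_comp: "v \<in> verts T \<Longrightarrow> twist pre i (twist pre j v) = twist pre (i + j) v"
  using twist_verts[of v pre j] twist_decode[of v pre j] by (simp add: twist_def rot_at_comp)

lemma twist_multiple: "v \<in> verts T \<Longrightarrow> j mod m = 0 \<Longrightarrow> twist pre j v = v"
  by (simp add: twist_def rot_at_multiple)

lemma twist_inverse:
  obtains i where "\<And>v. v \<in> verts T \<Longrightarrow> twist pre i (twist pre j v) = v"
    "\<And>v. v \<in> verts T \<Longrightarrow> twist pre j (twist pre i v) = v"
proof -
  have "(m - j mod m + j) mod m = (m - j mod m + j mod m) mod m" by (simp add: mod_add_right_eq)
  also have "\<dots> = 0" using mod_less_m[of j] by simp
  finally have i: "(m - j mod m + j) mod m = 0" .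
  then show thesis
    using that[of "m - j mod m"] by (simp add: twist_comp twist_multiple add.commute)
qed

lemma twist_edge:
  assumes e: "(u, v) \<in> edges T"
  shows "(twist pre j u, twist pre j v) \<in> edges T"
proof -
  obtain t where t: "list_decode v = list_decode u @ [t]" using e by (auto simp: edges_iff)
  have uv: "u \<in> verts T" "v \<in> verts T" using edge_verts[OF e] by auto
  have "\<exists>t'. rot_at pre j (list_decode v) = rot_at pre j (list_decode u) @ [t']"
  proof (cases "list_decode u = pre")
    case True
    then show ?thesis using t by (auto simp: rot_at_def)
  qed (use t rot_at_snoc in simp)
  then show ?thesis using twist_verts[OF uv(2)] uv by (simp add: edges_iff twist_decode verts_iff)
qed

lemma twist_Aut: "twist pre j \<in> Aut T"
proof -
  obtain i where i: "\<And>v. v \<in> verts T \<Longrightarrow> twist pre i (twist pre j v) = v"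
    "\<And>v. v \<in> verts T \<Longrightarrow> twist pre j (twist pre i v) = v"
    using twist_inverse by blast
  have "bij_betw (twist pre j) (verts T) (verts T)"
    by (rule bij_betwI[of _ _ _ "twist pre i"]) (use twist_verts i in auto)
  moreover have "twist pre j \<in> extensional (verts T)" by (simp add: twist_def)
  moreover have "twist pre j (base T) = base T"
    by (simp add: twist_def base_eq verts_iff rot_at_def)
  moreover have "(u, v) \<in> edges T \<longleftrightarrow> (twist pre j u, twist pre j v) \<in> edges T"
    if "u \<in> verts T" "v \<in> verts T" for u v
    using twist_edge[of u v pre j] twist_edge[of "twist pre j u" "twist pre j v" pre i] i that by auto
  ultimately show ?thesis by (simp add: Aut_def Bij_def)
qed

lemma twist_colour:
  assumes e: "(u, v) \<in> edges T" and u: "list_decode u \<noteq> pre"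
  shows "ccol P (twist pre j u, twist pre j v) = ccol P (u, v)"
proof -
  obtain t where t: "list_decode v = list_decode u @ [t]" using e by (auto simp: edges_iff)
  have "v \<in> verts T" using edge_verts[OF e] by auto
  then show ?thesis using t rot_at_snoc[OF u] by (simp add: cyc_pat_def twist_decode)
qed

text \<open>The local permutation is \<open>rot m j\<close> at the vertex \<open>pre\<close>, if that has label \<open>0\<close>, and trivial elsewhere.\<close>

lemma twist_Aut_pat: "twist pre j \<in> Aut_pat T P"
  unfolding Aut_pat_iff
proof (intro conjI ballI)
  show "twist pre j \<in> Aut T" by (rule twist_Aut)
  fix v assume "v \<in> verts T - {base T}"
  then have v: "v \<in> verts T" "v \<noteq> base T" by auto
  have lab: "lab P (twist pre j v) = lab P v"
    using valid_rot_at v by (simp add: cyc_pat_def vtype_def twist_decode verts_iff)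
  show "locally_patterned (twist pre j) v"
  proof (cases "list_decode v = pre \<and> vtype m v = 0")
    case False
    show ?thesis
    proof (rule locally_patterned_if_colours_kept[where f = "twist pre j", OF v lab])
      fix c assume c: "c \<in> children T v"
      then have e: "(v, c) \<in> edges T" by (simp add: children_def)
      show "ccol P (twist pre j v, twist pre j c) = ccol P (v, c)"
      proof (cases "list_decode v = pre")
        case True
        then have "vtype m v \<noteq> 0" using False by simp
        then obtain t where t: "list_decode c = pre @ [t]" "\<not> t < m"
          using c True unfolding children_eq[OF v(1)] by (auto simp: tokens_def)
        then have "rot_at pre j (list_decode c) = list_decode c" by (simp add: rot_at_def)
        then show ?thesis using edge_verts[OF e] by (simp add: cyc_pat_def twist_decode)
      qed (rule twist_colour[OF e])
    qed
  next
    case True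
    have "ccol P (twist pre j v, twist pre j c) = rot m j (ccol P (v, c))"
      if c: "c \<in> children T v" for c
    proof -
      obtain t where t: "t \<in> {0..m}" "list_decode c = pre @ [t]"
        using c True unfolding children_eq[OF v(1)] by (auto simp: tokens_def)
      then have "rot_at pre j (list_decode c) = pre @ [rot m j t]" using rot_at_child by simp
      then show ?thesis using child_vert[OF c] t(2) by (simp add: cyc_pat_def twist_decode)
    qed
    then show ?thesis
      unfolding locally_patterned_def using lab True by (auto simp: cyc_pat_def)
  qed
qed

lemma twist_stabiliser: "n \<le> length pre \<Longrightarrow> twist pre j \<in> stabiliser n"
  unfolding stabiliser_def using twist_Aut_pat
  by (auto simp: twist_def vdepth_def rot_at_short)

text \<open>Prefixes of growing length, none of which extends another, so that rotations below them are
small and have disjoint supports.\<close>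

definition branch :: "nat \<Rightarrow> nat list" where
  "branch k = replicate k 0 @ [1]"

lemma branch_incomparable:
  assumes "i \<noteq> j" shows "branch i @ t # zs \<noteq> branch j @ t' # zs'"
proof -
  have *: "branch i @ ys \<noteq> branch j @ ys'" if "i < j" for i j and ys ys' :: "nat list"
  proof
    assume "branch i @ ys = branch j @ ys'"
    then have "(branch i @ ys) ! i = (branch j @ ys') ! i" by simp
    then show False using that by (simp add: branch_def nth_append)
  qed
  show ?thesis using *[of i j "t # zs" "t' # zs'"] *[of j i "t' # zs'" "t # zs"] assms
    by (metis linorder_neqE_nat)
qed

lemma branch_vertex: "list_encode (branch k @ [0]) \<in> verts T"
proof -
  have "valid m 0 (replicate k 0 @ [1, 0])"
    using m2 by (induction k) (auto simp: tokens_def tok_type_def)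
  then show ?thesis by (simp add: verts_iff branch_def)
qed

lemma rot_at_branch_commute:
  "rot_at (branch i) a (rot_at (branch j) b xs) = rot_at (branch j) b (rot_at (branch i) a xs)"
proof (cases "i = j")
  case True
  then show ?thesis by (simp add: rot_at_comp add.commute)
next
  case False
  have out: "rot_at (branch i) a (branch j @ t # zs) = branch j @ t # zs"
      "rot_at (branch j) b (branch i @ t # zs) = branch i @ t # zs" for t zs
    using branch_incomparable[OF False] branch_incomparable[OF False[symmetric]]
    by (auto intro!: rot_at_out)
  show ?thesis
  proof (cases xs "branch j" rule: rot_at_cases)
    case (inside t zs)
    then show ?thesis by (simp add: rot_at_in out)
  next
    case outside
    then have o: "rot_at (branch j) b xs = xs" by (rule rot_at_out)
    show ?thesis
    proof (cases xs "branch i" rule: rot_at_cases)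
      case (inside t zs)
      then show ?thesis by (simp add: rot_at_in out)
    next
      case outside
      then show ?thesis using o by (simp add: rot_at_out)
    qed
  qed
qed

definition twist_germ :: "nat \<Rightarrow> (nat \<rightharpoonup> nat) set" where
  "twist_germ k = aaut_of_aut T (twist (branch k) 1)"

lemma twist_germ_stab: "n \<le> k \<Longrightarrow> twist_germ k \<in> stab_germs n"
  unfolding twist_germ_def
  by (rule aaut_of_aut_in_stab_germs, rule twist_stabiliser) (simp add: branch_def)

lemma twist_moves:
  "twist (branch k) 1 (list_encode (branch k @ [0])) \<noteq> list_encode (branch k @ [0])"
  "i \<noteq> k \<Longrightarrow> twist (branch i) 1 (list_encode (branch k @ [0])) = list_encode (branch k @ [0])"
proof -
  have "rot_at (branch k) 1 (branch k @ [0]) = branch k @ [1]"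
    using m2 rot_at_in[of 0 "branch k" 1 "[]"] by simp
  then have "list_decode (twist (branch k) 1 (list_encode (branch k @ [0]))) \<noteq> branch k @ [0]"
    using twist_decode[OF branch_vertex] by simp
  then show "twist (branch k) 1 (list_encode (branch k @ [0])) \<noteq> list_encode (branch k @ [0])" by auto
  assume "i \<noteq> k"
  then have "rot_at (branch i) 1 (branch k @ [0]) = branch k @ [0]"
    using branch_incomparable[of k i 0 "[]"] by (intro rot_at_out) simp
  then show "twist (branch i) 1 (list_encode (branch k @ [0])) = list_encode (branch k @ [0])"
    using branch_vertex by (simp add: twist_def)
qed

lemma twist_germ_inj: "inj twist_germ"
proof (rule injI, rule ccontr)
  fix i k assume eq: "twist_germ i = twist_germ k" and ne: "i \<noteq> k"
  have "twist (branch i) 1 = twist (branch k) 1"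
    using inj_onD[OF aaut_of_aut_inj] eq twist_Aut_pat unfolding twist_germ_def by blast
  then show False using twist_moves(1)[of k] twist_moves(2)[OF ne] by simp
qed

lemma twist_germ_ne_one: "twist_germ k \<noteq> \<one>\<^bsub>G\<^esub>"
  unfolding twist_germ_def aaut_of_aut_eq_one[OF twist_Aut]
  using twist_moves(1) branch_vertex by blast

lemma twist_germ_pow: "twist_germ k [^]\<^bsub>G\<^esub> m = \<one>\<^bsub>G\<^esub>"
proof -
  have "(twist (branch k) 1 ^^ n) v = twist (branch k) n v" if v: "v \<in> verts T" for n v
  proof (induction n)
    case 0
    then show ?case using twist_multiple[OF v, of 0] by simp
  next
    case (Suc n)
    then show ?case using twist_comp[OF v, of "branch k" 1 n] by simp
  qed
  then show ?thesis
    unfolding twist_germ_def aaut_of_aut_pow_eq_one[OF twist_Aut_pat] using twist_multiple[where j = m] by simp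
qed

lemma twist_germ_commute:
  "twist_germ i \<otimes>\<^bsub>G\<^esub> twist_germ j =
   twist_germ j \<otimes>\<^bsub>G\<^esub> twist_germ i"
proof -
  have ex: "\<exists>h\<in>Aut_pat T P. twist_germ i \<otimes>\<^bsub>G\<^esub> twist_germ j =
      aaut_of_aut T h" for i j
    using subgroup.m_closed[OF stab_germs_subgroup twist_germ_stab[of 0 i] twist_germ_stab[of 0 j]]
    unfolding stab_germs_0 by auto
  obtain h where h: "h \<in> Aut_pat T P"
      "twist_germ i \<otimes>\<^bsub>G\<^esub> twist_germ j = aaut_of_aut T h" using ex by blast
  obtain h' where h': "h' \<in> Aut_pat T P"
      "twist_germ j \<otimes>\<^bsub>G\<^esub> twist_germ i = aaut_of_aut T h'" using ex by blast
  have "h v = h' v" if v: "v \<in> verts T" for v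
  proof -
    have "h v = twist (branch i) 1 (twist (branch j) 1 v)" "h' v = twist (branch j) 1 (twist (branch i) 1 v)"
      using aut_mult[OF twist_Aut_pat twist_Aut_pat h(1) h(2)[unfolded twist_germ_def] v]
        aut_mult[OF twist_Aut_pat twist_Aut_pat h'(1) h'(2)[unfolded twist_germ_def] v] by simp_all
    then have "list_decode (h v) = list_decode (h' v)"
      using v twist_verts by (simp add: twist_decode rot_at_branch_commute)
    then show ?thesis by (simp add: list_decode_eq)
  qed
  then have "h = h'"
    using extensionalityI[OF AutD(1)[OF Aut_pat_Aut[OF h(1)]] AutD(1)[OF Aut_pat_Aut[OF h'(1)]]] by blast
  then show ?thesis using h h' by simp
qed

text \<open>Deeper than the rotated vertex all colours are kept.\<close>

lemma twist_germ_realised: "\<exists>g\<in>carrier thompson_V. embed g = twist_germ k"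
proof -
  have "twist_germ k \<in> carrier G"
    using twist_germ_stab[of 0 k] W_carrier by blast
  then obtain \<phi> where \<phi>: "patterned_map \<phi>" "twist_germ k = germ \<phi>" by (auto simp: carrier_AAut_pat)
  note iso = patterned_mapD(1)[OF \<phi>(1)]
  have "germ \<phi> = germ (as_map (twist (branch k) 1))"
    using \<phi>(2) by (simp add: twist_germ_def aaut_of_aut_eq[OF twist_Aut])
  then have "almost_eq \<phi> (as_map (twist (branch k) 1))"
    using germ_eq_iff[OF iso almost_iso_as_map[OF twist_Aut]] by blast
  then obtain N where N: "\<And>v. N \<le> vdepth v \<Longrightarrow> \<phi> v = as_map (twist (branch k) 1) v"
    using almost_eq_deep by blast
  define n where "n = max N (k + 2)"
  have eq: "\<phi> v = Some (twist (branch k) 1 v)" if "v \<in> verts T" "n \<le> vdepth v" for v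
    using N[of v] that by (simp add: n_def as_map_def)
  have col: "ccol P (the (\<phi> u), the (\<phi> v)) = ccol P (u, v)"
    if e: "(u, v) \<in> edges T" and d: "n \<le> vdepth u" for u v
  proof -
    have "list_decode u \<noteq> branch k" using d by (auto simp: n_def vdepth_def branch_def)
    then have "ccol P (twist (branch k) 1 u, twist (branch k) 1 v) = ccol P (u, v)"
      by (rule twist_colour[OF e])
    then show ?thesis using eq edge_verts[OF e] depth_edge[OF e] d by simp
  qed
  have deep: "{v \<in> verts T. n \<le> vdepth v} \<subseteq> dom \<phi>" using eq by auto
  obtain g where "g \<in> carrier thompson_V" "embed g = germ \<phi>"
    using colour_preserving_germ_realised[OF \<phi>(1) deep col] by blast
  then show ?thesis using \<phi>(2) by auto
qed

lemma rot_iterate: "t \<in> {0..m} \<Longrightarrow> (rot m j ^^ k) t = rot m (k * j) t"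
proof (induction k)
  case (Suc k)
  then show ?case
    using fun_cong[OF rot_comp[of j "k * j"], of t] by (simp add: compose_def add.commute)
qed (simp add: rot_0)

text \<open>If \<open>m\<close> divides \<open>p j\<close>, then it divides \<open>j\<close>.\<close>

lemma rot_coprime_fixed:
  assumes "coprime p m" "t \<in> {0..m}" "rot m (p * j) t = t"
  shows "rot m j t = t"
proof (cases "t < m")
  case True
  then have "(t + p * j) mod m = t" using assms by (simp add: rot_def)
  then have "m dvd p * j"
    using True by (metis add_diff_cancel_left' mod_eq_dvd_iff_nat mod_less le_add1)
  then have "m dvd j" using assms(1) by (simp add: coprime_commute coprime_dvd_mult_right_iff)
  then have "(t + j) mod m = t" using True by (auto elim!: dvdE)
  then show ?thesis using True by (simp add: rot_def)
qed (use assms(2) in \<open>simp add: rot_def\<close>)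

text \<open>By induction on the depth, \<open>g\<close> fixes every vertex: with the parent \<open>u\<close> of \<open>v\<close> fixed, \<open>g\<close> permutes the children of \<open>u\<close>
by a rotation of colours, and \<open>g\<^sup>p = 1\<close> makes the \<open>p\<close>-th power of that rotation fix the colour of \<open>v\<close>. The
first level is assumed to be fixed since at the root all permutations of children with equal label
are allowed.\<close>

lemma no_coprime_torsion:
  assumes p: "coprime p m" and x: "x \<in> stab_germs 1"
    and pow: "x [^]\<^bsub>G\<^esub> p = \<one>\<^bsub>G\<^esub>"
  shows "x = \<one>\<^bsub>G\<^esub>"
proof -
  obtain g where g: "g \<in> stabiliser 1" "x = aaut_of_aut T g" using x unfolding stab_germs_def by blast
  have gP: "g \<in> Aut_pat T P" and fixes1: "\<And>v. v \<in> verts T \<Longrightarrow> vdepth v \<le> 1 \<Longrightarrow> g v = v"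
    using g(1) by (auto simp: stabiliser_def)
  note gA = Aut_pat_Aut[OF gP]
  have gp: "(g ^^ p) v = v" if "v \<in> verts T" for v
    using pow aaut_of_aut_pow_eq_one[OF gP] that g(2) by blast
  have "g v = v" if "v \<in> verts T" for v
    using that
  proof (induction rule: tree_induct)
    case base
    then show ?case using AutD(3)[OF gA] .
  next
    case (child u v)
    note e = child(2)
    have vV: "v \<in> verts T" using edge_verts[OF e] by blast
    show ?case
    proof (cases "u = base T")
      case True
      then show ?thesis using fixes1[OF vV] depth_edge[OF e] depth_base by simp
    next
      case False
      then have "locally_patterned g u" using gP child(1) by (simp add: Aut_pat_iff)
      then obtain \<sigma> where \<sigma>: "\<sigma> \<in> perms P (vtype m u)"
          "\<And>c. c \<in> children T u \<Longrightarrow> ccol P (u, g c) = \<sigma> (ccol P (u, c))"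
        unfolding locally_patterned_def child(3) by (auto simp: cyc_pat_def)
      have g_child: "g c \<in> children T u" if c: "c \<in> children T u" for c
        using AutD(4)[OF gA child(1), of c] child_vert[OF c] c child(3) by (simp add: children_def)
      have iter: "(g ^^ k) v \<in> children T u \<and>
          ccol P (u, (g ^^ k) v) = (\<sigma> ^^ k) (ccol P (u, v))" for k
      proof (induction k)
        case 0
        then show ?case using e by (simp add: children_def)
      next
        case (Suc k)
        then show ?case using g_child \<sigma>(2) by simp
      qed
      let ?t = "ccol P (u, v)"
      have vc: "v \<in> children T u" using e by (simp add: children_def)
      have t: "?t \<in> tokens m (vtype m u)"
        using colour_mem_all[OF child(1) False vc] by (simp add: all_cols_eq) (simp add: cyc_pat_def)
      have fixed: "(\<sigma> ^^ p) ?t = ?t" using iter[of p] gp[OF vV] by simp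
      have "\<sigma> ?t = ?t"
      proof (cases "vtype m u = 0")
        case True
        then obtain j where j: "\<sigma> = rot m j" using \<sigma>(1) by (auto simp: cyc_pat_def)
        have t0: "?t \<in> {0..m}" using t True by (simp add: tokens_def)
        have "rot m (p * j) ?t = ?t" using fixed rot_iterate[OF t0] j by simp
        then show ?thesis using rot_coprime_fixed[OF p t0] j by simp
      next
        case False
        then show ?thesis using \<sigma>(1) t by (simp add: cyc_pat_def tokens_def)
      qed
      then have "ccol P (u, g v) = ccol P (u, v)" using \<sigma>(2)[OF vc] by simp
      then show ?thesis using colour_inj[OF child(1) False g_child[OF vc] vc] by simp
    qed
  qed
  then show ?thesis using g(2) aaut_of_aut_eq_one[OF gA] by simp
qed

text \<open>The commensurated subgroup of \<open>V\<close> attached to the tree: the elements that act as patterned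
automorphisms of the whole tree, up to finitely many vertices.\<close>

definition thompson_stab :: "((nat \<Rightarrow> bool) \<Rightarrow> (nat \<Rightarrow> bool)) set" where
  "thompson_stab = {g \<in> carrier thompson_V. embed g \<in> stab_germs 0}"

lemma commensurated_thompson_stab: "commensurated thompson_V thompson_stab"
  unfolding thompson_stab_def
  by (rule commensurated_preimage[OF group_thompson_V embed_hom finite_ball_action ball_action_eq])

lemma hom_embed: "group_hom thompson_V G embed"
  by (intro group_hom.intro group_hom_axioms.intro group_thompson_V group_AAut_pat embed_hom)

lemma embed_pow:
  assumes "g \<in> carrier thompson_V"
  shows "embed (g [^]\<^bsub>thompson_V\<^esub> (k::nat)) = embed g [^]\<^bsub>G\<^esub> k"
proof -
  interpret V: group thompson_V by (rule group_thompson_V)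
  interpret h: group_hom thompson_V "G" embed by (rule hom_embed)
  show ?thesis using assms by (induction k) simp_all
qed

lemma embed_eq_iff:
  "g \<in> carrier thompson_V \<Longrightarrow> h \<in> carrier thompson_V \<Longrightarrow> embed g = embed h \<longleftrightarrow> g = h"
  using embed_inj by (auto dest: inj_onD)

end

section \<open>Infinitely many primes\<close>

text \<open>The rotations below the vertices \<open>branch k\<close> of the tree for \<open>p\<close> are infinitely many commuting elements
with trivial \<open>p\<close>-th power, while the first-level stabiliser of the tree for \<open>q\<close> has no such elements
except the identity.\<close>

lemma not_commensurate_thompson_stab:
  assumes "2 \<le> p" "2 \<le> q" "coprime p q"
  shows "\<not> commensurate thompson_V (cyclic_tree.thompson_stab p) (cyclic_tree.thompson_stab q)"
proof -
  interpret V: group thompson_V by (rule group_thompson_V)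
  interpret P: cyclic_tree p by unfold_locales (rule assms)
  interpret Q: cyclic_tree q by unfold_locales (rule assms)
  interpret hP: group_hom thompson_V "AAut_pat (cyc_tree p) (cyc_pat p)" P.embed by (rule P.hom_embed)
  interpret hQ: group_hom thompson_V "AAut_pat (cyc_tree q) (cyc_pat q)" Q.embed by (rule Q.hom_embed)
  obtain e where e: "\<And>k. e k \<in> carrier thompson_V" "\<And>k. P.embed (e k) = P.twist_germ k"
    using P.twist_germ_realised by metis
  show ?thesis
  proof (rule not_commensurate_if_torsion[where e = e and p = p and F = "Q.ball_action 1 \<circ> Q.embed"
        and M = "{x \<in> carrier thompson_V. Q.embed x \<in> Q.stab_germs 1}"])
    show "group thompson_V" by (rule group_thompson_V)
    show "subgroup P.thompson_stab thompson_V" "subgroup Q.thompson_stab thompson_V"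
      using P.commensurated_thompson_stab Q.commensurated_thompson_stab by (simp_all add: commensurated_def)
    show "e k \<in> P.thompson_stab" for k
      using e P.twist_germ_stab[of 0 k] by (simp add: P.thompson_stab_def)
    show "inj e"
    proof (rule injI)
      fix i j assume "e i = e j"
      then have "P.twist_germ i = P.twist_germ j" using e(2) by metis
      then show "i = j" using P.twist_germ_inj by (simp add: inj_eq)
    qed
    show "e i \<otimes>\<^bsub>thompson_V\<^esub> e j = e j \<otimes>\<^bsub>thompson_V\<^esub> e i" for i j
    proof -
      have "P.embed (e i \<otimes>\<^bsub>thompson_V\<^esub> e j) = P.embed (e j \<otimes>\<^bsub>thompson_V\<^esub> e i)"
        using e P.twist_germ_commute[of i j] by simp
      then show ?thesis
        using P.embed_eq_iff[OF V.m_closed[OF e(1)[of i] e(1)[of j]] V.m_closed[OF e(1)[of j] e(1)[of i]]]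
        by blast
    qed
    show "e k [^]\<^bsub>thompson_V\<^esub> p = \<one>\<^bsub>thompson_V\<^esub>" for k
    proof -
      have "P.embed (e k [^]\<^bsub>thompson_V\<^esub> p) = P.embed \<one>\<^bsub>thompson_V\<^esub>"
        using P.embed_pow[OF e(1)] e(2) P.twist_germ_pow by simp
      then show ?thesis using P.embed_eq_iff[OF V.nat_pow_closed[OF e(1)] V.one_closed] by blast
    qed
    show "finite ((Q.ball_action 1 \<circ> Q.embed) ` Q.thompson_stab)"
      by (rule finite_subset[OF _ Q.finite_ball_action[of 1]]) (auto simp: Q.thompson_stab_def)
    show "a \<otimes>\<^bsub>thompson_V\<^esub> inv\<^bsub>thompson_V\<^esub> b \<in> {x \<in> carrier thompson_V. Q.embed x \<in> Q.stab_germs 1}"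
      if "a \<in> Q.thompson_stab" "b \<in> Q.thompson_stab"
        "(Q.ball_action 1 \<circ> Q.embed) a = (Q.ball_action 1 \<circ> Q.embed) b" for a b
      using that Q.ball_action_eq[of "Q.embed a" "Q.embed b" 1] by (simp add: Q.thompson_stab_def)
    show "x = \<one>\<^bsub>thompson_V\<^esub>"
      if "x \<in> {x \<in> carrier thompson_V. Q.embed x \<in> Q.stab_germs 1}" "x \<in> carrier thompson_V"
        "x [^]\<^bsub>thompson_V\<^esub> p = \<one>\<^bsub>thompson_V\<^esub>" for x
    proof -
      have "Q.embed x [^]\<^bsub>AAut_pat (cyc_tree q) (cyc_pat q)\<^esub> p = \<one>\<^bsub>AAut_pat (cyc_tree q) (cyc_pat q)\<^esub>"
        using Q.embed_pow[OF that(2), of p] that(3) by simp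
      then have "Q.embed x = \<one>\<^bsub>AAut_pat (cyc_tree q) (cyc_pat q)\<^esub>"
        using Q.no_coprime_torsion[OF assms(3)] that(1) by blast
      then have "Q.embed x = Q.embed \<one>\<^bsub>thompson_V\<^esub>" by simp
      then show ?thesis using Q.embed_eq_iff[OF that(2) V.one_closed] by blast
    qed
  qed
qed

text \<open>The rotation below \<open>branch n\<close> lies in the \<open>n\<close>-th stabiliser, so there is torsion of order \<open>p\<close> in every
neighbourhood of the identity on one side and none in the first-level stabiliser on the other.\<close>

lemma not_locally_isomorphic_cyc:
  assumes "2 \<le> p" "2 \<le> q" "coprime p q"
  shows "\<not> locally_isomorphic (AAut_pat (cyc_tree p) (cyc_pat p)) (AAut_pat_topology (cyc_tree p) (cyc_pat p))
    (AAut_pat (cyc_tree q) (cyc_pat q)) (AAut_pat_topology (cyc_tree q) (cyc_pat q))"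
proof -
  interpret P: cyclic_tree p by unfold_locales (rule assms)
  interpret Q: cyclic_tree q by unfold_locales (rule assms)
  show ?thesis
    unfolding P.AAut_pat_topology_eq Q.AAut_pat_topology_eq
  proof (rule not_locally_isomorphic_if_torsion[where p = p and n = 1])
    show "filtered_group (AAut_pat (cyc_tree p) (cyc_pat p)) P.stab_germs" by (rule P.filtered_group_axioms)
    show "filtered_group (AAut_pat (cyc_tree q) (cyc_pat q)) Q.stab_germs" by (rule Q.filtered_group_axioms)
    show "\<exists>x\<in>P.stab_germs n. x \<noteq> \<one>\<^bsub>AAut_pat (cyc_tree p) (cyc_pat p)\<^esub> \<and>
        x [^]\<^bsub>AAut_pat (cyc_tree p) (cyc_pat p)\<^esub> p = \<one>\<^bsub>AAut_pat (cyc_tree p) (cyc_pat p)\<^esub>" for n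
      by (intro bexI[of _ "P.twist_germ n"] conjI P.twist_germ_ne_one P.twist_germ_pow
          P.twist_germ_stab order_refl)
  qed (rule Q.no_coprime_torsion[OF assms(3)])
qed

theorem corollary1p5:
  shows "infinite ({U. commensurated thompson_V U} // commensuration thompson_V) \<and>
    (\<exists>(\<T> :: nat \<Rightarrow> nat rooted_tree) (\<P> :: nat \<Rightarrow> (nat, nat, nat) patterning).
      (\<forall>n. locally_finite_rooted_tree (\<T> n) \<and> is_patterning (\<T> n) (\<P> n) \<and>
           topological_group (AAut_pat (\<T> n) (\<P> n)) (AAut_pat_topology (\<T> n) (\<P> n)) \<and>
           embeds_densely thompson_V (AAut_pat (\<T> n) (\<P> n))
             (AAut_pat_topology (\<T> n) (\<P> n))) \<and>
      (\<forall>m n. m \<noteq> n \<longrightarrow>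
         \<not> locally_isomorphic
             (AAut_pat (\<T> m) (\<P> m)) (AAut_pat_topology (\<T> m) (\<P> m))
             (AAut_pat (\<T> n) (\<P> n)) (AAut_pat_topology (\<T> n) (\<P> n))))"
proof -
  obtain f :: "nat \<Rightarrow> nat" where f: "inj f" "range f \<subseteq> {p. prime p}"
    using infinite_countable_subset[OF primes_infinite] by blast
  have prime: "prime (f n)" for n using f(2) by blast
  have ge2: "2 \<le> f n" for n using prime by (simp add: prime_ge_2_nat)
  have coprime: "coprime (f k) (f n)" if "k \<noteq> n" for k n
    using primes_coprime[OF prime prime] f(1) that by (simp add: inj_eq)
  let ?C = "\<lambda>n. commensuration thompson_V `` {cyclic_tree.thompson_stab (f n)}"
  have tree: "cyclic_tree (f n)" for n by unfold_locales (rule ge2)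
  have com: "commensurated thompson_V (cyclic_tree.thompson_stab (f n))" for n
    by (rule cyclic_tree.commensurated_thompson_stab[OF tree])
  have refl: "commensurate thompson_V U U" if U: "subgroup U thompson_V" for U
    using rcosets_finiteI[OF group_thompson_V U U, of "\<lambda>_. ()"] group.subgroup_div[OF group_thompson_V U] U
    by (simp add: commensurate_def)
  have inj: "inj ?C"
  proof (rule injI, rule ccontr)
    fix k n assume eq: "?C k = ?C n" and ne: "k \<noteq> n"
    have "cyclic_tree.thompson_stab (f n) \<in> ?C n"
      using refl com by (simp add: commensuration_def commensurated_def)
    then have "commensurate thompson_V (cyclic_tree.thompson_stab (f k)) (cyclic_tree.thompson_stab (f n))"
      unfolding eq[symmetric] by (simp add: commensuration_def)
    then show False using not_commensurate_thompson_stab[OF ge2 ge2 coprime[OF ne]] by blast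
  qed
  have "range ?C \<subseteq> {U. commensurated thompson_V U} // commensuration thompson_V"
    using com by (auto simp: quotient_def)
  then have "infinite ({U. commensurated thompson_V U} // commensuration thompson_V)"
    using range_inj_infinite[OF inj] finite_subset by blast
  moreover have each: "locally_finite_rooted_tree (cyc_tree (f n)) \<and> is_patterning (cyc_tree (f n)) (cyc_pat (f n)) \<and>
      topological_group (AAut_pat (cyc_tree (f n)) (cyc_pat (f n))) (AAut_pat_topology (cyc_tree (f n)) (cyc_pat (f n))) \<and>
      embeds_densely thompson_V (AAut_pat (cyc_tree (f n)) (cyc_pat (f n)))
        (AAut_pat_topology (cyc_tree (f n)) (cyc_pat (f n)))" for n
  proof -
    interpret cyclic_tree "f n" by (rule tree)
    show ?thesis
      using locally_finite_rooted_tree is_patterning topological_group_filtration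
        thompson_V_embeds_densely by (simp add: AAut_pat_topology_eq)
  qed
  moreover from each have "\<forall>n. locally_finite_rooted_tree (cyc_tree (f n)) \<and> is_patterning (cyc_tree (f n)) (cyc_pat (f n)) \<and>
      topological_group (AAut_pat (cyc_tree (f n)) (cyc_pat (f n))) (AAut_pat_topology (cyc_tree (f n)) (cyc_pat (f n))) \<and>
      embeds_densely thompson_V (AAut_pat (cyc_tree (f n)) (cyc_pat (f n)))
        (AAut_pat_topology (cyc_tree (f n)) (cyc_pat (f n)))" ..
  moreover have "\<forall>k n. k \<noteq> n \<longrightarrow>
      \<not> locally_isomorphic
        (AAut_pat (cyc_tree (f k)) (cyc_pat (f k))) (AAut_pat_topology (cyc_tree (f k)) (cyc_pat (f k)))
        (AAut_pat (cyc_tree (f n)) (cyc_pat (f n))) (AAut_pat_topology (cyc_tree (f n)) (cyc_pat (f n)))"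
    using not_locally_isomorphic_cyc[OF ge2 ge2 coprime] by blast
  ultimately show ?thesis
    by (intro conjI exI[of _ "\<lambda>n. cyc_tree (f n)"] exI[of _ "\<lambda>n. cyc_pat (f n)"])
qed

end
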